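(* Let $p>1$, let $\{e_n\}_{n=1}^{\infty}$ be a symmetric basis of $\ell_p$, let $k\in\mathbb{N}$ and let $\{f(n)\}_{n=1}^{\infty}\in\mathcal{S}_k$. Then $\{e_n\}_{n=1}^{\infty}$ does not form a (Schauder) basis of $\ell_{p,k}(\{e_n\})$, and the operator $A_k:\ell_{p,k}(\{e_n\})\supset D(A_k)\to \ell_{p,k}(\{e_n\})$ defined by $$A_k\,(\mathfrak{f})\sum_{n=1}^{\infty}c_ne_n=(\mathfrak{f})\sum_{n=1}^{\infty}i f(n)\, c_ne_n,$$ $$D(A_k)=\Bigl\{x=(\mathfrak{f})\sum_{n=1}^{\infty}c_ne_n\in \ell_{p,k}(\{e_n\}):\ \{f(n)c_n\}_{n=1}^{\infty}\in\ell_p(\Delta^k)\Bigr\},$$ generates a $C_0$-group $\{e^{A_kt}\}_{t\in\mathbb{R}}$ on $\ell_{p,k}(\{e_n\})$, which acts for every $t\in\mathbb{R}$ by the formula $$e^{A_kt}\,(\mathfrak{f})\sum_{n=1}^{\infty}c_ne_n=(\mathfrak{f})\sum_{n=1}^{\infty}e^{itf(n)}c_ne_n .$$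
   Context: For a sequence $\{u_n\}_{n=1}^\infty$ put $u_{m}=0$ for all integers $m\le 0$ and $\Delta^k u_n=\sum_{j=0}^k(-1)^j\binom{k}{j}u_{n-j}$, $n\ge1$. The class $\mathcal{S}_k$ consists of all real sequences $\{f(n)\}_{n=1}^\infty$ such that $\lim_{n\to\infty}f(n)=+\infty$ and $\{n^j\Delta^jf(n)\}_{n=1}^\infty\in\ell_\infty$ for every $1\le j\le k$. A Schauder basis $\{e_n\}$ of a Banach space is symmetric if for every permutation $\pi$ of $\mathbb{N}$ the sequence $\{e_{\pi(n)}\}$ is a basis equivalent to $\{e_n\}$. (It is known that every symmetric basis of $\ell_p$, $p\ge 1$, is equivalent to the canonical one, i.e. there are $M\ge m>0$ with $m\sum|c_n|^p\le\|\sum c_ne_n\|^p\le M\sum|c_n|^p$.) $\ell_p(\Delta^k)$ is the set of complex sequences $\{c_n\}_{n=1}^\infty$ with $\{\Delta^kc_n\}_{n=1}^\infty\in\ell_p$. $(\mathfrak{f})\sum_{n=1}^\infty c_ne_n$ denotes a formal series, i.e. it is identified with its coefficient sequence (no convergence is required). $\ell_{p,k}(\{e_n\})$ is the Banach space of formal series $x=(\mathfrak{f})\sum_{n=1}^\infty c_ne_n$ with $\{c_n\}\in\ell_p(\Delta^k)$, with coefficientwise linear operations and norm $\|x\|_k=\bigl\|\sum_{n=1}^\infty(\Delta^kc_n)e_n\bigr\|$, where $\|\cdot\|$ is the norm of $\ell_p$. The vector $e_n$ is regarded as an element of $\ell_{p,k}(\{e_n\})$ via the formal series with single nonzero coefficient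 $c_n=1$. *)

theory Defs
  imports "HOL-Analysis.Analysis"
begin

text \<open>Sequences are indexed from 0: index \<open>n\<close> here stands for index \<open>n + 1\<close> in the
  one-based notation. A normed space of complex sequences is given by its carrier \<open>V\<close> and
  its norm \<open>N\<close>; the linear operations are coordinatewise.\<close>

type_synonym cseq = "nat \<Rightarrow> complex"


subsection \<open>Differences and the class \<open>S k\<close>\<close>

text \<open>The \<open>if\<close> encodes the convention that a sequence vanishes at all indices before its
  first one.\<close>

definition bdiff :: "nat \<Rightarrow> (nat \<Rightarrow> 'a::comm_ring_1) \<Rightarrow> nat \<Rightarrow> 'a" where
  "bdiff k u n = (\<Sum>j\<le>k. (-1) ^ j * of_nat (k choose j) * (if j \<le> n then u (n - j) else 0))"

definition S_class :: "nat \<Rightarrow> (nat \<Rightarrow> real) set" where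
  "S_class k = {f. filterlim f at_top sequentially \<and>
     (\<forall>j. 1 \<le> j \<and> j \<le> k \<longrightarrow> Bseq (\<lambda>n. real (Suc n) ^ j * bdiff j f n))}"


subsection \<open>Convergence and bases in a normed space of sequences\<close>

definition tendsto_in ::
    "cseq set \<Rightarrow> (cseq \<Rightarrow> real) \<Rightarrow> ('b \<Rightarrow> cseq) \<Rightarrow> cseq \<Rightarrow> 'b filter \<Rightarrow> bool" where
  "tendsto_in V N X x F \<longleftrightarrow>
     x \<in> V \<and> (\<forall>\<^sub>F t in F. X t \<in> V) \<and> ((\<lambda>t. N (\<lambda>i. X t i - x i)) \<longlongrightarrow> 0) F"

definition sums_in ::
    "cseq set \<Rightarrow> (cseq \<Rightarrow> real) \<Rightarrow> cseq \<Rightarrow> (nat \<Rightarrow> cseq) \<Rightarrow> cseq \<Rightarrow> bool" where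
  "sums_in V N c e x \<longleftrightarrow> tendsto_in V N (\<lambda>m i. \<Sum>n<m. c n * e n i) x sequentially"

definition series_in ::
    "cseq set \<Rightarrow> (cseq \<Rightarrow> real) \<Rightarrow> cseq \<Rightarrow> (nat \<Rightarrow> cseq) \<Rightarrow> cseq" where
  "series_in V N c e = (THE x. sums_in V N c e x)"

definition schauder_basis :: "cseq set \<Rightarrow> (cseq \<Rightarrow> real) \<Rightarrow> (nat \<Rightarrow> cseq) \<Rightarrow> bool" where
  "schauder_basis V N e \<longleftrightarrow> (\<forall>n. e n \<in> V) \<and> (\<forall>x\<in>V. \<exists>!c. sums_in V N c e x)"

definition equivalent_bases ::
    "cseq set \<Rightarrow> (cseq \<Rightarrow> real) \<Rightarrow> (nat \<Rightarrow> cseq) \<Rightarrow> (nat \<Rightarrow> cseq) \<Rightarrow> bool" where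
  "equivalent_bases V N e g \<longleftrightarrow> schauder_basis V N e \<and> schauder_basis V N g \<and>
     (\<forall>c. (\<exists>x. sums_in V N c e x) \<longleftrightarrow> (\<exists>y. sums_in V N c g y))"

definition symmetric_basis :: "cseq set \<Rightarrow> (cseq \<Rightarrow> real) \<Rightarrow> (nat \<Rightarrow> cseq) \<Rightarrow> bool" where
  "symmetric_basis V N e \<longleftrightarrow> schauder_basis V N e \<and>
     (\<forall>\<pi>. bij \<pi> \<longrightarrow> equivalent_bases V N (\<lambda>n. e (\<pi> n)) e)"


subsection \<open>Groups of operators\<close>

definition bounded_operator_on ::
    "cseq set \<Rightarrow> (cseq \<Rightarrow> real) \<Rightarrow> (cseq \<Rightarrow> cseq) \<Rightarrow> bool" where
  "bounded_operator_on V N B \<longleftrightarrow>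
     (\<forall>x\<in>V. B x \<in> V) \<and>
     (\<forall>x\<in>V. \<forall>y\<in>V. \<forall>a b. B (\<lambda>i. a * x i + b * y i) = (\<lambda>i. a * B x i + b * B y i)) \<and>
     (\<exists>C. \<forall>x\<in>V. N (B x) \<le> C * N x)"

definition C0_group :: "cseq set \<Rightarrow> (cseq \<Rightarrow> real) \<Rightarrow> (real \<Rightarrow> cseq \<Rightarrow> cseq) \<Rightarrow> bool" where
  "C0_group V N T \<longleftrightarrow>
     (\<forall>t. bounded_operator_on V N (T t)) \<and>
     (\<forall>x\<in>V. T 0 x = x) \<and>
     (\<forall>s t. \<forall>x\<in>V. T (s + t) x = T s (T t x)) \<and>
     (\<forall>x\<in>V. tendsto_in V N (\<lambda>t. T t x) x (at 0))"

definition orbit_deriv_in ::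
    "cseq set \<Rightarrow> (cseq \<Rightarrow> real) \<Rightarrow> (real \<Rightarrow> cseq \<Rightarrow> cseq) \<Rightarrow> cseq \<Rightarrow> cseq \<Rightarrow> bool" where
  "orbit_deriv_in V N T x y \<longleftrightarrow>
     tendsto_in V N (\<lambda>t i. (T t x i - x i) / complex_of_real t) y (at 0)"

text \<open>The operator \<open>A\<close> with domain \<open>D\<close> is the infinitesimal generator of the group \<open>T\<close>;
  the values of \<open>A\<close> outside \<open>D\<close> are irrelevant.\<close>

definition generates_C0_group ::
    "cseq set \<Rightarrow> (cseq \<Rightarrow> real) \<Rightarrow> cseq set \<Rightarrow> (cseq \<Rightarrow> cseq) \<Rightarrow> (real \<Rightarrow> cseq \<Rightarrow> cseq) \<Rightarrow> bool" where
  "generates_C0_group V N D A T \<longleftrightarrow>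
     C0_group V N T \<and>
     D = {x \<in> V. \<exists>y. orbit_deriv_in V N T x y} \<and>
     (\<forall>x\<in>D. orbit_deriv_in V N T x (A x))"


subsection \<open>The spaces\<close>

definition lp :: "real \<Rightarrow> cseq set" where
  "lp p = {x. summable (\<lambda>n. cmod (x n) powr p)}"

definition lp_norm :: "real \<Rightarrow> cseq \<Rightarrow> real" where
  "lp_norm p x = (\<Sum>n. cmod (x n) powr p) powr (1 / p)"

definition lp_diff :: "real \<Rightarrow> nat \<Rightarrow> cseq set" where
  "lp_diff p k = {c. bdiff k c \<in> lp p}"

text \<open>A formal series is its coefficient sequence, so \<open>lp_diff p k\<close> is also the carrier of the
  space of formal series with respect to \<open>e\<close>; only the norm depends on \<open>e\<close>.\<close>

definition lp_diff_norm :: "real \<Rightarrow> nat \<Rightarrow> (nat \<Rightarrow> cseq) \<Rightarrow> cseq \<Rightarrow> real" where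
  "lp_diff_norm p k e c = lp_norm p (series_in (lp p) (lp_norm p) (bdiff k c) e)"

text \<open>The formal series whose only nonzero coefficient is a 1 at position \<open>n\<close>, that is, the
  \<open>n\<close>-th basis vector regarded as a formal series.\<close>

definition single_term :: "nat \<Rightarrow> cseq" where
  "single_term n = (\<lambda>i. if i = n then 1 else 0)"

definition A_op :: "(nat \<Rightarrow> real) \<Rightarrow> cseq \<Rightarrow> cseq" where
  "A_op f c = (\<lambda>n. \<i> * complex_of_real (f n) * c n)"

definition A_dom :: "real \<Rightarrow> nat \<Rightarrow> (nat \<Rightarrow> real) \<Rightarrow> cseq set" where
  "A_dom p k f = {c \<in> lp_diff p k. (\<lambda>n. complex_of_real (f n) * c n) \<in> lp_diff p k}"

end

theory Submission
  imports Defs "HOL-Library.Diagonal_Subsequence"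
begin

text \<open>A symmetric basis \<open>e\<close> of \<open>\<ell>\<^sub>p\<close> is equivalent to the canonical one: its elements have norms
  bounded above and below, a subsequence converges coordinatewise, the limit has vanishing
  coefficients because \<open>p > 1\<close>, and hence by a gliding hump a further subsequence behaves like
  disjoint blocks. Permuting coefficients transfers the resulting \<open>p\<close>-estimates to the whole basis,
  and Zabreiko's lemma turns the equality of coefficient spaces into an equivalence of norms. So the
  norm of a formal series \<open>c\<close> is equivalent to the \<open>\<ell>\<^sub>p\<close> norm of \<open>\<Delta>\<^sup>k c\<close>.

  For \<open>f\<close> in \<open>S k\<close> the multipliers \<open>g = exp (i t f)\<close> satisfy \<open>\<Delta>\<^sup>j g n = O(n powr (-j))\<close>, locally uniformly
  in \<open>t\<close>. By the Leibniz rule \<open>\<Delta>\<^sup>k (g c)\<close> is dominated by the sum of the sequences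
  \<open>n powr (-j) * \<Delta>\<^sup>k\<^sup>-\<^sup>j c\<close>, which Hardy's inequality bounds by \<open>\<Delta>\<^sup>k c\<close>. This gives boundedness, and by
  dominated convergence strong continuity and the generator. The constant sequence 1 lies in the
  space, but \<open>\<Delta>\<^sup>k\<close> of the tail starting at \<open>m\<close> equals 1 at \<open>m\<close>, so its expansion does not converge.\<close>

subsection \<open>The space \<open>\<ell>\<^sub>p\<close>\<close>

text \<open>The definition of a symmetric basis only compares which coefficient sequences converge;
  it contains neither norm inequalities nor continuity of coefficients. Quantitative facts therefore
  come either from a coefficient sequence that would converge in one arrangement and diverge in
  another, or from Zabreiko's lemma, which bounds a seminorm that is finite everywhere. An injection
  between index sets extends to a permutation only if the complements match in size, so subsequences
  are kept co-infinite, and a sequence without zeros is first cut into pieces that vanish on an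
  infinite set. The sequence \<open>f\<close> is unbounded and not itself a bounded multiplier.
  Expanding the k-th difference of exp (i t f) directly would give a sum over products of
  differences of all orders; interpolating between the exponential and its shift avoids this. The
  majorant obtained from the Leibniz rule does not contain the multiplier, so the same construction
  serves boundedness, continuity and the derivative. The strict inequality \<open>p > 1\<close>
  enters through J^(1/p) = o(J) and through Hardy's inequality, which fails for p = 1.\<close>

locale lp_space =
  fixes p :: real
  assumes p1: "1 < p"
begin

abbreviation nrm :: "cseq \<Rightarrow> real" where "nrm \<equiv> lp_norm p"

lemma p0: "0 < p" "p \<noteq> 0" "0 \<le> p"
  using p1 by auto

lemma nrm_nonneg: "0 \<le> nrm x"
  by (simp add: lp_norm_def)

lemma nrm_powr: "x \<in> lp p \<Longrightarrow> nrm x powr p = (\<Sum>n. cmod (x n) powr p)"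
  using p0 by (simp add: lp_norm_def lp_def powr_powr suminf_nonneg)

lemma sum_le_nrm:
  assumes "x \<in> lp p" "finite A"
  shows "(\<Sum>n\<in>A. cmod (x n) powr p) \<le> nrm x powr p"
  using assms by (auto simp: nrm_powr lp_def intro!: sum_le_suminf)

lemma powr_p_le_cancel: "x powr p \<le> y powr p \<Longrightarrow> 0 \<le> y \<Longrightarrow> x \<ge> 0 \<Longrightarrow> x \<le> y"
  using p0 by (meson not_le powr_less_mono2)

lemma nrm_leI:
  assumes "\<And>N. (\<Sum>n<N. cmod (x n) powr p) \<le> B powr p" "0 \<le> B"
  shows "x \<in> lp p" "nrm x \<le> B"
proof -
  show x: "x \<in> lp p"
    unfolding lp_def using summableI_nonneg_bounded[OF _ assms(1)] by simp
  have "nrm x powr p \<le> B powr p"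
    unfolding nrm_powr[OF x] using x assms(1) by (intro suminf_le_const) (auto simp: lp_def)
  then show "nrm x \<le> B"
    using assms(2) nrm_nonneg by (rule powr_p_le_cancel)
qed

lemma coord_le_nrm: "x \<in> lp p \<Longrightarrow> cmod (x i) \<le> nrm x"
  using sum_le_nrm[of x "{i}"] nrm_nonneg by (auto intro: powr_p_le_cancel)

lemma nrm_mono:
  assumes "y \<in> lp p" "\<And>i. cmod (x i) \<le> cmod (y i)"
  shows "x \<in> lp p" "nrm x \<le> nrm y"
proof -
  have "(\<Sum>n<N. cmod (x n) powr p) \<le> nrm y powr p" for N
    using sum_le_nrm[OF assms(1), of "{..<N}"] p0 assms(2)
    by (smt (verit, best) finite_lessThan norm_ge_zero powr_mono2 sum_mono)
  from nrm_leI[OF this nrm_nonneg] show "x \<in> lp p" "nrm x \<le> nrm y" by auto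
qed

lemma convex_powr_p:
  assumes "0 \<le> a" "0 \<le> b" "0 \<le> u" "0 \<le> v" "u + v = 1"
  shows "(u * a + v * b) powr p \<le> u * a powr p + v * b powr p"
proof -
  \<comment> \<open>This settles the cases in which \<open>a\<close> or \<open>b\<close> vanishes;
    convexity is then applied to positive arguments only.\<close>
  have small: "(w * c) powr p \<le> w * c powr p" if "0 \<le> w" "w \<le> 1" "0 \<le> c" for w c :: real
  proof -
    have "w powr p \<le> w"
      using that p1 powr_mono'[of 1 p w] by simp
    then show ?thesis
      using that by (simp add: powr_mult mult_right_mono)
  qed
  consider "a = 0" | "b = 0" | "a > 0" "b > 0" using assms by linarith
  then show ?thesis
  proof cases
    case 1 then show ?thesis using small[of v b] assms p0 by simp
  next
    case 2 then show ?thesis using small[of u a] assms p0 by simp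
  next
    case 3
    show ?thesis
    proof -
      have u: "u = 1 - v" using assms by simp
      show ?thesis
        using convex_onD[OF powr_convex[of p], of v a b] p1 assms 3 by (simp add: u)
    qed
  qed
qed

text \<open>Minkowski's inequality from convexity of the p-th power with weights s/(s+t) and
  t/(s+t). Working with positive upper bounds \<open>s\<close>, \<open>t\<close> of the two norms
  avoids division by zero; they are lowered to the norms at the end.\<close>

lemma nrm_add:
  assumes x: "x \<in> lp p" and y: "y \<in> lp p"
  shows "(\<lambda>i. x i + y i) \<in> lp p" "nrm (\<lambda>i. x i + y i) \<le> nrm x + nrm y"
proof -
  have *: "(\<lambda>i. x i + y i) \<in> lp p \<and> nrm (\<lambda>i. x i + y i) \<le> s + t"
    if s: "s > 0" "nrm x \<le> s" and t: "t > 0" "nrm y \<le> t" for s t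
  proof -
    have st: "s + t > 0" using s t by simp
    have "cmod (x n + y n) powr p \<le>
        (s+t) powr p * (s/(s+t) * (cmod (x n) powr p / s powr p) + t/(s+t) * (cmod (y n) powr p / t powr p))"
      for n
    proof -
      have "cmod (x n + y n) \<le> cmod (x n) + cmod (y n)" by (rule norm_triangle_ineq)
      also have "\<dots> = (s+t) * (s/(s+t) * (cmod (x n)/s) + t/(s+t) * (cmod (y n)/t))"
      proof -
        have "(s+t) * (s/(s+t) * (a/s) + t/(s+t) * (b/t)) = a + b" for a b
          using s t st by (simp add: distrib_left)
        then show ?thesis by simp
      qed
      finally have "cmod (x n + y n) powr p \<le> \<dots> powr p"
        using p0 by (intro powr_mono2) auto
      also have "\<dots> = (s+t) powr p * (s/(s+t) * (cmod (x n)/s) + t/(s+t) * (cmod (y n)/t)) powr p"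
        using s t by (simp add: powr_mult)
      also have "\<dots> \<le> (s+t) powr p * (s/(s+t) * (cmod (x n)/s) powr p + t/(s+t) * (cmod (y n)/t) powr p)"
        using s t st by (intro mult_left_mono convex_powr_p) (auto simp: add_divide_distrib[symmetric])
      finally show ?thesis using s t by (simp add: powr_divide)
    qed
    note pt = this
    have "(\<Sum>n<N. cmod (x n + y n) powr p) \<le> (s + t) powr p" for N
    proof -
      have "(\<Sum>n<N. cmod (x n + y n) powr p) \<le> (\<Sum>n<N.
          (s+t) powr p * (s/(s+t) * (cmod (x n) powr p / s powr p) + t/(s+t) * (cmod (y n) powr p / t powr p)))"
        by (rule sum_mono) (rule pt)
      also have "\<dots> = (s+t) powr p * (s/(s+t) * ((\<Sum>n<N. cmod (x n) powr p) / s powr p)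
          + t/(s+t) * ((\<Sum>n<N. cmod (y n) powr p) / t powr p))"
        by (simp add: sum_distrib_left sum.distrib sum_divide_distrib distrib_left)
      also have "\<dots> \<le> (s+t) powr p * (s/(s+t) * 1 + t/(s+t) * 1)"
      proof -
        have "(\<Sum>n<N. cmod (x n) powr p) \<le> s powr p"
          using sum_le_nrm[OF x, of "{..<N}"] powr_mono2[of p "nrm x" s] s p0 nrm_nonneg by force
        moreover have "(\<Sum>n<N. cmod (y n) powr p) \<le> t powr p"
          using sum_le_nrm[OF y, of "{..<N}"] powr_mono2[of p "nrm y" t] t p0 nrm_nonneg by force
        ultimately show ?thesis
          using s t by (intro mult_left_mono add_mono) (auto simp: divide_le_eq)
      qed
      also have "\<dots> = (s+t) powr p"
        using st by (simp add: add_divide_distrib[symmetric])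
      finally show ?thesis .
    qed
    from nrm_leI[OF this] show ?thesis using st by simp
  qed
  show "(\<lambda>i. x i + y i) \<in> lp p"
    using *[of "nrm x + 1" "nrm y + 1"] nrm_nonneg[of x] nrm_nonneg[of y] by simp
  show "nrm (\<lambda>i. x i + y i) \<le> nrm x + nrm y"
  proof (rule field_le_epsilon)
    fix \<epsilon> :: real assume "\<epsilon> > 0"
    then show "nrm (\<lambda>i. x i + y i) \<le> nrm x + nrm y + \<epsilon>"
      using *[of "nrm x + \<epsilon>/2" "nrm y + \<epsilon>/2"] nrm_nonneg[of x] nrm_nonneg[of y] by simp
  qed
qed

lemma nrm_scale:
  shows "x \<in> lp p \<Longrightarrow> (\<lambda>i. a * x i) \<in> lp p"
    and "x \<in> lp p \<Longrightarrow> nrm (\<lambda>i. a * x i) = cmod a * nrm x"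
proof -
  assume x: "x \<in> lp p"
  then show "(\<lambda>i. a * x i) \<in> lp p"
    by (auto simp: lp_def norm_mult powr_mult intro: summable_mult)
  have "nrm (\<lambda>i. a * x i) = (cmod a powr p * (\<Sum>n. cmod (x n) powr p)) powr (1/p)"
    using x by (simp add: lp_norm_def norm_mult powr_mult suminf_mult lp_def)
  also have "\<dots> = cmod a * nrm x"
    using p0 by (simp add: powr_mult powr_powr lp_norm_def)
  finally show "nrm (\<lambda>i. a * x i) = cmod a * nrm x" .
qed

lemma zero_lp: "(\<lambda>i. 0) \<in> lp p" "nrm (\<lambda>i. 0) = 0"
  using p0 by (auto simp: lp_def lp_norm_def)

lemma nrm_minus: "x \<in> lp p \<Longrightarrow> (\<lambda>i. - x i) \<in> lp p" "x \<in> lp p \<Longrightarrow> nrm (\<lambda>i. - x i) = nrm x"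
  using nrm_scale[of x "-1"] by auto

lemma nrm_diff:
  assumes "x \<in> lp p" "y \<in> lp p"
  shows "(\<lambda>i. x i - y i) \<in> lp p" "nrm (\<lambda>i. x i - y i) \<le> nrm x + nrm y"
  using nrm_add[OF assms(1) nrm_minus(1)[OF assms(2)]] nrm_minus(2)[OF assms(2)] by auto

lemma nrm_diff_commute: "nrm (\<lambda>i. x i - y i) = nrm (\<lambda>i. y i - x i)"
  by (simp add: lp_norm_def norm_minus_commute)

lemma nrm_triangle:
  assumes "x \<in> lp p" "y \<in> lp p" "z \<in> lp p"
  shows "nrm (\<lambda>i. x i - z i) \<le> nrm (\<lambda>i. x i - y i) + nrm (\<lambda>i. y i - z i)"
  using nrm_add(2)[OF nrm_diff(1)[OF assms(1,2)] nrm_diff(1)[OF assms(2,3)]] by simp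

lemma nrm_triangle2:
  assumes "x \<in> lp p" "y \<in> lp p"
  shows "nrm x \<le> nrm (\<lambda>i. x i - y i) + nrm y"
  using nrm_add(2)[OF nrm_diff(1)[OF assms] assms(2)] by simp

lemma nrm_sum:
  assumes "finite A" "\<And>j. j \<in> A \<Longrightarrow> X j \<in> lp p"
  shows "(\<lambda>i. \<Sum>j\<in>A. X j i) \<in> lp p \<and> nrm (\<lambda>i. \<Sum>j\<in>A. X j i) \<le> (\<Sum>j\<in>A. nrm (X j))"
  using assms
proof (induction A rule: finite_induct)
  case empty
  then show ?case by (simp add: zero_lp)
next
  case (insert a A)
  then show ?case using nrm_add[of "X a" "\<lambda>i. \<Sum>j\<in>A. X j i"] by force
qed

lemmas sum_lp = nrm_sum[THEN conjunct1]

lemma nrm_zero_imp: "x \<in> lp p \<Longrightarrow> nrm x \<le> 0 \<Longrightarrow> x i = 0"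
  using coord_le_nrm[of x i] by (metis norm_le_zero_iff order_trans)

text \<open>Only finite sections of the power sum are passed to the limit, so coordinatewise
  convergence suffices. Bounds survive limits in this way wherever norm convergence is not yet
  known.\<close>

lemma fatou:
  assumes "\<And>i. ((\<lambda>m. X m i) \<longlongrightarrow> x i) F" "F \<noteq> bot"
    and "\<forall>\<^sub>F m in F. X m \<in> lp p \<and> nrm (X m) \<le> B"
  shows "x \<in> lp p" "nrm x \<le> B"
proof -
  have B: "0 \<le> B"
    using eventually_happens[OF assms(3)] assms(2) nrm_nonneg order_trans by blast
  have "(\<Sum>n<N. cmod (x n) powr p) \<le> B powr p" for N
  proof (rule tendsto_upperbound[OF _ _ assms(2)])
    show "((\<lambda>m. \<Sum>n<N. cmod (X m n) powr p) \<longlongrightarrow> (\<Sum>n<N. cmod (x n) powr p)) F"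
      using p0 by (intro tendsto_sum tendsto_powr2 tendsto_norm assms(1)) auto
    show "\<forall>\<^sub>F m in F. (\<Sum>n<N. cmod (X m n) powr p) \<le> B powr p"
      using assms(3)
    proof eventually_elim
      case (elim m)
      then show ?case
        using sum_le_nrm[of "X m" "{..<N}"] powr_mono2[of p "nrm (X m)" B] p0 nrm_nonneg by force
    qed
  qed
  from nrm_leI[OF this B] show "x \<in> lp p" "nrm x \<le> B" by auto
qed

lemma coord_tendsto:
  assumes "((\<lambda>m. nrm (\<lambda>i. X m i - x i)) \<longlongrightarrow> 0) F" "\<forall>\<^sub>F m in F. X m \<in> lp p" "x \<in> lp p"
  shows "((\<lambda>m. X m i) \<longlongrightarrow> x i) F"
proof -
  have "\<forall>\<^sub>F m in F. norm (X m i - x i) \<le> nrm (\<lambda>i. X m i - x i)"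
    using assms(2) by eventually_elim (auto intro!: coord_le_nrm[of "\<lambda>i. _ i - x i"] nrm_diff assms(3))
  from Lim_null_comparison[OF this assms(1)] show ?thesis
    by (simp add: LIM_zero_cancel)
qed

lemma nrm_tendsto_unique:
  assumes "((\<lambda>m. nrm (\<lambda>i. X m i - x i)) \<longlongrightarrow> 0) F" "((\<lambda>m. nrm (\<lambda>i. X m i - y i)) \<longlongrightarrow> 0) F"
    and "\<forall>\<^sub>F m in F. X m \<in> lp p" "x \<in> lp p" "y \<in> lp p" "F \<noteq> bot"
  shows "x = y"
proof
  show "x i = y i" for i
    by (rule tendsto_unique[OF assms(6) coord_tendsto[OF assms(1,3,4)] coord_tendsto[OF assms(2,3,5)]])
qed

text \<open>The last conclusion transfers Cauchy bounds to the limit; the Baire argument needs it to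
  keep the limit inside every closed ball of a nested sequence.\<close>

lemma lp_complete:
  assumes X: "\<And>m. X m \<in> lp p"
    and C: "\<And>\<epsilon>. \<epsilon> > 0 \<Longrightarrow> \<exists>N. \<forall>m\<ge>N. \<forall>n\<ge>m. nrm (\<lambda>i. X m i - X n i) \<le> \<epsilon>"
  obtains x where "x \<in> lp p" "(\<lambda>m. nrm (\<lambda>i. X m i - x i)) \<longlonglongrightarrow> 0"
    "\<And>m B. \<forall>n\<ge>m. nrm (\<lambda>i. X m i - X n i) \<le> B \<Longrightarrow> nrm (\<lambda>i. X m i - x i) \<le> B"
proof -
  have "Cauchy (\<lambda>m. X m i)" for i
  proof (rule CauchyI')
    fix \<epsilon> :: real assume "\<epsilon> > 0"
    then obtain N where N: "\<forall>m\<ge>N. \<forall>n\<ge>m. nrm (\<lambda>i. X m i - X n i) \<le> \<epsilon>/2"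
      using C[of "\<epsilon>/2"] by auto
    show "\<exists>M. \<forall>m\<ge>M. \<forall>n>m. dist (X m i) (X n i) < \<epsilon>"
    proof (intro exI allI impI)
      fix m n assume "m \<ge> N" "n > m"
      then have "nrm (\<lambda>i. X m i - X n i) \<le> \<epsilon>/2"
        using N by auto
      then show "dist (X m i) (X n i) < \<epsilon>"
        using coord_le_nrm[OF nrm_diff(1)[OF X[of m] X[of n]], of i] \<open>\<epsilon> > 0\<close>
        by (simp add: dist_norm)
    qed
  qed
  then have "\<exists>l. (\<lambda>m. X m i) \<longlonglongrightarrow> l" for i
    by (simp add: Cauchy_convergent_iff convergent_def)
  then obtain x where x: "\<And>i. (\<lambda>m. X m i) \<longlonglongrightarrow> x i" by metis
  have F: "(\<lambda>i. X m i - x i) \<in> lp p" "nrm (\<lambda>i. X m i - x i) \<le> B"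
    if "\<forall>n\<ge>m. nrm (\<lambda>i. X m i - X n i) \<le> B" for m B
  proof -
    have lim: "(\<lambda>n. X m i - X n i) \<longlonglongrightarrow> X m i - x i" for i
      by (intro tendsto_intros x)
    have ev: "\<forall>\<^sub>F n in sequentially. (\<lambda>i. X m i - X n i) \<in> lp p \<and> nrm (\<lambda>i. X m i - X n i) \<le> B"
      using that nrm_diff(1)[OF X X] by (intro eventually_sequentiallyI[of m]) blast
    show "(\<lambda>i. X m i - x i) \<in> lp p" "nrm (\<lambda>i. X m i - x i) \<le> B"
      using fatou[OF lim _ ev] by simp_all
  qed
  have "x \<in> lp p"
  proof -
    obtain N where "\<forall>n\<ge>N. nrm (\<lambda>i. X N i - X n i) \<le> 1"
      using C[of 1] by auto
    from nrm_diff(1)[OF X[of N] F(1)[OF this]] have "(\<lambda>i. X N i - (X N i - x i)) \<in> lp p" .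
    then show ?thesis by simp
  qed
  moreover have "(\<lambda>m. nrm (\<lambda>i. X m i - x i)) \<longlonglongrightarrow> 0"
  proof (rule LIMSEQ_I)
    fix \<epsilon> :: real assume "\<epsilon> > 0"
    then obtain N where N: "\<forall>m\<ge>N. \<forall>n\<ge>m. nrm (\<lambda>i. X m i - X n i) \<le> \<epsilon>/2"
      using C[of "\<epsilon>/2"] by auto
    show "\<exists>N. \<forall>m\<ge>N. norm (nrm (\<lambda>i. X m i - x i) - 0) < \<epsilon>"
    proof (intro exI allI impI)
      fix m assume "m \<ge> N"
      then have "nrm (\<lambda>i. X m i - x i) \<le> \<epsilon>/2" using N F(2)[of m "\<epsilon>/2"] by blast
      then show "norm (nrm (\<lambda>i. X m i - x i) - 0) < \<epsilon>"
        using \<open>\<epsilon> > 0\<close> nrm_nonneg by (simp add: abs_of_nonneg)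
    qed
  qed
  ultimately show thesis by (rule that[OF _ _ F(2)])
qed

text \<open>The bound depends only on where a block starts. This covers basis expansions whose terms
  need not have summable norms, as in \<open>conv_lp\<close>.\<close>

lemma series_converges:
  assumes X: "\<And>m. X m \<in> lp p" and b: "b \<longlonglongrightarrow> (0::real)"
    and le: "\<And>m n. m \<le> n \<Longrightarrow> nrm (\<lambda>i. \<Sum>j\<in>{m..<n}. X j i) \<le> b m"
  shows "\<exists>x\<in>lp p. (\<lambda>m. nrm (\<lambda>i. (\<Sum>j<m. X j i) - x i)) \<longlonglongrightarrow> 0"
proof -
  have d: "nrm (\<lambda>i. (\<Sum>j<m. X j i) - (\<Sum>j<n. X j i)) \<le> b m" if "m \<le> n" for m n
  proof -
    have "(\<Sum>j<n. X j i) - (\<Sum>j<m. X j i) = (\<Sum>j\<in>{m..<n}. X j i)" for i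
      using sum_diff_nat_ivl[of 0 m n "\<lambda>j. X j i"] that by (simp add: atLeast0LessThan)
    then show ?thesis
      using le[OF that] by (simp add: nrm_diff_commute[of "\<lambda>i. \<Sum>j<m. X j i"])
  qed
  have lp: "(\<lambda>i. \<Sum>j<m. X j i) \<in> lp p" for m
    by (intro sum_lp X) auto
  show ?thesis
  proof (rule lp_complete[of "\<lambda>m i. \<Sum>j<m. X j i"])
    fix \<epsilon> :: real assume "\<epsilon> > 0"
    then obtain N where "\<forall>m\<ge>N. b m < \<epsilon>"
      using order_tendstoD(2)[OF b] by (auto simp: eventually_sequentially)
    then show "\<exists>N. \<forall>m\<ge>N. \<forall>n\<ge>m. nrm (\<lambda>i. (\<Sum>j<m. X j i) - (\<Sum>j<n. X j i)) \<le> \<epsilon>"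
      using d by (meson less_imp_le order_trans)
  qed (use lp in auto)
qed

lemma abs_series_converges:
  assumes X: "\<And>m. X m \<in> lp p" and s: "summable (\<lambda>j. b j)" and le: "\<And>j. nrm (X j) \<le> b j"
  shows "\<exists>x\<in>lp p. (\<lambda>m. nrm (\<lambda>i. (\<Sum>j<m. X j i) - x i)) \<longlonglongrightarrow> 0"
proof (rule series_converges[of X "\<lambda>m. \<Sum>j. b (j + m)"])
  have b0: "0 \<le> b j" for j using le nrm_nonneg order_trans by blast
  show "(\<lambda>m. \<Sum>j. b (j + m)) \<longlonglongrightarrow> 0"
    using suminf_exist_split2[OF s] .
  fix m n :: nat assume "m \<le> n"
  have "nrm (\<lambda>i. \<Sum>j\<in>{m..<n}. X j i) \<le> (\<Sum>j\<in>{m..<n}. nrm (X j))"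
    using nrm_sum[of "{m..<n}" X] X by auto
  also have "\<dots> \<le> (\<Sum>j\<in>{m..<n}. b j)" by (rule sum_mono) (rule le)
  also have "\<dots> = (\<Sum>j<n - m. b (j + m))"
    using sum.shift_bounds_nat_ivl[of b 0 m "n - m"] \<open>m \<le> n\<close> by (simp add: atLeast0LessThan)
  also have "\<dots> \<le> (\<Sum>j. b (j + m))"
    using b0 s by (intro sum_le_suminf) (auto simp: summable_iff_shift)
  finally show "nrm (\<lambda>i. \<Sum>j\<in>{m..<n}. X j i) \<le> (\<Sum>j. b (j + m))" .
qed (rule X)

lemma nrm_limit:
  assumes "((\<lambda>m. nrm (\<lambda>i. X m i - x i)) \<longlongrightarrow> 0) F" "\<forall>\<^sub>F m in F. X m \<in> lp p" "F \<noteq> bot"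
    and "\<forall>\<^sub>F m in F. nrm (X m) \<le> B" "x \<in> lp p"
  shows "nrm x \<le> B"
  using fatou(2)[of X x F B] coord_tendsto[OF assms(1,2,5)] assms(2-4)
  by (simp add: eventually_conj)

end

subsection \<open>Countably subadditive seminorms\<close>

lemma null_comparison:
  assumes "\<And>x. norm (f x) \<le> g x" "(g \<longlongrightarrow> (0::real)) F"
  shows "(f \<longlongrightarrow> 0) F"
  by (rule Lim_null_comparison[OF always_eventually assms(2)]) (simp add: assms(1))

context lp_space begin

text \<open>The sets are arbitrary, hence the conclusion is density in a ball and not inclusion of a
  ball. If every \<open>A n\<close> were nowhere dense, balls with at least halving radii could
  avoid \<open>A 0\<close>, \<open>A 1\<close>, ... in turn, and their common point would be
  uncovered.\<close>

lemma baire_ball: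
  fixes A :: "nat \<Rightarrow> cseq set"
  assumes cov: "\<And>x. x \<in> lp p \<Longrightarrow> \<exists>n. x \<in> A n" 
  obtains n x0 r where "x0 \<in> lp p" "r > 0"
    "\<And>y s. y \<in> lp p \<Longrightarrow> nrm (\<lambda>i. y i - x0 i) < r \<Longrightarrow> s > 0 \<Longrightarrow> \<exists>z\<in>lp p. nrm (\<lambda>i. z i - y i) < s \<and> z \<in> A n"
proof (rule ccontr)
  note thes = that
  assume "\<not> thesis"
  then have neg: "\<exists>y s. y \<in> lp p \<and> nrm (\<lambda>i. y i - x0 i) < r \<and> s > 0 \<and> (\<forall>z\<in>lp p. nrm (\<lambda>i. z i - y i) < s \<longrightarrow> z \<notin> A n)"
    if "x0 \<in> lp p" "r > 0" for n x0 r
    using that thes[of x0 r n] by blast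
  have "\<exists>b. \<forall>n. (fst (b n) \<in> lp p \<and> snd (b n) > 0) \<and>
     (nrm (\<lambda>i. fst (b (Suc n)) i - fst (b n) i) \<le> snd (b n) / 2 \<and> snd (b (Suc n)) \<le> snd (b n) / 2 \<and>
     (\<forall>z\<in>lp p. nrm (\<lambda>i. z i - fst (b (Suc n)) i) \<le> snd (b (Suc n)) \<longrightarrow> z \<notin> A n))"
  proof (rule dependent_nat_choice)
    show "\<exists>x. fst x \<in> lp p \<and> (0::real) < snd x"
      using zero_lp(1) by (intro exI[of _ "(\<lambda>i. 0, 1)"]) simp
  next
    fix b :: "cseq \<times> real" and n
    assume b: "fst b \<in> lp p \<and> 0 < snd b"
    then obtain y s where y: "y \<in> lp p" "nrm (\<lambda>i. y i - fst b i) < snd b / 2" "s > 0"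
      "\<forall>z\<in>lp p. nrm (\<lambda>i. z i - y i) < s \<longrightarrow> z \<notin> A n"
      using neg[of "fst b" "snd b / 2" n] by auto
    show "\<exists>y. (fst y \<in> lp p \<and> 0 < snd y) \<and> nrm (\<lambda>i. fst y i - fst b i) \<le> snd b / 2 \<and>
           snd y \<le> snd b / 2 \<and> (\<forall>z\<in>lp p. nrm (\<lambda>i. z i - fst y i) \<le> snd y \<longrightarrow> z \<notin> A n)"
      \<comment> \<open>With \<open>s/2\<close> the closed ball avoids \<open>A n\<close>; with
        \<open>snd b/2\<close> it stays inside the previous closed ball.\<close>
      using y b by (intro exI[of _ "(y, min (s/2) (snd b/2))"]) auto
  qed
  then obtain b where
    lp: "\<And>n. fst (b n) \<in> lp p" and pos: "\<And>n. snd (b n) > 0" and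
    step: "\<And>n. nrm (\<lambda>i. fst (b (Suc n)) i - fst (b n) i) \<le> snd (b n) / 2" and
    half: "\<And>n. snd (b (Suc n)) \<le> snd (b n) / 2" and
    avoid: "\<And>n z. z\<in>lp p \<Longrightarrow> nrm (\<lambda>i. z i - fst (b (Suc n)) i) \<le> snd (b (Suc n)) \<Longrightarrow> z \<notin> A n"
    by blast
  have nested: "nrm (\<lambda>i. fst (b (m + k)) i - fst (b m) i) \<le> snd (b m) - snd (b (m + k))" for m k
  proof (induction k)
    case 0
    then show ?case by (simp add: zero_lp)
  next
    case (Suc k)
    have "nrm (\<lambda>i. fst (b (m + Suc k)) i - fst (b m) i) \<le> snd (b (m + k)) / 2 + (snd (b m) - snd (b (m + k)))"
      using nrm_triangle[OF lp[of "m + Suc k"] lp[of "m + k"] lp[of m]] step[of "m + k"] Suc by simp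
    then show ?case using half[of "m + k"] by simp
  qed
  have dec: "snd (b n) \<le> snd (b 0) / 2 ^ n" for n
  proof (induction n)
    case (Suc n)
    then show ?case using half[of n] by simp
  qed simp
  have lim0: "(\<lambda>n. snd (b 0) / 2 ^ n) \<longlonglongrightarrow> 0"
    by (rule LIMSEQ_divide_realpow_zero) simp
  have near: "nrm (\<lambda>i. fst (b m) i - fst (b n) i) \<le> snd (b m)" if "m \<le> n" for m n
    using nested[of m "n - m"] that pos[of n] by (subst nrm_diff_commute) simp
  obtain x where x: "x \<in> lp p"
    "\<And>m B. \<forall>n\<ge>m. nrm (\<lambda>i. fst (b m) i - fst (b n) i) \<le> B \<Longrightarrow> nrm (\<lambda>i. fst (b m) i - x i) \<le> B"
  proof (rule lp_complete[of "\<lambda>n. fst (b n)"])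
    fix \<epsilon> :: real assume "\<epsilon> > 0"
    then obtain N where N: "\<forall>m\<ge>N. snd (b 0) / 2 ^ m < \<epsilon>"
      using order_tendstoD(2)[OF lim0] by (auto simp: eventually_sequentially)
    show "\<exists>N. \<forall>m\<ge>N. \<forall>n\<ge>m. nrm (\<lambda>i. fst (b m) i - fst (b n) i) \<le> \<epsilon>"
    proof (intro exI allI impI)
      fix m n assume "m \<ge> N" "n \<ge> m"
      then have "snd (b m) < \<epsilon>" using N dec[of m] by (meson le_less_trans)
      then show "nrm (\<lambda>i. fst (b m) i - fst (b n) i) \<le> \<epsilon>"
        using near[OF \<open>n \<ge> m\<close>] by simp
    qed
  qed (use lp in auto)
  obtain n where "x \<in> A n" using cov[OF x(1)] by blast
  moreover have "nrm (\<lambda>i. x i - fst (b (Suc n)) i) \<le> snd (b (Suc n))"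
    using x(2)[of "Suc n" "snd (b (Suc n))"] near[of "Suc n"] by (subst nrm_diff_commute) simp
  ultimately show False using avoid[OF x(1)] by blast
qed

text \<open>Zabreiko's lemma: countable subadditivity replaces lower semicontinuity, and together with
  the Baire argument it yields boundedness.\<close>

lemma zabreiko:
  assumes scale: "\<And>a x. x \<in> lp p \<Longrightarrow> q (\<lambda>i. a * x i) = cmod a * q x"
    and nonneg: "\<And>x. x \<in> lp p \<Longrightarrow> 0 \<le> q x"
    and csub: "\<And>X x. (\<And>j. X j \<in> lp p) \<Longrightarrow> x \<in> lp p \<Longrightarrow>
      (\<lambda>J. nrm (\<lambda>i. (\<Sum>j<J. X j i) - x i)) \<longlonglongrightarrow> 0 \<Longrightarrow> summable (\<lambda>j. q (X j)) \<Longrightarrow>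
      q x \<le> (\<Sum>j. q (X j))"
  shows "\<exists>C>0. \<forall>x\<in>lp p. q x \<le> C * nrm x"
proof -
  have q0: "q (\<lambda>i. 0) = 0"
    using scale[OF zero_lp(1), of 0] by simp
  have add: "q (\<lambda>i. x i + y i) \<le> q x + q y" if "x \<in> lp p" "y \<in> lp p" for x y
  proof -
    \<comment> \<open>Finite subadditivity is \<open>csub\<close> for the sequence x, y, 0, 0,
      ....\<close>
    define X where "X j = (if j = 0 then x else if j = 1 then y else (\<lambda>i. 0))" for j :: nat
    have fin: "q (X j) = 0" if "j \<notin> {..<2}" for j using that q0 by (auto simp: X_def)
    have sums: "(\<lambda>j. q (X j)) sums (\<Sum>j<2. q (X j))"
      by (rule sums_finite) (use fin in auto)
    have S: "(\<Sum>j<J. X j i) = x i + y i" if "J \<ge> 2" for J i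
      using that
    proof (induction J rule: dec_induct)
      case base show ?case by (simp add: X_def numeral_2_eq_2)
    next
      case (step n) then show ?case by (simp add: X_def)
    qed
    have "q (\<lambda>i. x i + y i) \<le> (\<Sum>j. q (X j))"
    proof (rule csub)
      show "X j \<in> lp p" for j using that zero_lp by (auto simp: X_def)
      show "(\<lambda>J. nrm (\<lambda>i. (\<Sum>j<J. X j i) - (x i + y i))) \<longlonglongrightarrow> 0"
        by (rule tendsto_eventually, rule eventually_sequentiallyI[of 2]) (simp add: S zero_lp)
    qed (use nrm_add that sums in \<open>auto simp: sums_iff\<close>)
    also have "\<dots> = q x + q y"
      using sums by (simp add: sums_iff X_def numeral_2_eq_2)
    finally show ?thesis .
  qed
  obtain n x0 r where x0: "x0 \<in> lp p" and r: "r > 0" and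
    ball: "\<And>y s. y \<in> lp p \<Longrightarrow> nrm (\<lambda>i. y i - x0 i) < r \<Longrightarrow> s > 0 \<Longrightarrow>
      \<exists>z\<in>lp p. nrm (\<lambda>i. z i - y i) < s \<and> z \<in> {x. q x \<le> real n}"
    by (rule baire_ball[of "\<lambda>n. {x. q x \<le> real n}"]) (use real_arch_simple in auto)
  have dens0: "\<exists>z\<in>lp p. nrm (\<lambda>i. z i - y i) < s \<and> q z \<le> n"
    if y: "y \<in> lp p" "nrm y < r" and s: "s > 0" for y s
  proof -
    obtain z1 where z1: "z1 \<in> lp p" "nrm (\<lambda>i. z1 i - (x0 i + y i)) < s" "q z1 \<le> n"
      using ball[OF nrm_add(1)[OF x0 y(1)] _ s] y by auto
    obtain z2 where z2: "z2 \<in> lp p" "nrm (\<lambda>i. z2 i - (x0 i - y i)) < s" "q z2 \<le> n"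
      using ball[OF nrm_diff(1)[OF x0 y(1)] _ s] y by (auto simp: nrm_minus)
    note u = nrm_diff(1)[OF z1(1) nrm_add(1)[OF x0 y(1)]] nrm_diff(1)[OF z2(1) nrm_diff(1)[OF x0 y(1)]]
    \<comment> \<open>Since \<open>z1\<close> is near x0 + y and \<open>z2\<close> near x0 - y, half
      their difference is near \<open>y\<close>: the ball of density is recentred at 0.\<close>
    define z where "z i = (1/2) * (z1 i - z2 i)" for i
    have zl: "z \<in> lp p" unfolding z_def by (intro nrm_scale nrm_diff z1 z2)
    have "nrm (\<lambda>i. z i - y i) = nrm (\<lambda>i. (1/2) * ((z1 i - (x0 i + y i)) - (z2 i - (x0 i - y i))))"
      by (rule arg_cong[where f = nrm]) (simp add: z_def fun_eq_iff diff_divide_distrib)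
    also have "\<dots> = (1/2) * nrm (\<lambda>i. (z1 i - (x0 i + y i)) - (z2 i - (x0 i - y i)))"
      using nrm_scale(2)[OF nrm_diff(1)[OF u], of "1/2"] by simp
    also have "\<dots> \<le> (1/2) * (nrm (\<lambda>i. z1 i - (x0 i + y i)) + nrm (\<lambda>i. z2 i - (x0 i - y i)))"
      by (intro mult_left_mono nrm_diff(2) u) simp
    also have "\<dots> < s" using z1 z2 by simp
    finally have close: "nrm (\<lambda>i. z i - y i) < s" .
    have "q z = (1/2) * q (\<lambda>i. z1 i - z2 i)"
      unfolding z_def using scale[OF nrm_diff(1)[OF z1(1) z2(1)], of "1/2"] by simp
    also have "\<dots> \<le> (1/2) * (q z1 + q z2)"
      using add[OF z1(1) nrm_minus(1)[OF z2(1)]] scale[OF z2(1), of "-1"] by simp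
    also have "\<dots> \<le> n" using z1 z2 by simp
    finally show ?thesis using zl close by blast
  qed
  have dens: "\<exists>z\<in>lp p. nrm (\<lambda>i. y i - z i) < r * (1/2) ^ Suc k \<and> q z \<le> n * (1/2) ^ k"
    if y: "y \<in> lp p" "nrm y < r * (1/2) ^ k" for y k
  proof -
    define w where "w = (\<lambda>i. 2 ^ k * y i)"
    have w: "w \<in> lp p" "nrm w < r"
      using nrm_scale[OF y(1), of "2^k"] y(2) unfolding w_def
      by (auto simp: norm_power power_one_over field_simps)
    obtain z where z: "z \<in> lp p" "nrm (\<lambda>i. z i - w i) < r/2" "q z \<le> n"
      using dens0[OF w, of "r/2"] r by auto
    have "nrm (\<lambda>i. (1/2)^k * z i - y i) = (1/2)^k * nrm (\<lambda>i. z i - w i)"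
      using nrm_scale(2)[OF nrm_diff(1)[OF z(1) w(1)], of "(1/2)^k"]
      by (simp add: w_def algebra_simps norm_power norm_divide power_one_over)
    also have "\<dots> < (1/2)^k * (r/2)" using z by simp
    finally have "nrm (\<lambda>i. y i - (1/2)^k * z i) < r * (1/2) ^ Suc k"
      by (subst nrm_diff_commute) (simp add: algebra_simps)
    moreover have "q (\<lambda>i. (1/2)^k * z i) \<le> n * (1/2)^k"
      using scale[OF z(1), of "(1/2)^k"] z(3) by (simp add: norm_power norm_divide field_simps)
    ultimately show ?thesis
      using nrm_scale(1)[OF z(1), of "(1/2)^k"] by (intro bexI[of _ "\<lambda>i. (1/2)^k * z i"]) auto
  qed
  have bound: "q x \<le> 2 * n" if x: "x \<in> lp p" "nrm x < r" for x
  proof -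
    \<comment> \<open>Successive approximation: \<open>y k\<close> is the remainder after
      \<open>k\<close> corrections, so \<open>x\<close> is the sum of the increments. Their
      \<open>q\<close>-values are at most n / 2^k, which sum to 2 n.\<close>
    have "\<exists>y. \<forall>k. (y k \<in> lp p \<and> nrm (y k) < r * (1/2) ^ k \<and> (k = 0 \<longrightarrow> y k = x)) \<and>
       ((\<lambda>i. y k i - y (Suc k) i) \<in> lp p \<and> q (\<lambda>i. y k i - y (Suc k) i) \<le> n * (1/2) ^ k)"
    proof (rule dependent_nat_choice)
      show "\<exists>y. y \<in> lp p \<and> nrm y < r * (1 / 2) ^ 0 \<and> ((0::nat) = 0 \<longrightarrow> y = x)"
        using x by auto
      fix y k assume y: "y \<in> lp p \<and> nrm y < r * (1 / 2) ^ k \<and> (k = 0 \<longrightarrow> y = x)"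
      then obtain z where z: "z \<in> lp p" "nrm (\<lambda>i. y i - z i) < r * (1/2) ^ Suc k" "q z \<le> n * (1/2) ^ k"
        using dens by blast
      then show "\<exists>y'. (y' \<in> lp p \<and> nrm y' < r * (1 / 2) ^ Suc k \<and> (Suc k = 0 \<longrightarrow> y' = x)) \<and>
         (\<lambda>i. y i - y' i) \<in> lp p \<and> q (\<lambda>i. y i - y' i) \<le> n * (1 / 2) ^ k"
        using y nrm_diff(1) by (intro exI[of _ "\<lambda>i. y i - z i"]) auto
    qed
    then obtain y where y: "\<And>k. y k \<in> lp p" "\<And>k. nrm (y k) < r * (1/2) ^ k" "y 0 = x"
      "\<And>k. q (\<lambda>i. y k i - y (Suc k) i) \<le> n * (1/2) ^ k" by blast
    define X where "X k = (\<lambda>i. y k i - y (Suc k) i)" for k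
    have Xl: "X k \<in> lp p" for k unfolding X_def by (intro nrm_diff y)
    have sumX: "(\<Sum>k<J. X k i) - x i = - y J i" for J i
      unfolding X_def using sum_lessThan_telescope'[of "\<lambda>k. y k i" J] y(3) by simp
    have gs: "(\<lambda>k. real n * (1/2) ^ k) sums (real n * 2)"
      using sums_mult[OF geometric_sums[of "1/2::real"], of "real n"] by simp
    have qX: "q (X k) \<le> real n * (1/2) ^ k" for k
      using y(4)[of k] by (simp add: X_def)
    have sq: "summable (\<lambda>k. q (X k))"
    proof (rule summable_comparison_test'[OF sums_summable[OF gs], of 0])
      show "norm (q (X k)) \<le> real n * (1/2) ^ k" for k
        using qX[of k] nonneg[OF Xl, of k] by simp
    qed
    have "q x \<le> (\<Sum>k. q (X k))"
    proof (rule csub)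
      have lim: "(\<lambda>J. r * (1/2) ^ J) \<longlonglongrightarrow> 0"
        by (intro tendsto_mult_right_zero LIMSEQ_realpow_zero) auto
      have le: "norm (nrm (y J)) \<le> r * (1/2) ^ J" for J
        using y(2)[of J] nrm_nonneg[of "y J"] by simp
      have "(\<lambda>J. nrm (y J)) \<longlonglongrightarrow> 0"
        by (rule null_comparison[OF le lim])
      then show "(\<lambda>J. nrm (\<lambda>i. (\<Sum>j<J. X j i) - x i)) \<longlonglongrightarrow> 0"
        by (simp add: sumX nrm_minus y(1))
    qed (fact Xl x(1) sq)+
    also have "\<dots> \<le> (\<Sum>k. real n * (1/2) ^ k)"
      by (rule suminf_le[OF qX sq sums_summable[OF gs]])
    also have "\<dots> = 2 * n" using sums_unique[OF gs] by simp
    finally show ?thesis .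
  qed
  \<comment> \<open>Rescaling \<open>x\<close> to norm r/2, where \<open>q\<close> is at most 2 n,
    gives the factor 4 n / r; the summand 1 keeps \<open>C\<close> positive when n = 0.\<close>
  define C where "C = 4 * real n / r + 1"
  have C: "C > 0" using r by (simp add: C_def add_nonneg_pos)
  have "q x \<le> C * nrm x" if x: "x \<in> lp p" for x
  proof (cases "nrm x = 0")
    case True
    then have "x = (\<lambda>i. 0)" using nrm_zero_imp[OF x] by auto
    then show ?thesis using q0 zero_lp by simp
  next
    case False
    then have pos: "nrm x > 0" using nrm_nonneg[of x] by simp
    define a where "a = complex_of_real (r / (2 * nrm x))"
    have a: "cmod a = r / (2 * nrm x)" using pos r by (simp add: a_def norm_divide)
    have "nrm (\<lambda>i. a * x i) < r" using nrm_scale(2)[OF x, of a] a pos r by simp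
    from bound[OF nrm_scale(1)[OF x] this] have "q x * (r / (2 * nrm x)) \<le> 2 * n"
      using scale[OF x, of a] a by (simp add: mult.commute)
    then have "q x \<le> 4 * real n / r * nrm x" using pos r by (simp add: field_simps)
    also have "\<dots> \<le> C * nrm x" using pos by (simp add: C_def distrib_right)
    finally show ?thesis .
  qed
  then show ?thesis using C by blast
qed

end

subsection \<open>Disjoint blocks and Hardy's inequality\<close>

context lp_space begin

lemma finite_support_lp:
  assumes "finite A" "\<And>i. i \<notin> A \<Longrightarrow> x i = 0"
  shows "x \<in> lp p"
  unfolding lp_def using assms p0 by (auto intro!: summable_finite[of A])

lemma restrict_lp: "x \<in> lp p \<Longrightarrow> (\<lambda>i. if P i then x i else 0) \<in> lp p"
  by (rule nrm_mono[of x]) auto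

lemma nrm_restrict: "x \<in> lp p \<Longrightarrow> nrm (\<lambda>i. if P i then x i else 0) \<le> nrm x"
  by (rule nrm_mono[of x]) auto

text \<open>Estimates for finite combinations are stated with it so that they also apply to
  coefficients not yet known to lie in \<open>lp p\<close>.\<close>

definition head_norm :: "cseq \<Rightarrow> nat \<Rightarrow> real" where
  "head_norm c J = (\<Sum>j<J. cmod (c j) powr p) powr (1 / p)"

lemma head_norm_nonneg: "0 \<le> head_norm c J"
  by (simp add: head_norm_def)

lemma head_norm_powr: "head_norm c J powr p = (\<Sum>j<J. cmod (c j) powr p)"
  using p0 by (simp add: head_norm_def powr_powr sum_nonneg)

lemma coord_le_head: 
  assumes "j < J" shows "cmod (c j) \<le> head_norm c J"
proof (rule powr_p_le_cancel)
  show "cmod (c j) powr p \<le> head_norm c J powr p"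
    unfolding head_norm_powr using assms by (intro member_le_sum) auto
qed (auto simp: head_norm_nonneg)

lemma nrm_finite_sum:
  assumes "\<And>i. i \<ge> N \<Longrightarrow> x i = 0"
  shows "nrm x = (\<Sum>n<N. cmod (x n) powr p) powr (1 / p)"
proof -
  have "(\<Sum>n. cmod (x n) powr p) = (\<Sum>n<N. cmod (x n) powr p)"
    using assms p0 by (intro suminf_finite) auto
  then show ?thesis by (simp add: lp_norm_def)
qed

lemma tail_tendsto:
  assumes "x \<in> lp p"
  shows "(\<lambda>N. nrm (\<lambda>i. if N \<le> i then x i else 0)) \<longlonglongrightarrow> 0"
proof -
  have s: "summable (\<lambda>n. cmod (x n) powr p)" using assms by (simp add: lp_def)
  have "(\<lambda>N. (\<Sum>n. cmod (x (n + N)) powr p)) \<longlonglongrightarrow> 0"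
    using suminf_exist_split2[OF s] .
  then have "(\<lambda>N. (\<Sum>n. cmod (x (n + N)) powr p) powr (1/p)) \<longlonglongrightarrow> 0 powr (1/p)"
    using p0 s by (intro tendsto_powr2) (simp_all add: suminf_nonneg summable_iff_shift[of "\<lambda>n. cmod (x n) powr p"])
  moreover have "(\<Sum>n. cmod (if N \<le> n then x n else 0) powr p) = (\<Sum>n. cmod (x (n + N)) powr p)" for N
  proof -
    have "(\<lambda>n. cmod (if N \<le> n then x n else 0) powr p) \<in> {f. summable f}"
      using restrict_lp[OF assms, of "\<lambda>n. N \<le> n"] by (simp add: lp_def)
    then show ?thesis
      using suminf_split_initial_segment[of "\<lambda>n. cmod (if N \<le> n then x n else 0) powr p" N] p0
      by simp
  qed
  ultimately show ?thesis using p0 by (simp add: lp_norm_def)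
qed

text \<open>At each index at most one block is nonzero, so the p-th power passes through the sum
  over \<open>j\<close>.\<close>

lemma disjoint_blocks_norm:
  assumes N: "incseq (N :: nat \<Rightarrow> nat)"
    and supp: "\<And>j i. y j i \<noteq> 0 \<Longrightarrow> N j \<le> i \<and> i < N (Suc j)"
  shows "nrm (\<lambda>i. \<Sum>j<J. c j * y j i) = (\<Sum>j<J. cmod (c j) powr p * nrm (y j) powr p) powr (1 / p)"
proof -
  have yfin: "y j \<in> lp p" for j
    by (rule finite_support_lp[of "{..<N (Suc j)}"]) (use supp in auto)
  have "(\<Sum>n. cmod (\<Sum>j<J. c j * y j n) powr p) = (\<Sum>n. \<Sum>j<J. cmod (c j) powr p * cmod (y j n) powr p)"
  proof (rule suminf_cong)
    fix n
    show "cmod (\<Sum>j<J. c j * y j n) powr p = (\<Sum>j<J. cmod (c j) powr p * cmod (y j n) powr p)"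
    proof (cases "\<exists>j<J. y j n \<noteq> 0")
      case True
      then obtain j where j: "j < J" "y j n \<noteq> 0" by blast
      have other: "y l n = 0" if "l \<noteq> j" for l
      proof (rule ccontr)
        assume "y l n \<noteq> 0"
        then have "N l < N (Suc j)" "N j < N (Suc l)" using supp j by (meson le_less_trans)+
        moreover have "Suc l \<le> j \<or> Suc j \<le> l" using that by auto
        ultimately show False using N by (meson incseqD leD order_trans less_le_trans)
      qed
      have "(\<Sum>l<J. c l * y l n) = (\<Sum>l\<in>{j}. c l * y l n)"
        using j other by (intro sum.mono_neutral_right) auto
      moreover have "(\<Sum>l<J. cmod (c l) powr p * cmod (y l n) powr p) = (\<Sum>l\<in>{j}. cmod (c l) powr p * cmod (y l n) powr p)"
        using j other p0 by (intro sum.mono_neutral_right) auto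
      ultimately show ?thesis by (simp add: norm_mult powr_mult)
    next
      case False
      then show ?thesis using p0 by simp
    qed
  qed
  also have "\<dots> = (\<Sum>j<J. \<Sum>n. cmod (c j) powr p * cmod (y j n) powr p)"
    using yfin by (intro suminf_sum) (auto simp: lp_def intro: summable_mult)
  also have "\<dots> = (\<Sum>j<J. cmod (c j) powr p * nrm (y j) powr p)"
    using yfin by (intro sum.cong refl) (simp add: nrm_powr suminf_mult lp_def)
  finally show ?thesis by (simp add: lp_norm_def)
qed

lemma head_coord_tendsto:
  assumes z: "\<And>k. z k \<in> lp p" and null: "\<And>i. (\<lambda>k. z k i) \<longlonglongrightarrow> 0"
  shows "(\<lambda>k. nrm (\<lambda>i. if i < N then z k i else 0)) \<longlonglongrightarrow> 0"
proof -
  have "nrm (\<lambda>i. if i < N then z k i else 0) = (\<Sum>n<N. cmod (z k n) powr p) powr (1/p)" for k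
    by (subst nrm_finite_sum[of N]) auto
  moreover have "(\<lambda>k. (\<Sum>n<N. cmod (z k n) powr p) powr (1/p)) \<longlonglongrightarrow> (\<Sum>n<N. cmod 0 powr p) powr (1/p)"
    using p0 by (intro tendsto_powr2 tendsto_sum tendsto_norm null) (simp_all add: sum_nonneg)
  ultimately show ?thesis using p0 by simp
qed

text \<open>Gliding hump: up to summable errors, a subsequence of a bounded coordinatewise null sequence
  consists of disjoint blocks. The index gaps of 2 keep the range of the subsequence co-infinite.\<close>

lemma gliding_hump:
  assumes z: "\<And>k. z k \<in> lp p" and M: "\<And>k. nrm (z k) \<le> M"
    and null: "\<And>i. (\<lambda>k. z k i) \<longlonglongrightarrow> 0" and d: "\<delta> > 0"
  obtains \<kappa> :: "nat \<Rightarrow> nat" where "\<And>j. \<kappa> j + 2 \<le> \<kappa> (Suc j)"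
    "\<And>c J. nrm (\<lambda>i. \<Sum>j<J. c j * z (\<kappa> j) i) \<le> (M + \<delta>) * head_norm c J"
    "\<And>c J. (\<And>k. \<delta> \<le> nrm (z k)) \<Longrightarrow> \<delta> / 4 * head_norm c J \<le> nrm (\<lambda>i. \<Sum>j<J. c j * z (\<kappa> j) i)"
proof -
  \<comment> \<open>Head and tail errors cost at most 2 \<eta> j for each vector, hence \<delta>/4
    in total. The blocks keep norm at least \<delta>/2, and the lower estimate retains
    \<delta>/4.\<close>
  define \<eta> where "\<eta> j = \<delta> / 16 * (1/2)^j" for j :: nat
  have \<eta>pos: "\<eta> j > 0" for j using d by (simp add: \<eta>_def)
  define hd where "hd k N = (\<lambda>i. if i < N then z k i else 0)" for k and N :: nat
  define tl where "tl k N = (\<lambda>i. if N \<le> i then z k i else 0)" for k and N :: nat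
  have hdl: "hd k N \<in> lp p" and tll: "tl k N \<in> lp p" for k N
    unfolding hd_def tl_def by (intro restrict_lp z)+
  \<comment> \<open>Each state is a pair of a vector index and a cutoff: beyond its cutoff the
    vector is small, and the next vector is chosen small before that cutoff.\<close>
  have "\<exists>f. \<forall>j. nrm (tl (fst (f j)) (snd (f j))) \<le> \<eta> j \<and>
      (fst (f j) + 2 \<le> fst (f (Suc j)) \<and> snd (f j) < snd (f (Suc j)) \<and>
       nrm (hd (fst (f (Suc j))) (snd (f j))) \<le> \<eta> (Suc j))"
  proof (rule dependent_nat_choice)
    obtain N where "nrm (tl 0 N) < \<eta> 0"
      using order_tendstoD(2)[OF tail_tendsto[OF z[of 0]] \<eta>pos[of 0]]
      by (auto simp: eventually_sequentially tl_def)
    then show "\<exists>x. nrm (tl (fst x) (snd x)) \<le> \<eta> 0"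
      by (intro exI[of _ "(0, N)"]) simp
  next
    fix x :: "nat \<times> nat" and j
    obtain K where K: "\<forall>k\<ge>K. nrm (hd k (snd x)) < \<eta> (Suc j)"
      using order_tendstoD(2)[OF head_coord_tendsto[OF z null] \<eta>pos[of "Suc j"]]
      by (auto simp: eventually_sequentially hd_def)
    define k where "k = max K (fst x + 2)"
    obtain N where N: "\<forall>n\<ge>N. nrm (tl k n) < \<eta> (Suc j)"
      using order_tendstoD(2)[OF tail_tendsto[OF z[of k]] \<eta>pos[of "Suc j"]]
      by (auto simp: eventually_sequentially tl_def)
    show "\<exists>y. nrm (tl (fst y) (snd y)) \<le> \<eta> (Suc j) \<and> fst x + 2 \<le> fst y \<and> snd x < snd y \<and>
       nrm (hd (fst y) (snd x)) \<le> \<eta> (Suc j)"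
      using K N by (intro exI[of _ "(k, max N (Suc (snd x)))"]) (auto simp: k_def intro: less_imp_le)
  qed
  then obtain f where f: "\<And>j. nrm (tl (fst (f j)) (snd (f j))) \<le> \<eta> j"
    "\<And>j. fst (f j) + 2 \<le> fst (f (Suc j))" "\<And>j. snd (f j) < snd (f (Suc j))"
    "\<And>j. nrm (hd (fst (f (Suc j))) (snd (f j))) \<le> \<eta> (Suc j)" by blast
  define \<kappa> where "\<kappa> j = fst (f j)" for j
  \<comment> \<open>Block \<open>j\<close> starts at the cutoff of its predecessor; starting block 0
    at 0 makes its head empty.\<close>
  define N where "N j = (case j of 0 \<Rightarrow> 0 | Suc l \<Rightarrow> snd (f l))" for j
  have Nle: "N j \<le> N (Suc j)" for j
    using f(3) by (auto simp: N_def less_imp_le split: nat.split)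
  define y where "y j = (\<lambda>i. if N j \<le> i \<and> i < N (Suc j) then z (\<kappa> j) i else 0)" for j
  define w where "w j = (\<lambda>i. z (\<kappa> j) i - y j i)" for j
  have yl: "y j \<in> lp p" for j unfolding y_def by (intro restrict_lp z)
  have wl: "w j \<in> lp p" for j unfolding w_def by (intro nrm_diff yl z)
  have hd0: "nrm (hd (\<kappa> j) (N j)) \<le> \<eta> j" for j
    using f(4) less_imp_le[OF \<eta>pos[of 0]]
    by (cases j) (auto simp: \<kappa>_def N_def hd_def zero_lp)
  have wn: "nrm (w j) \<le> 2 * \<eta> j" for j
  proof -
    have "w j = (\<lambda>i. hd (\<kappa> j) (N j) i + tl (\<kappa> j) (N (Suc j)) i)"
      using Nle[of j] by (auto simp: w_def y_def hd_def tl_def fun_eq_iff)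
    then have "nrm (w j) \<le> nrm (hd (\<kappa> j) (N j)) + nrm (tl (\<kappa> j) (N (Suc j)))"
      using nrm_add(2)[OF hdl tll] by simp
    also have "\<dots> \<le> \<eta> j + \<eta> j"
      using hd0 f(1) by (intro add_mono) (auto simp: N_def \<kappa>_def)
    finally show ?thesis by simp
  qed
  define ysum where "ysum c J = nrm (\<lambda>i. \<Sum>j<J. c j * y j i)" for c J
  define wsum where "wsum c J = nrm (\<lambda>i. \<Sum>j<J. c j * w j i)" for c J
  have ys: "ysum c J = (\<Sum>j<J. cmod (c j) powr p * nrm (y j) powr p) powr (1 / p)" for c J
    unfolding ysum_def using Nle
    by (intro disjoint_blocks_norm[of N] incseq_SucI) (auto simp: y_def split: if_splits)
  have ylu: "nrm (y j) \<le> M" for j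
    unfolding y_def by (rule order_trans[OF nrm_restrict[OF z] M])
  have M0: "0 \<le> M" using M nrm_nonneg order_trans by blast
  have yup: "ysum c J \<le> M * head_norm c J" for c J
  proof -
    have "(\<Sum>j<J. cmod (c j) powr p * nrm (y j) powr p) \<le> (\<Sum>j<J. cmod (c j) powr p * M powr p)"
      using ylu p0 nrm_nonneg by (intro sum_mono mult_left_mono powr_mono2) auto
    then have "ysum c J \<le> (\<Sum>j<J. cmod (c j) powr p * M powr p) powr (1/p)"
      unfolding ys using p0 by (intro powr_mono2) (auto intro!: sum_nonneg)
    also have "\<dots> = M * head_norm c J"
      using p0 M0 by (simp add: head_norm_def sum_distrib_right[symmetric] powr_mult powr_powr sum_nonneg)
    finally show ?thesis .
  qed
  have wup: "wsum c J \<le> \<delta> / 4 * head_norm c J" for c J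
  proof -
    have "wsum c J \<le> (\<Sum>j<J. nrm (\<lambda>i. c j * w j i))"
      unfolding wsum_def using nrm_sum[of "{..<J}" "\<lambda>j i. c j * w j i"] nrm_scale(1)[OF wl] by simp
    also have "\<dots> = (\<Sum>j<J. cmod (c j) * nrm (w j))" by (simp add: nrm_scale(2)[OF wl])
    also have "\<dots> \<le> (\<Sum>j<J. head_norm c J * (2 * \<eta> j))"
      using coord_le_head head_norm_nonneg wn nrm_nonneg by (intro sum_mono mult_mono) auto
    also have "\<dots> = head_norm c J * (\<delta> / 8 * (\<Sum>j<J. (1/2)^j))"
      by (simp add: sum_distrib_left \<eta>_def algebra_simps)
    also have "\<dots> \<le> head_norm c J * (\<delta> / 8 * 2)"
      using d head_norm_nonneg by (intro mult_left_mono) (auto simp: geometric_sum)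
    finally show ?thesis by (simp add: mult.commute)
  qed
  have split: "(\<Sum>j<J. c j * z (\<kappa> j) i) = (\<Sum>j<J. c j * y j i) + (\<Sum>j<J. c j * w j i)" for c J i
    unfolding sum.distrib[symmetric] w_def by (simp add: right_diff_distrib)
  have cyl: "(\<lambda>i. \<Sum>j<J. c j * y j i) \<in> lp p" and cwl: "(\<lambda>i. \<Sum>j<J. c j * w j i) \<in> lp p" for c J
    using sum_lp[of "{..<J}" "\<lambda>j i. c j * y j i"] sum_lp[of "{..<J}" "\<lambda>j i. c j * w j i"]
      nrm_scale(1)[OF yl] nrm_scale(1)[OF wl] by auto
  show thesis
  proof (rule that[of \<kappa>])
    show "\<kappa> j + 2 \<le> \<kappa> (Suc j)" for j using f(2) by (simp add: \<kappa>_def)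
    show "nrm (\<lambda>i. \<Sum>j<J. c j * z (\<kappa> j) i) \<le> (M + \<delta>) * head_norm c J" for c J
    proof -
      have "nrm (\<lambda>i. \<Sum>j<J. c j * z (\<kappa> j) i) \<le> ysum c J + wsum c J"
        unfolding split ysum_def wsum_def by (rule nrm_add(2)[OF cyl cwl])
      also have "\<dots> \<le> M * head_norm c J + \<delta> / 4 * head_norm c J" by (rule add_mono[OF yup wup])
      also have "\<dots> \<le> (M + \<delta>) * head_norm c J" using d head_norm_nonneg[of c J] by (simp add: algebra_simps)
      finally show ?thesis .
    qed
    \<comment> \<open>The lower bound is a premise of this estimate only, because
      \<open>basis_null_subsequence\<close> applies the lemma for its upper estimate alone.\<close>
    fix c J assume low: "\<And>k. \<delta> \<le> nrm (z k)"
    have ylow: "\<delta> / 2 \<le> nrm (y j)" for j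
    proof -
      have "\<delta> \<le> nrm (w j) + nrm (y j)"
        using low[of "\<kappa> j"] nrm_triangle2[OF z yl, of "\<kappa> j" j] unfolding w_def by simp
      moreover have "\<eta> j \<le> \<delta> / 16"
        using d by (simp add: \<eta>_def power_le_one mult_left_le)
      ultimately show ?thesis using wn[of j] d by simp
    qed
    have "\<delta> / 2 * head_norm c J = (\<Sum>j<J. cmod (c j) powr p * (\<delta>/2) powr p) powr (1/p)"
      using p0 d by (simp add: head_norm_def sum_distrib_right[symmetric] powr_mult powr_powr sum_nonneg)
    also have "\<dots> \<le> ysum c J"
      unfolding ys using p0 ylow d
      by (intro powr_mono2 sum_mono mult_left_mono) (auto intro!: sum_nonneg)
    also have "ysum c J \<le> nrm (\<lambda>i. \<Sum>j<J. c j * z (\<kappa> j) i) + wsum c J"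
    proof -
      have "ysum c J = nrm (\<lambda>i. (\<Sum>j<J. c j * z (\<kappa> j) i) - (\<Sum>j<J. c j * w j i))"
        unfolding split ysum_def by simp
      also have "\<dots> \<le> nrm (\<lambda>i. \<Sum>j<J. c j * z (\<kappa> j) i) + wsum c J"
        unfolding wsum_def split by (intro nrm_diff(2) nrm_add cyl cwl)
      finally show ?thesis .
    qed
    finally show "\<delta> / 4 * head_norm c J \<le> nrm (\<lambda>i. \<Sum>j<J. c j * z (\<kappa> j) i)"
      using wup[of c J] by simp
  qed
qed

section \<open>Hardy's inequality and dominated convergence\<close>

lemma young_powr:
  assumes "0 \<le> a" "0 \<le> b"
  shows "p * (a powr (p - 1) * b) \<le> (p - 1) * a powr p + b powr p"
proof -
  have "b * a powr (p - 1) \<le> b powr p / p + (a powr (p-1)) powr (p/(p-1)) / (p/(p-1))"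
    using p1 assms by (intro Youngs_inequality) (auto simp: field_simps)
  moreover have "(a powr (p-1)) powr (p/(p-1)) = a powr p"
    using p1 by (simp add: powr_powr)
  ultimately show ?thesis using p1 by (simp add: field_simps)
qed

text \<open>Elliott's proof of Hardy's inequality; the constant is not optimal.\<close>

lemma hardy:
  fixes a :: "nat \<Rightarrow> real"
  assumes a: "\<And>n. 0 \<le> a n"
  shows "(\<Sum>n<N. ((\<Sum>m\<le>n. a m) / real (Suc n)) powr p) \<le> 2 powr p / (p - 1) * (\<Sum>n<N. a n powr p)"
proof -
  define \<alpha> where "\<alpha> n = (\<Sum>m\<le>n. a m) / real (Suc n)" for n
  have \<alpha>0: "0 \<le> \<alpha> n" for n using a by (simp add: \<alpha>_def sum_nonneg)
  \<comment> \<open>Writing a N = (N+1) \<alpha> N - N \<alpha> (N-1) and applying Young to the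
    mixed product bounds each summand by N \<alpha> (N-1)^p - (N+1) \<alpha> N^p, which
    telescopes.\<close>
  have tele: "(p - 1) * (\<Sum>n<N. \<alpha> n powr p) - p * (\<Sum>n<N. \<alpha> n powr (p - 1) * a n) \<le>
      - (if N = 0 then 0 else real N * \<alpha> (N - 1) powr p)" for N
  proof (induction N)
    case 0 then show ?case by simp
  next
    case (Suc N)
    define b where "b = (if N = 0 then 0 else \<alpha> (N - 1))"
    have b0: "0 \<le> b" using \<alpha>0 by (simp add: b_def)
    have aN: "a N = real (Suc N) * \<alpha> N - real N * b"
      by (cases N) (auto simp: \<alpha>_def b_def)
    have pw: "\<alpha> N powr (p - 1) * \<alpha> N = \<alpha> N powr p"
      using \<alpha>0[of N] p1 by (cases "\<alpha> N = 0") (auto simp: powr_mult_base[of "\<alpha> N" "p-1"] mult.commute)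
    have "real N * (p * (\<alpha> N powr (p - 1) * b)) \<le> real N * ((p - 1) * \<alpha> N powr p + b powr p)"
      using young_powr[OF \<alpha>0 b0] by (intro mult_left_mono) auto
    moreover have "p * (\<alpha> N powr (p - 1) * a N) = p * (real (Suc N) * \<alpha> N powr p) - real N * (p * (\<alpha> N powr (p - 1) * b))"
      unfolding aN pw[symmetric] by (simp add: algebra_simps)
    moreover have "(if N = 0 then 0 else real N * \<alpha> (N - 1) powr p) = real N * b powr p"
      by (simp add: b_def)
    ultimately show ?case using Suc by (simp add: algebra_simps)
  qed
  have "(p - 1) * (\<Sum>n<N. \<alpha> n powr p) \<le> p * (\<Sum>n<N. \<alpha> n powr (p - 1) * a n)"
  proof -
    have "0 \<le> (if N = 0 then 0 else real N * \<alpha> (N - 1) powr p)" by simp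
    then show ?thesis using tele[of N] by linarith
  qed
  \<comment> \<open>Young is applied to \<alpha> n and 2 a n and then halved, so that half of the
    left-hand side can be absorbed; this is the origin of \<open>2 powr p\<close>.\<close>
  also have "p * (\<Sum>n<N. \<alpha> n powr (p - 1) * a n) \<le> (\<Sum>n<N. (p-1)/2 * \<alpha> n powr p + 2 powr p / 2 * a n powr p)"
    unfolding sum_distrib_left
  proof (rule sum_mono)
    fix n
    show "p * (\<alpha> n powr (p - 1) * a n) \<le> (p-1)/2 * \<alpha> n powr p + 2 powr p / 2 * a n powr p"
      using young_powr[OF \<alpha>0, of "2 * a n" n] a[of n] by (simp add: powr_mult field_simps)
  qed
  also have "\<dots> = (p-1)/2 * (\<Sum>n<N. \<alpha> n powr p) + 2 powr p / 2 * (\<Sum>n<N. a n powr p)"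
    by (simp add: sum.distrib sum_distrib_left)
  finally have "(p-1) * (\<Sum>n<N. \<alpha> n powr p) \<le> 2 powr p * (\<Sum>n<N. a n powr p)"
    by (simp add: field_simps)
  then show ?thesis using p1 by (simp add: \<alpha>_def field_simps)
qed

text \<open>Tannery's theorem for the series of p-th powers. A general filter is taken because it is
  used with \<open>t\<close> tending to 0 through the reals.\<close>

lemma dominated_nrm_tendsto:
  assumes W: "W \<in> lp p" and le: "\<forall>\<^sub>F t in F. \<forall>n. cmod (Y t n) \<le> cmod (W n)"
    and lim: "\<And>n. ((\<lambda>t. Y t n) \<longlongrightarrow> 0) F"
  shows "((\<lambda>t. nrm (Y t)) \<longlongrightarrow> 0) F"
proof (cases "F = bot")
  case False
  have "\<forall>\<^sub>F (n,t) in sequentially \<times>\<^sub>F F. norm (cmod (Y t n) powr p) \<le> cmod (W n) powr p"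
  proof -
    have "\<forall>\<^sub>F x in sequentially \<times>\<^sub>F F. True \<and> (\<forall>n. cmod (Y (snd x) n) \<le> cmod (W n))"
      by (rule eventually_prodI[OF eventually_True le])
    then show ?thesis
      by (rule eventually_mono) (use p0 in \<open>auto intro!: powr_mono2\<close>)
  qed
  moreover have "((\<lambda>t. cmod (Y t n) powr p) \<longlongrightarrow> cmod 0 powr p) F" for n
    using p0 by (intro tendsto_powr2 tendsto_norm lim) auto
  ultimately have "((\<lambda>t. \<Sum>n. cmod (Y t n) powr p) \<longlongrightarrow> (\<Sum>n::nat. cmod 0 powr p)) F"
    using tannerys_theorem[of "\<lambda>n t. cmod (Y t n) powr p" "\<lambda>n. cmod 0 powr p" F "\<lambda>n. cmod (W n) powr p"]
      W False by (simp add: lp_def)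
  moreover have "\<forall>\<^sub>F t in F. 0 \<le> (\<Sum>n. cmod (Y t n) powr p)"
    using le by eventually_elim (use nrm_mono(1)[OF W] in \<open>auto simp: lp_def intro!: suminf_nonneg\<close>)
  ultimately have "((\<lambda>t. (\<Sum>n. cmod (Y t n) powr p) powr (1/p)) \<longlongrightarrow> 0 powr (1/p)) F"
    using p0 by (intro tendsto_powr2) auto
  then show ?thesis using p0 by (simp add: lp_norm_def)
qed simp

end

subsection \<open>Schauder bases of \<open>\<ell>\<^sub>p\<close>\<close>

locale lp_basis = lp_space +
  fixes e :: "nat \<Rightarrow> cseq"
  assumes basis: "schauder_basis (lp p) (lp_norm p) e"
begin

abbreviation psum :: "cseq \<Rightarrow> nat \<Rightarrow> cseq" where
  "psum c m \<equiv> (\<lambda>i. \<Sum>n<m. c n * e n i)"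

abbreviation sums_to :: "cseq \<Rightarrow> cseq \<Rightarrow> bool" where
  "sums_to c x \<equiv> sums_in (lp p) nrm c e x"

definition conv :: "cseq \<Rightarrow> bool" where
  "conv c \<longleftrightarrow> (\<exists>x. sums_to c x)"

definition coef :: "cseq \<Rightarrow> cseq" where
  "coef x = (THE c. sums_to c x)"

lemma e_lp: "e n \<in> lp p"
  using basis by (simp add: schauder_basis_def)

lemma psum_lp: "psum c m \<in> lp p"
  using e_lp by (intro sum_lp nrm_scale) auto

lemma sums_to_iff: "sums_to c x \<longleftrightarrow> x \<in> lp p \<and> (\<lambda>m. nrm (\<lambda>i. psum c m i - x i)) \<longlonglongrightarrow> 0"
  using psum_lp by (simp add: sums_in_def tendsto_in_def)

lemma sums_to_lp: "sums_to c x \<Longrightarrow> x \<in> lp p"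
  by (simp add: sums_to_iff)

lemma sums_to_unique: "sums_to c x \<Longrightarrow> sums_to c y \<Longrightarrow> x = y"
  unfolding sums_to_iff using psum_lp
  by (auto intro!: nrm_tendsto_unique[of "psum c" x sequentially y])

lemma coef_ex1: "x \<in> lp p \<Longrightarrow> \<exists>!c. sums_to c x"
  using basis by (simp add: schauder_basis_def)

lemma coef_sums: "x \<in> lp p \<Longrightarrow> sums_to (coef x) x"
  unfolding coef_def by (rule theI'[OF coef_ex1])

lemma coef_eqI: "sums_to c x \<Longrightarrow> coef x = c"
  using coef_ex1[OF sums_to_lp] coef_sums[OF sums_to_lp] by blast

lemma sums_to_scale:
  assumes "sums_to c x" shows "sums_to (\<lambda>n. a * c n) (\<lambda>i. a * x i)"
proof -
  have eq: "(\<lambda>i. psum (\<lambda>n. a * c n) m i - a * x i) = (\<lambda>i. a * (psum c m i - x i))" for m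
    by (simp add: right_diff_distrib sum_distrib_left mult.assoc)
  have "nrm (\<lambda>i. a * (psum c m i - x i)) = cmod a * nrm (\<lambda>i. psum c m i - x i)" for m
    using assms by (intro nrm_scale(2) nrm_diff psum_lp) (simp add: sums_to_iff)
  moreover have "(\<lambda>m. cmod a * nrm (\<lambda>i. psum c m i - x i)) \<longlonglongrightarrow> 0"
    using assms by (intro tendsto_mult_right_zero) (simp add: sums_to_iff)
  ultimately show ?thesis
    using assms unfolding sums_to_iff eq by (simp add: nrm_scale)
qed

lemma sums_to_add:
  assumes "sums_to c x" "sums_to d y"
  shows "sums_to (\<lambda>n. c n + d n) (\<lambda>i. x i + y i)"
proof -
  have xy: "x \<in> lp p" "y \<in> lp p" using assms by (auto simp: sums_to_iff)
  have eq: "(\<lambda>i. psum (\<lambda>n. c n + d n) m i - (x i + y i)) = (\<lambda>i. (psum c m i - x i) + (psum d m i - y i))" for m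
    by (simp add: distrib_right sum.distrib fun_eq_iff)
  have le: "norm (nrm (\<lambda>i. (psum c m i - x i) + (psum d m i - y i)))
     \<le> nrm (\<lambda>i. psum c m i - x i) + nrm (\<lambda>i. psum d m i - y i)" for m
    using nrm_add(2)[OF nrm_diff(1)[OF psum_lp[of c m] xy(1)] nrm_diff(1)[OF psum_lp[of d m] xy(2)]] nrm_nonneg by simp
  have "(\<lambda>m. nrm (\<lambda>i. psum c m i - x i) + nrm (\<lambda>i. psum d m i - y i)) \<longlonglongrightarrow> 0"
    using assms by (intro tendsto_add_zero) (auto simp: sums_to_iff)
  from null_comparison[OF le this] show ?thesis
    unfolding sums_to_iff eq using nrm_add(1)[OF xy] by simp
qed

lemma conv_add: "conv c \<Longrightarrow> conv d \<Longrightarrow> conv (\<lambda>n. c n + d n)"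
  unfolding conv_def using sums_to_add by blast

lemma conv_diff: "conv c \<Longrightarrow> conv d \<Longrightarrow> conv (\<lambda>n. c n - d n)"
  using conv_add[of c "\<lambda>n. -1 * d n"] sums_to_scale[of d _ "-1"] unfolding conv_def by auto

lemma sums_to_eventually:
  assumes "x \<in> lp p" "\<And>m. m \<ge> N \<Longrightarrow> psum c m = x"
  shows "sums_to c x"
  unfolding sums_to_iff
proof
  show "(\<lambda>m. nrm (\<lambda>i. psum c m i - x i)) \<longlonglongrightarrow> 0"
  proof (rule tendsto_eventually, rule eventually_sequentiallyI[of N])
    fix m assume "N \<le> m"
    then have "psum c m i = x i" for i using assms(2) by metis
    then show "nrm (\<lambda>i. psum c m i - x i) = 0" by (simp add: zero_lp)
  qed
qed fact

lemma coef_scale: "x \<in> lp p \<Longrightarrow> coef (\<lambda>i. a * x i) = (\<lambda>n. a * coef x n)"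
  by (intro coef_eqI sums_to_scale coef_sums)

lemma coef_add: "x \<in> lp p \<Longrightarrow> y \<in> lp p \<Longrightarrow> coef (\<lambda>i. x i + y i) = (\<lambda>n. coef x n + coef y n)"
  by (intro coef_eqI sums_to_add coef_sums)

lemma coef_diff: "x \<in> lp p \<Longrightarrow> y \<in> lp p \<Longrightarrow> coef (\<lambda>i. x i - y i) = (\<lambda>n. coef x n - coef y n)"
  using coef_add[of x "\<lambda>i. -1 * y i"] coef_scale[of y "-1"] nrm_minus(1)[of y] by simp

lemma coef_zero: "coef (\<lambda>i. 0) = (\<lambda>n. 0)"
  using coef_scale[OF zero_lp(1), of 0] by simp

lemma coef_sum:
  assumes "finite A" "\<And>j. j \<in> A \<Longrightarrow> X j \<in> lp p"
  shows "coef (\<lambda>i. \<Sum>j\<in>A. X j i) = (\<lambda>n. \<Sum>j\<in>A. coef (X j) n)"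
  using assms
proof (induction A rule: finite_induct)
  case (insert a A)
  then show ?case
    using coef_add[of "X a" "\<lambda>i. \<Sum>j\<in>A. X j i"] sum_lp[of A X] by simp
qed (simp add: coef_zero)

lemma coef_e: "coef (e k) = (\<lambda>n. if n = k then 1 else 0)"
proof (rule coef_eqI, rule sums_to_eventually[OF e_lp])
  fix m assume "Suc k \<le> m"
  then have "(\<Sum>n<m. (if n = k then 1 else 0) * e n i) = e k i" for i
    by (simp add: if_distrib[of "\<lambda>c. c * _"] sum.delta cong: if_cong)
  then show "psum (\<lambda>n. if n = k then 1 else 0) m = e k" by auto
qed

lemma e_pos: "nrm (e n) > 0"
proof (rule ccontr)
  assume "\<not> nrm (e n) > 0"
  then have "e n = (\<lambda>i. 0)" using nrm_zero_imp[OF e_lp] by fastforce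
  then have "coef (e n) n = 0" using coef_zero by simp
  then show False by (simp add: coef_e)
qed

text \<open>The classical renorming that makes a basis monotone. Bounding it by the norm bounds all
  partial sum projections simultaneously.\<close>

definition psum_sup :: "cseq \<Rightarrow> real" where
  "psum_sup x = (SUP m. nrm (psum (coef x) m))"

lemma psum_bdd:
  assumes x: "x \<in> lp p" shows "bdd_above (range (\<lambda>m. nrm (psum (coef x) m)))"
proof -
  have "(\<lambda>m. nrm (\<lambda>i. psum (coef x) m i - x i)) \<longlonglongrightarrow> 0"
    using coef_sums[OF x] by (simp add: sums_to_iff)
  from BseqE[OF convergent_imp_Bseq[OF convergentI[OF this]]]
  obtain K where K: "\<forall>m. norm (nrm (\<lambda>i. psum (coef x) m i - x i)) \<le> K"
    .
  show ?thesis
  proof (rule bdd_aboveI2)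
    fix m show "nrm (psum (coef x) m) \<le> K + nrm x"
      using nrm_triangle2[OF psum_lp x, of "coef x" m] spec[OF K, of m] by simp
  qed
qed

lemma psum_le_sup: "x \<in> lp p \<Longrightarrow> nrm (psum (coef x) m) \<le> psum_sup x"
  unfolding psum_sup_def by (intro cSUP_upper psum_bdd) auto

lemma coef_le_sup:
  assumes "x \<in> lp p" shows "cmod (coef x n) * nrm (e n) \<le> 2 * psum_sup x"
proof -
  have "cmod (coef x n) * nrm (e n) = nrm (\<lambda>i. psum (coef x) (Suc n) i - psum (coef x) n i)"
    using nrm_scale(2)[OF e_lp] by simp
  also have "\<dots> \<le> nrm (psum (coef x) (Suc n)) + nrm (psum (coef x) n)"
    by (rule nrm_diff(2)[OF psum_lp psum_lp])
  also have "\<dots> \<le> 2 * psum_sup x" using psum_le_sup[OF assms, of "Suc n"] psum_le_sup[OF assms, of n] by simp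
  finally show ?thesis .
qed

text \<open>Summability of \<open>psum_sup (X j)\<close> forces the coefficients of the
  \<open>X j\<close> to be summable at each index. Their sums \<open>d\<close> are shown to expand
  \<open>x\<close>, so uniqueness of expansions gives \<open>coef x = d\<close>, and the partial
  sums of \<open>x\<close> inherit the bound.\<close>

lemma psum_sup_csub:
  assumes X: "\<And>j. X j \<in> lp p" and x: "x \<in> lp p"
    and lim: "(\<lambda>J. nrm (\<lambda>i. (\<Sum>j<J. X j i) - x i)) \<longlonglongrightarrow> 0"
    and s: "summable (\<lambda>j. psum_sup (X j))"
  shows "psum_sup x \<le> (\<Sum>j. psum_sup (X j))"
proof -
  define C where "C J n = (\<Sum>j<J. coef (X j) n)" for J n
  define R where "R J = (\<Sum>j. psum_sup (X (j + J)))" for J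
  have pos: "0 \<le> psum_sup (X j)" for j
    using psum_le_sup[OF X, of j 0] by (simp add: zero_lp)
  have "summable (\<lambda>j. coef (X j) n)" for n
  proof (rule summable_comparison_test'[of "\<lambda>j. 2 / nrm (e n) * psum_sup (X j)" 0])
    show "norm (coef (X j) n) \<le> 2 / nrm (e n) * psum_sup (X j)" for j
      using coef_le_sup[OF X, of j n] e_pos[of n] by (simp add: field_simps)
  qed (intro summable_mult s)
  then have Clim: "(\<lambda>J. C J n) \<longlonglongrightarrow> (\<Sum>j. coef (X j) n)" for n
    unfolding C_def by (rule summable_LIMSEQ)
  define d where "d n = (\<Sum>j. coef (X j) n)" for n
  \<comment> \<open>The bound is uniform in \<open>m\<close>; this permits fixing \<open>J\<close>
    first and letting \<open>m\<close> grow afterwards.\<close>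
  have part: "nrm (\<lambda>i. psum (C J) m i - psum (C J') m i) \<le> R J" if "J \<le> J'" for J J' m
  proof -
    have "C J' n = C J n + (\<Sum>j\<in>{J..<J'}. coef (X j) n)" for n
      unfolding C_def using sum.atLeastLessThan_concat[of 0 J J' "\<lambda>j. coef (X j) n"] that
      by (simp add: atLeast0LessThan)
    then have eq: "(\<lambda>i. psum (C J) m i - psum (C J') m i) = (\<lambda>i. - (\<Sum>j\<in>{J..<J'}. psum (coef (X j)) m i))"
      by (auto simp: fun_eq_iff distrib_right sum.distrib sum_distrib_right intro: sum.swap)
    have "nrm (\<lambda>i. psum (C J) m i - psum (C J') m i) \<le> (\<Sum>j\<in>{J..<J'}. nrm (psum (coef (X j)) m))"
      unfolding eq using nrm_sum[of "{J..<J'}" "\<lambda>j. psum (coef (X j)) m"] psum_lp nrm_minus(2) by auto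
    also have "\<dots> \<le> (\<Sum>j\<in>{J..<J'}. psum_sup (X j))"
      by (intro sum_mono psum_le_sup X)
    also have "\<dots> = (\<Sum>j<J' - J. psum_sup (X (j + J)))"
      using sum.shift_bounds_nat_ivl[of "\<lambda>j. psum_sup (X j)" 0 J "J' - J"] that by (simp add: atLeast0LessThan)
    also have "\<dots> \<le> R J"
      unfolding R_def using pos s summable_iff_shift[of "\<lambda>j. psum_sup (X j)" J]
      by (intro sum_le_suminf) auto
    finally show ?thesis .
  qed
  have tail: "nrm (\<lambda>i. psum (C J) m i - psum d m i) \<le> R J" for J m
  proof (rule fatou(2))
    show "(\<lambda>J'. psum (C J) m i - psum (C J') m i) \<longlonglongrightarrow> psum (C J) m i - psum d m i" for i
      unfolding d_def by (intro tendsto_intros Clim)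
    show "\<forall>\<^sub>F J' in sequentially. (\<lambda>i. psum (C J) m i - psum (C J') m i) \<in> lp p \<and>
      nrm (\<lambda>i. psum (C J) m i - psum (C J') m i) \<le> R J"
      by (rule eventually_sequentiallyI[of J]) (simp add: part nrm_diff psum_lp)
  qed simp
  have R0: "R \<longlonglongrightarrow> 0"
    unfolding R_def by (rule suminf_exist_split2[OF s])
  have Yl: "(\<lambda>i. \<Sum>j<J. X j i) \<in> lp p" for J using X by (intro sum_lp) auto
  have "sums_to d x"
    unfolding sums_to_iff
  proof
    show "(\<lambda>m. nrm (\<lambda>i. psum d m i - x i)) \<longlonglongrightarrow> 0"
    proof (rule LIMSEQ_I)
      fix \<epsilon> :: real assume "\<epsilon> > 0"
      then have e3: "\<epsilon> / 3 > 0" by simp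
      obtain J where J: "R J < \<epsilon>/3" "nrm (\<lambda>i. (\<Sum>j<J. X j i) - x i) < \<epsilon>/3"
        using eventually_happens[OF eventually_conj[OF order_tendstoD(2)[OF R0 e3] order_tendstoD(2)[OF lim e3]]]
        by auto
      have "sums_to (C J) (\<lambda>i. \<Sum>j<J. X j i)"
        using coef_sums[OF Yl[of J]] coef_sum[of "{..<J}" X] X by (simp add: C_def[abs_def])
      then have "(\<lambda>m. nrm (\<lambda>i. psum (C J) m i - (\<Sum>j<J. X j i))) \<longlonglongrightarrow> 0"
        by (simp add: sums_to_iff)
      from order_tendstoD(2)[OF this e3]
      obtain N where N: "\<And>m. m \<ge> N \<Longrightarrow> nrm (\<lambda>i. psum (C J) m i - (\<Sum>j<J. X j i)) < \<epsilon>/3"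
        by (auto simp: eventually_sequentially)
      show "\<exists>N. \<forall>m\<ge>N. norm (nrm (\<lambda>i. psum d m i - x i) - 0) < \<epsilon>"
      proof (intro exI allI impI)
        fix m assume "m \<ge> N"
        have "nrm (\<lambda>i. psum d m i - x i) \<le> nrm (\<lambda>i. psum d m i - psum (C J) m i) + nrm (\<lambda>i. psum (C J) m i - x i)"
          by (rule nrm_triangle[OF psum_lp psum_lp x])
        also have "nrm (\<lambda>i. psum (C J) m i - x i) \<le> nrm (\<lambda>i. psum (C J) m i - (\<Sum>j<J. X j i)) + nrm (\<lambda>i. (\<Sum>j<J. X j i) - x i)"
          by (rule nrm_triangle[OF psum_lp Yl x])
        also have "nrm (\<lambda>i. psum d m i - psum (C J) m i) \<le> R J"
          using tail[of J m] by (subst nrm_diff_commute)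
        finally have "nrm (\<lambda>i. psum d m i - x i) < \<epsilon>" using J N[OF \<open>m \<ge> N\<close>] by simp
        then show "norm (nrm (\<lambda>i. psum d m i - x i) - 0) < \<epsilon>" using nrm_nonneg by simp
      qed
    qed
  qed fact
  then have "coef x = d" by (rule coef_eqI)
  \<comment> \<open>For J = 0 the coefficients \<open>C J\<close> vanish and \<open>R J\<close> is
    the whole series.\<close>
  moreover have "nrm (psum d m) \<le> R 0" for m
    using tail[of 0 m] nrm_minus(2)[OF psum_lp[of d m]] by (simp add: C_def)
  ultimately show ?thesis
    unfolding psum_sup_def[of x] by (intro cSUP_least) (simp_all add: R_def)
qed

text \<open>Continuity of the coefficient functionals is not part of \<open>schauder_basis\<close>;
  it follows from Zabreiko's lemma for \<open>psum_sup\<close>. The factor \<open>nrm (e n)\<close>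
  makes the constant independent of \<open>n\<close>.\<close>

lemma coef_bounded: "\<exists>B>0. \<forall>x\<in>lp p. \<forall>n. cmod (coef x n) * nrm (e n) \<le> B * nrm x"
proof -
  have "\<exists>C>0. \<forall>x\<in>lp p. psum_sup x \<le> C * nrm x"
  proof (rule zabreiko)
    fix a x assume x: "x \<in> lp p"
    have *: "nrm (psum (coef (\<lambda>i. a * x i)) m) = cmod a * nrm (psum (coef x) m)" for m
      using nrm_scale(2)[OF psum_lp[of "coef x" m], of a] by (simp add: coef_scale[OF x] sum_distrib_left mult.assoc)
    show "psum_sup (\<lambda>i. a * x i) = cmod a * psum_sup x"
    proof -
      let ?S = "Sup (range (\<lambda>m. nrm (psum (coef x) m)))"
      have "continuous (at_left ?S) ((*) (cmod a))" by (intro continuous_intros)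
      then show ?thesis
        unfolding psum_sup_def * using continuous_at_Sup_mono[of "(*) (cmod a)" "range (\<lambda>m. nrm (psum (coef x) m))"]
        psum_bdd[OF x]
        by (simp add: image_image mono_def mult_left_mono)
    qed
    show "0 \<le> psum_sup x" using psum_le_sup[OF x, of 0] by (simp add: zero_lp)
  qed (rule psum_sup_csub)
  then obtain C where C: "C > 0" "\<And>x. x \<in> lp p \<Longrightarrow> psum_sup x \<le> C * nrm x" by blast
  have "cmod (coef x n) * nrm (e n) \<le> (2 * C) * nrm x" if "x \<in> lp p" for x n
    using coef_le_sup[OF that, of n] C(2)[OF that] by simp
  then show ?thesis using C(1) by (intro exI[of _ "2 * C"]) auto
qed

lemma coef_tendsto:
  assumes lim: "((\<lambda>m. nrm (\<lambda>i. X m i - x i)) \<longlongrightarrow> 0) F" and X: "\<And>m. X m \<in> lp p" and x: "x \<in> lp p"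
  shows "((\<lambda>m. coef (X m) n) \<longlongrightarrow> coef x n) F"
proof -
  obtain B where B: "\<And>x. x \<in> lp p \<Longrightarrow> cmod (coef x n) * nrm (e n) \<le> B * nrm x"
    using coef_bounded by blast
  have le: "norm (coef (X m) n - coef x n) \<le> B / nrm (e n) * nrm (\<lambda>i. X m i - x i)" for m
    using B[OF nrm_diff(1)[OF X x], of m] e_pos[of n] by (simp add: coef_diff[OF X x] field_simps)
  have "((\<lambda>m. B / nrm (e n) * nrm (\<lambda>i. X m i - x i)) \<longlongrightarrow> 0) F"
    by (intro tendsto_mult_right_zero lim)
  from null_comparison[OF le this] show ?thesis by (simp add: LIM_zero_cancel)
qed

text \<open>With \<open>abs_conv\<close> this forms the pair of crude convergence tests that is
  available before any p-estimate; \<open>norms_not_separated\<close> plays them against each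
  other.\<close>

lemma conv_null:
  assumes "conv c" shows "(\<lambda>n. cmod (c n) * nrm (e n)) \<longlonglongrightarrow> 0"
proof -
  obtain x where x: "x \<in> lp p" and lim: "(\<lambda>m. nrm (\<lambda>i. psum c m i - x i)) \<longlonglongrightarrow> 0"
    using assms by (auto simp: conv_def sums_to_iff)
  have le: "norm (cmod (c n) * nrm (e n)) \<le> nrm (\<lambda>i. psum c (Suc n) i - x i) + nrm (\<lambda>i. psum c n i - x i)" for n
  proof -
    have "cmod (c n) * nrm (e n) = nrm (\<lambda>i. psum c (Suc n) i - psum c n i)"
      using nrm_scale(2)[OF e_lp] by simp
    also have "\<dots> \<le> nrm (\<lambda>i. psum c (Suc n) i - x i) + nrm (\<lambda>i. x i - psum c n i)"
      by (rule nrm_triangle[OF psum_lp x psum_lp])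
    finally show ?thesis using e_pos[of n] nrm_diff_commute[of x "psum c n"] by simp
  qed
  have "(\<lambda>n. nrm (\<lambda>i. psum c (Suc n) i - x i) + nrm (\<lambda>i. psum c n i - x i)) \<longlonglongrightarrow> 0"
    by (intro tendsto_add_zero lim LIMSEQ_Suc)
  from null_comparison[OF le this] show ?thesis .
qed

lemma abs_conv:
  assumes "summable (\<lambda>n. cmod (c n) * nrm (e n))" shows "conv c"
proof -
  have "\<exists>x\<in>lp p. (\<lambda>m. nrm (\<lambda>i. (\<Sum>j<m. c j * e j i) - x i)) \<longlonglongrightarrow> 0"
    by (rule abs_series_converges[OF nrm_scale(1)[OF e_lp] assms]) (simp add: nrm_scale(2)[OF e_lp])
  then show ?thesis by (auto simp: conv_def sums_to_iff)
qed

end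

subsection \<open>Symmetric bases of \<open>\<ell>\<^sub>p\<close>\<close>

text \<open>The numbers \<alpha> j + 1 are never attained. The infinite complement is what
  \<open>permutation_extending\<close> requires.\<close>

lemma gap_strict_mono:
  fixes \<alpha> :: "nat \<Rightarrow> nat"
  assumes "\<And>j. \<alpha> j + 2 \<le> \<alpha> (Suc j)"
  shows "strict_mono \<alpha>" "infinite (- range \<alpha>)"
proof -
  show mono: "strict_mono \<alpha>"
    unfolding strict_mono_Suc_iff
  proof
    show "\<alpha> j < \<alpha> (Suc j)" for j using assms[of j] by simp
  qed
  have "\<alpha> i \<noteq> \<alpha> j + 1" for i j
  proof (cases "i \<le> j")
    case True
    then have "\<alpha> i \<le> \<alpha> j" using mono by (simp add: strict_mono_less_eq)
    then show ?thesis by simp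
  next
    case False
    then have "\<alpha> (Suc j) \<le> \<alpha> i" using mono by (simp add: strict_mono_less_eq)
    then show ?thesis using assms[of j] by simp
  qed
  then have "range (\<lambda>j. \<alpha> j + 1) \<subseteq> - range \<alpha>"
    by (metis (no_types, lifting) ComplI image_subset_iff rangeE)
  moreover have "infinite (range (\<lambda>j. \<alpha> j + 1))"
    using mono by (intro range_inj_infinite injI) (simp add: strict_mono_eq)
  ultimately show "infinite (- range \<alpha>)" by (rule infinite_super)
qed

lemma choose_gap:
  assumes "\<And>j N. \<exists>n\<ge>N. P j n"
  obtains \<alpha> :: "nat \<Rightarrow> nat" where "\<And>j. \<alpha> j + 2 \<le> \<alpha> (Suc j)" "\<And>j. P j (\<alpha> j)"
proof -
  have "\<exists>\<alpha>. \<forall>j. P j (\<alpha> j) \<and> \<alpha> j + 2 \<le> \<alpha> (Suc j)"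
  proof (rule dependent_nat_choice)
    show "\<exists>x. P 0 x" using assms by blast
    show "\<exists>y. P (Suc j) y \<and> x + 2 \<le> y" for x j using assms[of "x + 2" "Suc j"] by blast
  qed
  then show thesis using that by blast
qed

text \<open>Both complements are infinite sets of naturals, so their increasing enumerations match
  them with each other.\<close>

lemma permutation_extending:
  fixes \<alpha> \<beta> :: "nat \<Rightarrow> nat"
  assumes "inj \<alpha>" "inj \<beta>" "infinite (- range \<alpha>)" "infinite (- range \<beta>)"
  obtains \<pi> where "bij \<pi>" "\<And>j. \<pi> (\<alpha> j) = \<beta> j"
proof -
  let ?ea = "enumerate (- range \<alpha>)" and ?eb = "enumerate (- range \<beta>)"
  have ea: "bij_betw ?ea UNIV (- range \<alpha>)" and eb: "bij_betw ?eb UNIV (- range \<beta>)"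
    using assms bij_enumerate by auto
  define \<pi> where "\<pi> n = (if n \<in> range \<alpha> then \<beta> (inv \<alpha> n) else ?eb (inv_into UNIV ?ea n))" for n
  have "bij_betw (\<beta> \<circ> inv \<alpha>) (range \<alpha>) (range \<beta>)"
    using assms by (intro bij_betw_trans[OF bij_betw_inv_into[of \<alpha> UNIV]]) (auto simp: inj_imp_bij_betw_inv bij_betw_def)
  then have 1: "bij_betw \<pi> (range \<alpha>) (range \<beta>)"
    by (subst bij_betw_cong[where g = "\<beta> \<circ> inv \<alpha>"]) (auto simp: \<pi>_def)
  have "bij_betw (?eb \<circ> inv_into UNIV ?ea) (- range \<alpha>) (- range \<beta>)"
    by (rule bij_betw_trans[OF bij_betw_inv_into[OF ea] eb])
  then have 2: "bij_betw \<pi> (- range \<alpha>) (- range \<beta>)"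
    by (subst bij_betw_cong[where g = "?eb \<circ> inv_into UNIV ?ea"]) (auto simp: \<pi>_def)
  have "bij \<pi>" using bij_betw_combine[OF 1 2] by simp
  moreover have "\<pi> (\<alpha> j) = \<beta> j" for j using assms(1) by (simp add: \<pi>_def)
  ultimately show thesis by (rule that)
qed

definition spread :: "(nat \<Rightarrow> nat) \<Rightarrow> (nat \<Rightarrow> complex) \<Rightarrow> nat \<Rightarrow> complex" where
  "spread \<alpha> c n = (if n \<in> range \<alpha> then c (inv \<alpha> n) else 0)"

lemma spread_in: "inj \<alpha> \<Longrightarrow> spread \<alpha> c (\<alpha> j) = c j"
  by (simp add: spread_def)

lemma spread_out: "n \<notin> range \<alpha> \<Longrightarrow> spread \<alpha> c n = 0"
  by (simp add: spread_def)

lemma diagonal_convergent_subsequence: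
  fixes z :: "nat \<Rightarrow> nat \<Rightarrow> complex"
  assumes "\<And>i. bounded (range (\<lambda>k. z k i))"
  obtains r v where "strict_mono (r :: nat \<Rightarrow> nat)" "\<And>i. (\<lambda>k. z (r k) i) \<longlonglongrightarrow> v i"
proof -
  interpret subseqs "\<lambda>i s. convergent (\<lambda>k. z (s k) i)"
  proof
    fix i and s :: "nat \<Rightarrow> nat"
    have "bounded (range (\<lambda>k. z (s k) i))"
      by (rule bounded_subset[OF assms[of i]]) auto
    from bounded_imp_convergent_subsequence[OF this]
    obtain l r where "strict_mono r" "((\<lambda>k. z (s k) i) \<circ> r) \<longlonglongrightarrow> l" by blast
    then show "\<exists>r'. strict_mono r' \<and> convergent (\<lambda>k. z ((s \<circ> r') k) i)"
      by (intro exI[of _ r]) (auto simp: o_def convergent_def)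
  qed
  have "convergent (\<lambda>k. z ((diagseq \<circ> (+) (Suc i)) k) i)" for i
  proof (rule diagseq_holds)
    fix r s :: "nat \<Rightarrow> nat" and n
    assume r: "strict_mono r" and c: "convergent (\<lambda>k. z (s k) n)"
    show "convergent (\<lambda>k. z ((s \<circ> r) k) n)"
      using convergent_subseq_convergent[OF c r] by (simp add: o_def)
  qed
  then have "convergent (\<lambda>k. z (diagseq (k + Suc i)) i)" for i
    by (simp only: o_def add.commute[of _ "Suc i"])
  then have "convergent (\<lambda>k. z (diagseq k) i)" for i
    using convergent_ignore_initial_segment[of "\<lambda>k. z (diagseq k) i" "Suc i"] by blast
  then have "\<exists>l. (\<lambda>k. z (diagseq k) i) \<longlonglongrightarrow> l" for i by (simp add: convergent_def)
  then show thesis using that[OF subseq_diagseq] by metis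
qed

locale lp_symmetric_basis = lp_space +
  fixes e :: "nat \<Rightarrow> cseq"
  assumes symmetric: "symmetric_basis (lp p) (lp_norm p) e"

sublocale lp_symmetric_basis \<subseteq> lp_basis
  by unfold_locales (use symmetric in \<open>simp add: symmetric_basis_def\<close>)

section \<open>Consequences of invariance under permutations\<close>

context lp_symmetric_basis begin

text \<open>The sum of \<open>c\<close> is expanded in the permuted basis. Continuity of the
  coefficients of \<open>e\<close> identifies that expansion as c (\<pi> n), and equivalence of the
  two bases returns it to \<open>e\<close>.\<close>

lemma conv_permute:
  assumes c: "conv c" and \<pi>: "bij \<pi>"
  shows "conv (\<lambda>n. c (\<pi> n))"
proof -
  obtain x where x: "sums_to c x" using c by (auto simp: conv_def)
  have xl: "x \<in> lp p" using x by (rule sums_to_lp)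
  have eq: "equivalent_bases (lp p) nrm (\<lambda>n. e (\<pi> n)) e"
    using symmetric \<pi> by (simp add: symmetric_basis_def)
  then obtain d where d: "sums_in (lp p) nrm d (\<lambda>n. e (\<pi> n)) x"
    using xl unfolding equivalent_bases_def schauder_basis_def by blast
  define S where "S m = (\<lambda>i. \<Sum>n<m. d n * e (\<pi> n) i)" for m
  have Sl: "S m \<in> lp p" for m
    unfolding S_def by (intro sum_lp nrm_scale e_lp) auto
  have lim: "(\<lambda>m. nrm (\<lambda>i. S m i - x i)) \<longlonglongrightarrow> 0"
    using d by (simp add: sums_in_def tendsto_in_def S_def)
  have "d j = c (\<pi> j)" for j
  proof -
    have coefS: "coef (S m) (\<pi> j) = d j" if "m \<ge> Suc j" for m
    proof -
      have "coef (S m) (\<pi> j) = (\<Sum>n<m. d n * (if \<pi> j = \<pi> n then 1 else 0))"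
        unfolding S_def using coef_sum[of "{..<m}" "\<lambda>n i. d n * e (\<pi> n) i"] nrm_scale(1)[OF e_lp]
        by (simp add: coef_scale[OF e_lp] coef_e)
      also have "\<dots> = (\<Sum>n<m. if n = j then d n else 0)"
        using \<pi> by (intro sum.cong) (auto dest: bij_is_inj injD)
      also have "\<dots> = d j" using that by simp
      finally show ?thesis .
    qed
    have "(\<lambda>m. coef (S m) (\<pi> j)) \<longlonglongrightarrow> d j"
      by (rule tendsto_eventually, rule eventually_sequentiallyI[of "Suc j"]) (rule coefS)
    moreover have "(\<lambda>m. coef (S m) (\<pi> j)) \<longlonglongrightarrow> coef x (\<pi> j)"
      by (rule coef_tendsto[OF lim Sl xl])
    ultimately show ?thesis using coef_eqI[OF x] LIMSEQ_unique by metis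
  qed
  then have "(\<lambda>n. c (\<pi> n)) = d" by auto
  then show ?thesis
    using eq d unfolding equivalent_bases_def conv_def by auto
qed

lemma conv_spread:
  assumes "inj \<alpha>" "inj \<beta>" "infinite (- range \<alpha>)" "infinite (- range \<beta>)" "conv (spread \<beta> c)"
  shows "conv (spread \<alpha> c)"
proof -
  obtain \<pi> where \<pi>: "bij \<pi>" "\<And>j. \<pi> (\<alpha> j) = \<beta> j"
    using permutation_extending[OF assms(1-4)] by blast
  have "spread \<beta> c (\<pi> n) = spread \<alpha> c n" for n
  proof (cases "n \<in> range \<alpha>")
    case True
    then show ?thesis using \<pi>(2) assms by (auto simp: spread_in)
  next
    case False
    have "\<pi> n \<notin> range \<beta>"
    proof
      assume "\<pi> n \<in> range \<beta>"
      then obtain j where "\<pi> n = \<pi> (\<alpha> j)" using \<pi>(2) by auto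
      then have "n = \<alpha> j" using \<pi>(1) by (meson bij_is_inj injD)
      then show False using False by simp
    qed
    then show ?thesis using False by (simp add: spread_out)
  qed
  then show ?thesis using conv_permute[OF assms(5) \<pi>(1)] by simp
qed

text \<open>Otherwise one coefficient sequence would converge absolutely when placed along \<alpha>
  and have unbounded terms when placed along \<beta>, against \<open>conv_spread\<close>.\<close>

lemma norms_not_separated:
  assumes \<alpha>: "\<And>j. \<alpha> j + 2 \<le> \<alpha> (Suc j)" and \<beta>: "\<And>j. \<beta> j + 2 \<le> \<beta> (Suc j)"
  shows "\<exists>j. nrm (e (\<beta> j)) < 4 ^ j * nrm (e (\<alpha> j))"
proof (rule ccontr)
  assume "\<not> ?thesis"
  then have big: "4 ^ j * nrm (e (\<alpha> j)) \<le> nrm (e (\<beta> j))" for j by (simp add: not_less)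
  note A = gap_strict_mono[of \<alpha>, OF \<alpha>] and B = gap_strict_mono[of \<beta>, OF \<beta>]
  have inj: "inj \<alpha>" "inj \<beta>" using A B strict_mono_imp_inj_on by auto
  \<comment> \<open>The terms have norm 2^(-j) along \<alpha> and at least 2^j along \<beta>: the
    ratio 4^j is split evenly.\<close>
  define c where "c j = complex_of_real (1 / (2 ^ j * nrm (e (\<alpha> j))))" for j
  have cn: "cmod (c j) = 1 / (2 ^ j * nrm (e (\<alpha> j)))" for j
    using e_pos[of "\<alpha> j"] by (simp add: c_def norm_divide norm_mult norm_power)
  have "(\<lambda>j. cmod (spread \<alpha> c (\<alpha> j)) * nrm (e (\<alpha> j))) = (\<lambda>j. (1/2) ^ j)"
    using e_pos by (simp add: spread_in inj cn power_one_over less_imp_neq[THEN not_sym])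
  then have "summable (\<lambda>n. cmod (spread \<alpha> c n) * nrm (e n))"
    using summable_mono_reindex[OF A(1), of "\<lambda>n. cmod (spread \<alpha> c n) * nrm (e n)"]
    by (simp add: spread_out summable_geometric)
  then have "conv (spread \<alpha> c)" by (rule abs_conv)
  then have "conv (spread \<beta> c)" by (rule conv_spread[OF inj(2,1) B(2) A(2)])
  from LIMSEQ_subseq_LIMSEQ[OF conv_null[OF this] B(1)]
  have "(\<lambda>j. cmod (c j) * nrm (e (\<beta> j))) \<longlonglongrightarrow> 0" by (simp add: o_def spread_in inj)
  from order_tendstoD(2)[OF this, of 1]
  obtain j where "cmod (c j) * nrm (e (\<beta> j)) < 1" by (auto simp: eventually_sequentially)
  moreover have "cmod (c j) * (4 ^ j * nrm (e (\<alpha> j))) \<le> cmod (c j) * nrm (e (\<beta> j))"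
    by (intro mult_left_mono big) simp
  moreover have "cmod (c j) * (4 ^ j * nrm (e (\<alpha> j))) = 2 ^ j"
    using e_pos[of "\<alpha> j"] by (simp add: cn field_simps flip: power_mult_distrib)
  moreover have "(1::real) \<le> 2 ^ j" by simp
  ultimately show False by linarith
qed

text \<open>The even indices serve as reference subsequence: unbounded norms would allow a \<beta>
  whose norms outgrow those of e (2 j) by 4^j. In \<open>e_norm_lower\<close> the roles are
  exchanged.\<close>

lemma e_norm_upper: "\<exists>M. \<forall>n. nrm (e n) \<le> M"
proof (rule ccontr)
  assume neg: "\<not> ?thesis"
  have "\<exists>n\<ge>N. 4 ^ j * nrm (e (2 * j)) \<le> nrm (e n)" for j N
  proof (rule ccontr)
    assume H: "\<not> ?thesis"
    have "nrm (e n) \<le> max (4 ^ j * nrm (e (2 * j))) (\<Sum>i<N. nrm (e i))" for n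
    proof (cases "n < N")
      case True
      then have "nrm (e n) \<le> (\<Sum>i<N. nrm (e i))" using nrm_nonneg by (intro member_le_sum) auto
      then show ?thesis by simp
    next
      case False
      then show ?thesis using H by (meson linorder_le_cases max.coboundedI1 not_less)
    qed
    then show False using neg by blast
  qed
  then obtain \<beta> where \<beta>: "\<And>j. \<beta> j + 2 \<le> \<beta> (Suc j)" "\<And>j. 4 ^ j * nrm (e (2 * j)) \<le> nrm (e (\<beta> j))"
    using choose_gap[of "\<lambda>j n. 4 ^ j * nrm (e (2 * j)) \<le> nrm (e n)"] by blast
  show False
    using norms_not_separated[of "\<lambda>j. 2 * j" \<beta>] \<beta> by (auto simp: not_less[symmetric])
qed

lemma e_norm_lower: "\<exists>\<delta>>0. \<forall>n. \<delta> \<le> nrm (e n)"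
proof (rule ccontr)
  assume neg: "\<not> ?thesis"
  have "\<exists>n\<ge>N. 4 ^ j * nrm (e n) \<le> nrm (e (2 * j))" for j N
  proof (rule ccontr)
    assume H: "\<not> ?thesis"
    define \<delta> where "\<delta> = Min (insert (nrm (e (2 * j)) / 4 ^ j) ((\<lambda>i. nrm (e i)) ` {..<N}))"
    have "\<delta> > 0" unfolding \<delta>_def using e_pos by (subst Min_gr_iff) auto
    moreover have "\<delta> \<le> nrm (e n)" for n
    proof (cases "n < N")
      case True
      then show ?thesis unfolding \<delta>_def by (intro Min_le) auto
    next
      case False
      have "\<delta> \<le> nrm (e (2 * j)) / 4 ^ j" unfolding \<delta>_def by (intro Min_le) auto
      also have "\<dots> \<le> nrm (e n)"
      proof -
        have "nrm (e (2 * j)) \<le> 4 ^ j * nrm (e n)" using H False by (meson linorder_le_cases not_less)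
        then show ?thesis by (simp add: field_simps)
      qed
      finally show ?thesis .
    qed
    ultimately show False using neg by blast
  qed
  then obtain \<alpha> where \<alpha>: "\<And>j. \<alpha> j + 2 \<le> \<alpha> (Suc j)" "\<And>j. 4 ^ j * nrm (e (\<alpha> j)) \<le> nrm (e (2 * j))"
    using choose_gap[of "\<lambda>j n. 4 ^ j * nrm (e n) \<le> nrm (e (2 * j))"] by blast
  show False
    using norms_not_separated[of \<alpha> "\<lambda>j. 2 * j"] \<alpha> by (auto simp: not_less[symmetric])
qed

text \<open>A coordinatewise limit \<open>v\<close> of a subsequence of the basis has vanishing coefficients: along a
  gliding hump subsequence, sums of \<open>J\<close> vectors \<open>e (r k) - v\<close> have norm of order \<open>J powr (1/p)\<close>,
  while their coefficient at \<open>m\<close> is eventually \<open>- J * coef v m\<close>.\<close>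

lemma basis_null_subsequence:
  obtains r where "strict_mono (r :: nat \<Rightarrow> nat)" "\<And>i. (\<lambda>k. e (r k) i) \<longlonglongrightarrow> 0"
proof -
  obtain M where M: "\<And>n. nrm (e n) \<le> M" using e_norm_upper by blast
  have "bounded (range (\<lambda>k. e k i))" for i
    by (rule boundedI[of _ M]) (use coord_le_nrm[OF e_lp] M order_trans in blast)
  then obtain r v where r: "strict_mono r" and v: "\<And>i. (\<lambda>k. e (r k) i) \<longlonglongrightarrow> v i"
    using diagonal_convergent_subsequence[of e] by blast
  have vl: "v \<in> lp p" "nrm v \<le> M"
    using fatou[of "\<lambda>k. e (r k)" v sequentially M, OF v] e_lp M by auto
  obtain B where B: "\<And>x n. x \<in> lp p \<Longrightarrow> cmod (coef x n) * nrm (e n) \<le> B * nrm x" and Bpos: "B > 0"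
    using coef_bounded by blast
  have "coef v m = 0" for m
  proof (rule ccontr)
    assume nz: "coef v m \<noteq> 0"
    \<comment> \<open>The offset gives r (k + Suc m) > m, so the basis vector contributes nothing to
      coefficient \<open>m\<close>, for every \<open>k\<close> and not only eventually.\<close>
    define z where "z k = (\<lambda>i. e (r (k + Suc m)) i - v i)" for k
    have zl: "z k \<in> lp p" for k unfolding z_def by (intro nrm_diff e_lp vl)
    have zM: "nrm (z k) \<le> 2 * M" for k
      unfolding z_def using nrm_diff(2)[OF e_lp vl(1), of "r (k + Suc m)"] M[of "r (k + Suc m)"] vl(2) by simp
    have z0: "(\<lambda>k. z k i) \<longlonglongrightarrow> 0" for i
      unfolding z_def using LIMSEQ_ignore_initial_segment[OF v[of i], of "Suc m"] by (simp add: LIM_zero)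
    obtain \<kappa> where \<kappa>: "\<And>c J. nrm (\<lambda>i. \<Sum>j<J. c j * z (\<kappa> j) i) \<le> (2 * M + 1) * head_norm c J"
      using gliding_hump[OF zl zM z0, of 1] by (metis zero_less_one)
    have coefz: "coef (z k) m = - coef v m" for k
    proof -
      have "m < r (k + Suc m)" using seq_suble[OF r, of "k + Suc m"] by simp
      then show ?thesis unfolding z_def by (simp add: coef_diff[OF e_lp vl(1)] coef_e)
    qed
    define a where "a = cmod (coef v m) * nrm (e m)"
    have a: "a > 0" using nz e_pos by (simp add: a_def)
    define C where "C = B * (2 * M + 1)"
    have C0: "0 \<le> C" using Bpos M[of 0] e_pos[of 0] by (simp add: C_def)
    have bound: "real J * a \<le> C * real J powr (1 / p)" for J
    proof -
      have sl: "(\<lambda>i. \<Sum>j<J. z (\<kappa> j) i) \<in> lp p" using zl by (intro sum_lp) auto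
      have "coef (\<lambda>i. \<Sum>j<J. z (\<kappa> j) i) m = - (of_nat J * coef v m)"
        using coef_sum[of "{..<J}" "\<lambda>j. z (\<kappa> j)"] zl by (simp add: coefz)
      then have "real J * a \<le> B * nrm (\<lambda>i. \<Sum>j<J. z (\<kappa> j) i)"
        using B[OF sl, of m] by (simp add: a_def norm_mult mult.assoc)
      also have "\<dots> \<le> B * ((2 * M + 1) * head_norm (\<lambda>_. 1) J)"
        using \<kappa>[of "\<lambda>_. 1" J] Bpos by (intro mult_left_mono) auto
      finally show ?thesis by (simp add: C_def head_norm_def mult.assoc)
    qed
    \<comment> \<open>The conjugate exponent turns J^(1 - 1/p) \<le> C/a into a bound on
      \<open>J\<close> itself; it is here that \<open>p > 1\<close> rules out a nonzero
      coefficient.\<close>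
    define q where "q = p / (p - 1)"
    have q: "q > 0" "(1 - 1 / p) * q = 1" using p1 by (auto simp: q_def field_simps)
    obtain J where J: "(C / a) powr q + 1 < real J" using reals_Archimedean2 by blast
    have Jpos: "real J > 0" using J powr_ge_zero[of "C / a" q] by linarith
    have "real J powr (1 - 1 / p) = real J / real J powr (1 / p)"
      using Jpos by (simp add: powr_diff)
    also have "\<dots> \<le> C / a"
      using bound[of J] a Jpos by (simp add: field_simps)
    finally have "(real J powr (1 - 1 / p)) powr q \<le> (C / a) powr q"
      using q by (intro powr_mono2) auto
    then have "real J \<le> (C / a) powr q"
      using Jpos q(2) by (simp add: powr_powr)
    then show False using J by simp
  qed
  then have "coef v = (\<lambda>n. 0)" by auto
  then have "sums_to (\<lambda>n. 0) v" using coef_sums[OF vl(1)] by simp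
  moreover have "sums_to (\<lambda>n. 0) (\<lambda>i. 0)" by (rule sums_to_eventually[of _ 0]) (auto simp: zero_lp)
  ultimately have "v = (\<lambda>i. 0)" by (rule sums_to_unique)
  then show thesis using that[OF r] v by simp
qed

text \<open>The gliding hump is applied to the coordinatewise null subsequence, with both norm
  bounds of the basis. The gaps of \<kappa> survive composition with the strictly increasing
  \<open>r\<close>.\<close>

lemma basis_subsequence_lp:
  "\<exists>\<alpha> K \<delta>. (\<forall>j. \<alpha> j + 2 \<le> \<alpha> (Suc j)) \<and> K > 0 \<and> \<delta> > 0 \<and>
     (\<forall>c J. nrm (\<lambda>i. \<Sum>j<J. c j * e (\<alpha> j) i) \<le> K * head_norm c J) \<and>
     (\<forall>c J. \<delta> * head_norm c J \<le> nrm (\<lambda>i. \<Sum>j<J. c j * e (\<alpha> j) i))"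
proof -
  obtain r where r: "strict_mono (r :: nat \<Rightarrow> nat)" and null: "\<And>i. (\<lambda>k. e (r k) i) \<longlonglongrightarrow> 0"
    using basis_null_subsequence by blast
  obtain M where M: "\<And>n. nrm (e n) \<le> M" using e_norm_upper by blast
  obtain \<delta> where \<delta>: "\<delta> > 0" "\<And>n. \<delta> \<le> nrm (e n)" using e_norm_lower by blast
  have M0: "0 \<le> M" using M[of 0] nrm_nonneg[of "e 0"] by linarith
  show ?thesis
  proof (rule gliding_hump[of "\<lambda>k. e (r k)" M \<delta>])
    fix \<kappa> :: "nat \<Rightarrow> nat"
    assume k: "\<And>j. \<kappa> j + 2 \<le> \<kappa> (Suc j)"
      and up: "\<And>c J. nrm (\<lambda>i. \<Sum>j<J. c j * e (r (\<kappa> j)) i) \<le> (M + \<delta>) * head_norm c J"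
      and low: "\<And>c J. (\<And>k. \<delta> \<le> nrm (e (r k))) \<Longrightarrow> \<delta> / 4 * head_norm c J \<le> nrm (\<lambda>i. \<Sum>j<J. c j * e (r (\<kappa> j)) i)"
    have gap: "r (\<kappa> j) + 2 \<le> r (\<kappa> (Suc j))" for j
    proof -
      have "r (\<kappa> j) < r (Suc (\<kappa> j))" "r (Suc (\<kappa> j)) < r (Suc (Suc (\<kappa> j)))"
        "r (Suc (Suc (\<kappa> j))) \<le> r (\<kappa> (Suc j))"
        using r k[of j] by (simp_all add: strict_mono_less strict_mono_less_eq)
      then show ?thesis by simp
    qed
    have "\<And>c J. \<delta> / 4 * head_norm c J \<le> nrm (\<lambda>i. \<Sum>j<J. c j * e (r (\<kappa> j)) i)"
      by (rule low) (rule \<delta>)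
    then show ?thesis
      using gap up \<delta>(1) M0
      by (intro exI[of _ "\<lambda>j. r (\<kappa> j)"] exI[of _ "M + \<delta>"] exI[of _ "\<delta> / 4"]) auto
  qed (use e_lp M null \<delta> in auto)
qed

text \<open>The upper p-estimate makes the series along \<alpha> Cauchy. A general \<open>c\<close>
  may have no zeros and then cannot be moved onto \<alpha>; its even and odd parts live on
  co-infinite sets and can be moved separately.\<close>

lemma conv_lp:
  assumes c: "c \<in> lp p" shows "conv c"
proof -
  obtain \<alpha> K where \<alpha>: "\<And>j. \<alpha> j + 2 \<le> \<alpha> (Suc j)" and K: "K > 0"
    and up: "\<And>c J. nrm (\<lambda>i. \<Sum>j<J. c j * e (\<alpha> j) i) \<le> K * head_norm c J"
    using basis_subsequence_lp by blast
  note A = gap_strict_mono[of \<alpha>, OF \<alpha>]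
  have inj: "inj \<alpha>" using A(1) by (rule strict_mono_imp_inj_on)
  have spr: "conv (spread \<alpha> c)" if c: "c \<in> lp p" for c
  proof -
    define t where "t m = (\<lambda>i. if m \<le> i then c i else 0)" for m
    have tl: "t m \<in> lp p" for m unfolding t_def by (rule restrict_lp[OF c])
    have hn: "head_norm (t m) n \<le> nrm (t m)" for m n
      using powr_p_le_cancel[of "head_norm (t m) n"] sum_le_nrm[OF tl, of "{..<n}" m]
      by (simp add: head_norm_powr nrm_nonneg head_norm_nonneg)
    have blk: "nrm (\<lambda>i. \<Sum>j\<in>{m..<n}. c j * e (\<alpha> j) i) \<le> K * nrm (t m)" for m n
    proof -
      have "(\<Sum>j\<in>{m..<n}. c j * e (\<alpha> j) i) = (\<Sum>j<n. t m j * e (\<alpha> j) i)" for i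
        by (rule sum.mono_neutral_cong_left) (auto simp: t_def)
      then have "nrm (\<lambda>i. \<Sum>j\<in>{m..<n}. c j * e (\<alpha> j) i) \<le> K * head_norm (t m) n"
        using up[of "t m" n] by simp
      also have "\<dots> \<le> K * nrm (t m)" using hn K by simp
      finally show ?thesis .
    qed
    have "(\<lambda>m. K * nrm (t m)) \<longlonglongrightarrow> 0"
      unfolding t_def by (intro tendsto_mult_right_zero tail_tendsto c)
    from series_converges[OF nrm_scale(1)[OF e_lp] this blk]
    obtain x where x: "x \<in> lp p" "(\<lambda>m. nrm (\<lambda>i. (\<Sum>j<m. c j * e (\<alpha> j) i) - x i)) \<longlonglongrightarrow> 0"
      by blast
    have Sl: "(\<lambda>i. \<Sum>j<m. c j * e (\<alpha> j) i) \<in> lp p" for m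
      by (intro sum_lp nrm_scale e_lp) auto
    \<comment> \<open>Instead of reindexing partial sums, the coefficients of the limit are
      computed; its basis expansion is then the required series.\<close>
    have "coef x n = spread \<alpha> c n" for n
    proof -
      have "coef (\<lambda>i. \<Sum>j<m. c j * e (\<alpha> j) i) n = spread \<alpha> c n" if "n < m" for m
      proof -
        have "coef (\<lambda>i. \<Sum>j<m. c j * e (\<alpha> j) i) n = (\<Sum>j<m. c j * (if n = \<alpha> j then 1 else 0))"
          using coef_sum[of "{..<m}" "\<lambda>j i. c j * e (\<alpha> j) i"] nrm_scale(1)[OF e_lp]
          by (simp add: coef_scale[OF e_lp] coef_e)
        also have "\<dots> = spread \<alpha> c n"
        proof (cases "n \<in> range \<alpha>")
          case True
          then obtain l where l: "n = \<alpha> l" by auto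
          have "l < m" using seq_suble[OF A(1), of l] l that by simp
          have "(\<Sum>j<m. c j * (if n = \<alpha> j then 1 else 0)) = (\<Sum>j<m. if l = j then c j else 0)"
            using inj by (intro sum.cong) (auto simp: l dest: injD)
          then show ?thesis using \<open>l < m\<close> l by (simp add: spread_in inj)
        next
          case False
          then show ?thesis by (auto simp: spread_out intro!: sum.neutral)
        qed
        finally show ?thesis .
      qed
      then have "(\<lambda>m. coef (\<lambda>i. \<Sum>j<m. c j * e (\<alpha> j) i) n) \<longlonglongrightarrow> spread \<alpha> c n"
        by (intro tendsto_eventually eventually_sequentiallyI[of "Suc n"]) simp
      then show ?thesis
        using coef_tendsto[OF x(2) Sl x(1), of n] LIMSEQ_unique by blast
    qed
    then have "coef x = spread \<alpha> c" by auto
    then show ?thesis using coef_sums[OF x(1)] by (auto simp: conv_def)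
  qed
  have gen: "conv (spread \<beta> (\<lambda>j. c (\<beta> j)))" if \<beta>: "\<And>j. \<beta> j + 2 \<le> \<beta> (Suc j)" for \<beta>
  proof -
    note B = gap_strict_mono[of \<beta>, OF \<beta>]
    have injB: "inj \<beta>" using B(1) by (rule strict_mono_imp_inj_on)
    have "(\<lambda>j. c (\<beta> j)) \<in> lp p"
      using summable_reindex[of "\<lambda>n. cmod (c n) powr p" \<beta>] c injB by (simp add: lp_def o_def)
    then show ?thesis by (intro conv_spread[OF injB inj B(2) A(2)] spr)
  qed
  have "c = (\<lambda>n. spread (\<lambda>j. 2 * j) (\<lambda>j. c (2 * j)) n + spread (\<lambda>j. 2 * j + 1) (\<lambda>j. c (2 * j + 1)) n)"
  proof
    fix n
    have inj: "inj (\<lambda>j::nat. 2 * j)" "inj (\<lambda>j::nat. 2 * j + 1)" by (auto intro: injI)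
    show "c n = spread (\<lambda>j. 2 * j) (\<lambda>j. c (2 * j)) n + spread (\<lambda>j. 2 * j + 1) (\<lambda>j. c (2 * j + 1)) n"
    proof (cases "even n")
      case True
      then obtain j where "n = 2 * j" by blast
      moreover have "n \<notin> range (\<lambda>j. 2 * j + 1)" using True by auto
      ultimately show ?thesis using spread_in[OF inj(1), of "\<lambda>j. c (2 * j)" j] by (simp add: spread_out)
    next
      case False
      then obtain j where "n = 2 * j + 1" using oddE by blast
      moreover have "n \<notin> range (\<lambda>j. 2 * j)" using False by auto
      ultimately show ?thesis using spread_in[OF inj(2), of "\<lambda>j. c (2 * j + 1)" j] by (simp add: spread_out)
    qed
  qed
  moreover have "conv (\<lambda>n. spread (\<lambda>j. 2 * j) (\<lambda>j. c (2 * j)) n + spread (\<lambda>j. 2 * j + 1) (\<lambda>j. c (2 * j + 1)) n)"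
    using gen[of "\<lambda>j. 2 * j"] gen[of "\<lambda>j. 2 * j + 1"] by (intro conv_add) auto
  ultimately show ?thesis by simp
qed

text \<open>Removing a sparse set on which \<open>c\<close> is summable leaves a sequence with infinitely many zeros,
  which a permutation moves onto the subsequence with a lower \<open>p\<close>-estimate.\<close>

lemma lp_conv:
  assumes c: "conv c" shows "c \<in> lp p"
proof -
  obtain \<alpha> \<delta> where \<alpha>: "\<And>j. \<alpha> j + 2 \<le> \<alpha> (Suc j)" and \<delta>: "\<delta> > 0"
    and low: "\<And>c J. \<delta> * head_norm c J \<le> nrm (\<lambda>i. \<Sum>j<J. c j * e (\<alpha> j) i)"
    using basis_subsequence_lp by blast
  note A = gap_strict_mono[of \<alpha>, OF \<alpha>]
  have injA: "inj \<alpha>" using A(1) by (rule strict_mono_imp_inj_on)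
  obtain \<delta>' where \<delta>': "\<delta>' > 0" "\<And>n. \<delta>' \<le> nrm (e n)" using e_norm_lower by blast
  \<comment> \<open>The terms c n * e n tend to 0 and the norms of the \<open>e n\<close> are
    bounded below, so \<open>c\<close> tends to 0.\<close>
  have "\<exists>n\<ge>N. cmod (c n) \<le> (1/2) ^ j" for j N
  proof -
    have "\<delta>' * (1/2) ^ j > 0" using \<delta>' by simp
    from order_tendstoD(2)[OF conv_null[OF c] this]
    obtain N' where "\<forall>n\<ge>N'. cmod (c n) * nrm (e n) < \<delta>' * (1/2) ^ j"
      by (auto simp: eventually_sequentially)
    then have lt: "cmod (c (max N N')) * nrm (e (max N N')) < \<delta>' * (1/2) ^ j" by simp
    have "\<delta>' * cmod (c (max N N')) \<le> cmod (c (max N N')) * nrm (e (max N N'))"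
      using mult_left_mono[OF \<delta>'(2)[of "max N N'"], of "cmod (c (max N N'))"] by (simp add: mult.commute)
    then have "\<delta>' * cmod (c (max N N')) < \<delta>' * (1/2) ^ j" using lt by linarith
    then have "cmod (c (max N N')) \<le> (1/2) ^ j" using \<delta>'(1) by simp
    then show ?thesis by (intro exI[of _ "max N N'"]) simp
  qed
  then obtain \<beta> where \<beta>: "\<And>j. \<beta> j + 2 \<le> \<beta> (Suc j)" and small: "\<And>j. cmod (c (\<beta> j)) \<le> (1/2) ^ j"
    using choose_gap[of "\<lambda>j n. cmod (c n) \<le> (1/2) ^ j"] by blast
  note B = gap_strict_mono[of \<beta>, OF \<beta>]
  have injB: "inj \<beta>" using B(1) by (rule strict_mono_imp_inj_on)
  define s where "s = spread \<beta> (\<lambda>j. c (\<beta> j))"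
  have sl: "s \<in> lp p"
  proof -
    have le: "cmod (c (\<beta> j)) powr p \<le> (1/2) ^ j" for j
    proof -
      have "cmod (c (\<beta> j)) powr p \<le> ((1/2) ^ j) powr p"
        using small p0 by (intro powr_mono2) auto
      also have "\<dots> \<le> ((1/2) ^ j) powr 1"
        using p1 by (intro powr_mono') (auto simp: power_le_one)
      finally show ?thesis by simp
    qed
    have "summable (\<lambda>j. cmod (c (\<beta> j)) powr p)"
      by (rule summable_comparison_test'[of "\<lambda>j. (1/2) ^ j" 0]) (use le in \<open>auto simp: summable_geometric\<close>)
    then have "summable (\<lambda>n. cmod (s n) powr p)"
      using summable_mono_reindex[OF B(1), of "\<lambda>n. cmod (s n) powr p"] p0
      by (simp add: s_def spread_in[OF injB] spread_out)
    then show ?thesis by (simp add: lp_def)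
  qed
  define c' where "c' = (\<lambda>n. c n - s n)"
  have c': "conv c'" unfolding c'_def by (rule conv_diff[OF c conv_lp[OF sl]])
  have c'0: "c' n = 0" if "n \<in> range \<beta>" for n
    using that by (auto simp: c'_def s_def spread_in[OF injB])
  \<comment> \<open>All of \<open>c'\<close> sits on the range of \<gamma>, whose complement, the
    range of \<beta>, is infinite; hence \<alpha> j can be sent to \<gamma> j.\<close>
  define \<gamma> where "\<gamma> = enumerate (- range \<beta>)"
  have \<gamma>: "bij_betw \<gamma> UNIV (- range \<beta>)" unfolding \<gamma>_def by (rule bij_enumerate[OF B(2)])
  have injG: "inj \<gamma>" and rG: "range \<gamma> = - range \<beta>" using \<gamma> by (auto simp: bij_betw_def)
  have infG: "infinite (- range \<gamma>)" unfolding rG using range_inj_infinite[OF injB] by simp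
  obtain \<pi> where \<pi>: "bij \<pi>" "\<And>j. \<pi> (\<alpha> j) = \<gamma> j"
    using permutation_extending[OF injA injG A(2) infG] by blast
  have out: "c' (\<pi> n) = 0" if "n \<notin> range \<alpha>" for n
  proof (rule c'0, rule ccontr)
    assume "\<pi> n \<notin> range \<beta>"
    then have "\<pi> n \<in> range \<gamma>" using rG by blast
    then obtain j where "\<pi> n = \<pi> (\<alpha> j)" using \<pi>(2) by auto
    then have "n = \<alpha> j" using \<pi>(1) by (meson bij_is_inj injD)
    then show False using that by simp
  qed
  have "conv (\<lambda>n. c' (\<pi> n))" by (rule conv_permute[OF c' \<pi>(1)])
  then obtain x where x: "x \<in> lp p" "(\<lambda>m. nrm (\<lambda>i. psum (\<lambda>n. c' (\<pi> n)) m i - x i)) \<longlonglongrightarrow> 0"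
    by (auto simp: conv_def sums_to_iff)
  from BseqE[OF convergent_imp_Bseq[OF convergentI[OF x(2)]]]
  obtain R where R: "\<forall>m. norm (nrm (\<lambda>i. psum (\<lambda>n. c' (\<pi> n)) m i - x i)) \<le> R" .
  have psum_le: "nrm (psum (\<lambda>n. c' (\<pi> n)) m) \<le> R + nrm x" for m
    using nrm_triangle2[OF psum_lp x(1), of "\<lambda>n. c' (\<pi> n)" m] spec[OF R, of m] by simp
  have bd: "head_norm (\<lambda>j. c' (\<gamma> j)) J \<le> (R + nrm x) / \<delta>" for J
  proof -
    \<comment> \<open>Stopping strictly before the index \<alpha> J catches exactly \<alpha> 0, ...,
      \<alpha> (J-1).\<close>
    have "psum (\<lambda>n. c' (\<pi> n)) (\<alpha> J) i = (\<Sum>j<J. c' (\<gamma> j) * e (\<alpha> j) i)" for i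
    proof -
      have "psum (\<lambda>n. c' (\<pi> n)) (\<alpha> J) i = (\<Sum>n\<in>\<alpha> ` {..<J}. c' (\<pi> n) * e n i)"
      proof (rule sum.mono_neutral_right)
        show "\<alpha> ` {..<J} \<subseteq> {..<\<alpha> J}" using A(1) by (auto simp: strict_mono_less)
        show "\<forall>n\<in>{..<\<alpha> J} - \<alpha> ` {..<J}. c' (\<pi> n) * e n i = 0"
        proof
          fix n assume n: "n \<in> {..<\<alpha> J} - \<alpha> ` {..<J}"
          have "n \<notin> range \<alpha>"
          proof
            assume "n \<in> range \<alpha>"
            then obtain j where "n = \<alpha> j" by auto
            then show False using n A(1) by (auto simp: strict_mono_less)
          qed
          then show "c' (\<pi> n) * e n i = 0" using out by simp
        qed
      qed simp
      also have "\<dots> = (\<Sum>j<J. c' (\<gamma> j) * e (\<alpha> j) i)"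
        using injA by (subst sum.reindex) (auto simp: \<pi>(2) inj_on_def)
      finally show ?thesis .
    qed
    then have "\<delta> * head_norm (\<lambda>j. c' (\<gamma> j)) J \<le> R + nrm x"
      using low[of "\<lambda>j. c' (\<gamma> j)" J] psum_le[of "\<alpha> J"] by simp
    then show ?thesis using \<delta> by (simp add: field_simps)
  qed
  have "(\<lambda>j. c' (\<gamma> j)) \<in> lp p"
  proof (rule nrm_leI)
    show "(\<Sum>j<J. cmod (c' (\<gamma> j)) powr p) \<le> ((R + nrm x) / \<delta>) powr p" for J
      using powr_mono2[OF p0(3) head_norm_nonneg bd, of J] by (simp add: head_norm_powr)
    show "0 \<le> (R + nrm x) / \<delta>" using bd[of 0] head_norm_nonneg order_trans by blast
  qed
  then have "summable (\<lambda>n. cmod (c' n) powr p)"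
    using summable_mono_reindex[of \<gamma> "\<lambda>n. cmod (c' n) powr p"] c'0 rG p0 strict_mono_enumerate[OF B(2)]
    by (auto simp: lp_def \<gamma>_def)
  then have "c' \<in> lp p" by (simp add: lp_def)
  from nrm_add(1)[OF this sl] show ?thesis by (simp add: c'_def)
qed

lemma series_in_eqI: "sums_to c x \<Longrightarrow> series_in (lp p) nrm c e = x"
  unfolding series_in_def using sums_to_unique by blast

lemma series_in_sums: "c \<in> lp p \<Longrightarrow> sums_to c (series_in (lp p) nrm c e)"
  using conv_lp series_in_eqI by (auto simp: conv_def)

text \<open>By \<open>conv_lp\<close> and \<open>lp_conv\<close>, synthesis (coefficients to sum)
  and analysis (sum to coefficients) are mutually inverse and defined on all of \<open>lp p\<close>.
  Zabreiko's lemma bounds each of them.\<close>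

theorem equivalent_to_canonical:
  "\<exists>m>0. \<exists>M>0. \<forall>c\<in>lp p. m * nrm c \<le> nrm (series_in (lp p) nrm c e) \<and>
     nrm (series_in (lp p) nrm c e) \<le> M * nrm c"
proof -
  let ?T = "\<lambda>c. series_in (lp p) nrm c e"
  have "\<exists>M>0. \<forall>c\<in>lp p. nrm (?T c) \<le> M * nrm c"
  proof (rule zabreiko)
    fix a c assume c: "c \<in> lp p"
    show "nrm (?T (\<lambda>i. a * c i)) = cmod a * nrm (?T c)"
      using series_in_eqI[OF sums_to_scale[OF series_in_sums[OF c]]]
        nrm_scale(2)[OF sums_to_lp[OF series_in_sums[OF c]]] by simp
  next
    fix X c assume X: "\<And>j. X j \<in> lp p" and c: "c \<in> lp p"
      and lim: "(\<lambda>J. nrm (\<lambda>i. (\<Sum>j<J. X j i) - c i)) \<longlonglongrightarrow> 0" and s: "summable (\<lambda>j. nrm (?T (X j)))"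
    have TX: "sums_to (X j) (?T (X j))" "?T (X j) \<in> lp p" for j
      using series_in_sums[OF X] sums_to_lp by blast+
    obtain y where y: "y \<in> lp p" "(\<lambda>J. nrm (\<lambda>i. (\<Sum>j<J. ?T (X j) i) - y i)) \<longlonglongrightarrow> 0"
      using abs_series_converges[OF TX(2) s order_refl] by blast
    have Sl: "(\<lambda>i. \<Sum>j<J. ?T (X j) i) \<in> lp p" for J using TX(2) by (intro sum_lp) auto
    have Xl: "(\<lambda>i. \<Sum>j<J. X j i) \<in> lp p" for J using X by (intro sum_lp) auto
    \<comment> \<open>The sum \<open>y\<close> of the images must be the image of \<open>c\<close>.
      Its coefficients are computed twice, by continuity of \<open>coef\<close> and by
      coordinatewise convergence of the sums of \<open>X\<close>.\<close>
    have "coef y n = c n" for n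
    proof (rule LIMSEQ_unique)
      show "(\<lambda>J. coef (\<lambda>i. \<Sum>j<J. ?T (X j) i) n) \<longlonglongrightarrow> coef y n"
        by (rule coef_tendsto[OF y(2) Sl y(1)])
      have "coef (\<lambda>i. \<Sum>j<J. ?T (X j) i) n = (\<Sum>j<J. X j n)" for J
        using coef_sum[of "{..<J}" "\<lambda>j. ?T (X j)"] TX(2) coef_eqI[OF TX(1)] by simp
      then show "(\<lambda>J. coef (\<lambda>i. \<Sum>j<J. ?T (X j) i) n) \<longlonglongrightarrow> c n"
        using coord_tendsto[OF lim always_eventually c] Xl by simp
    qed
    then have "coef y = c" by auto
    then have Tc: "?T c = y" using series_in_eqI[OF coef_sums[OF y(1)]] by simp
    have "nrm (\<lambda>i. \<Sum>j<J. ?T (X j) i) \<le> (\<Sum>j. nrm (?T (X j)))" for J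
    proof -
      have "nrm (\<lambda>i. \<Sum>j<J. ?T (X j) i) \<le> (\<Sum>j<J. nrm (?T (X j)))"
        using nrm_sum[of "{..<J}" "\<lambda>j. ?T (X j)"] TX(2) by simp
      also have "\<dots> \<le> (\<Sum>j. nrm (?T (X j)))" using s nrm_nonneg by (intro sum_le_suminf) auto
      finally show ?thesis .
    qed
    then show "nrm (?T c) \<le> (\<Sum>j. nrm (?T (X j)))"
      unfolding Tc using Sl by (intro nrm_limit[OF y(2) _ _ _ y(1)]) simp_all
  qed (rule nrm_nonneg)
  moreover have "\<exists>C>0. \<forall>x\<in>lp p. nrm (coef x) \<le> C * nrm x"
  proof (rule zabreiko)
    have cl: "coef x \<in> lp p" if "x \<in> lp p" for x
      using coef_sums[OF that] by (intro lp_conv) (auto simp: conv_def)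
    show "nrm (coef (\<lambda>i. a * x i)) = cmod a * nrm (coef x)" if "x \<in> lp p" for a x
      using nrm_scale(2)[OF cl[OF that]] by (simp add: coef_scale[OF that])
    fix X x assume X: "\<And>j. X j \<in> lp p" and x: "x \<in> lp p"
      and lim: "(\<lambda>J. nrm (\<lambda>i. (\<Sum>j<J. X j i) - x i)) \<longlonglongrightarrow> 0" and s: "summable (\<lambda>j. nrm (coef (X j)))"
    have Xl: "(\<lambda>i. \<Sum>j<J. X j i) \<in> lp p" for J using X by (intro sum_lp) auto
    have "nrm (coef (\<lambda>i. \<Sum>j<J. X j i)) \<le> (\<Sum>j. nrm (coef (X j)))" for J
    proof -
      have "nrm (coef (\<lambda>i. \<Sum>j<J. X j i)) \<le> (\<Sum>j<J. nrm (coef (X j)))"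
        using nrm_sum[of "{..<J}" "\<lambda>j. coef (X j)"] cl[OF X] coef_sum[of "{..<J}" X] X by simp
      also have "\<dots> \<le> (\<Sum>j. nrm (coef (X j)))" using s nrm_nonneg by (intro sum_le_suminf) auto
      finally show ?thesis .
    qed
    then show "nrm (coef x) \<le> (\<Sum>j. nrm (coef (X j)))"
      using cl[OF Xl] by (intro fatou(2)[OF coef_tendsto[OF lim Xl x]]) simp_all
  qed (rule nrm_nonneg)
  ultimately obtain M C where M: "M > 0" "\<And>c. c \<in> lp p \<Longrightarrow> nrm (?T c) \<le> M * nrm c"
    and C: "C > 0" "\<And>x. x \<in> lp p \<Longrightarrow> nrm (coef x) \<le> C * nrm x" by blast
  have "(1 / C) * nrm c \<le> nrm (?T c)" if "c \<in> lp p" for c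
    using C(2)[OF sums_to_lp[OF series_in_sums[OF that]]] coef_eqI[OF series_in_sums[OF that]] C(1)
    by (simp add: field_simps)
  then show ?thesis using M C(1) by (intro exI[of _ "1 / C"] conjI exI[of _ M]) auto
qed

end

subsection \<open>Differences and multipliers\<close>

text \<open>The right shift with zero fill, matching the convention in \<open>bdiff\<close>; thus
  \<open>bdiff k\<close> is the k-th power of the identity minus \<open>shift 1\<close>.\<close>

definition shift :: "nat \<Rightarrow> (nat \<Rightarrow> 'a::zero) \<Rightarrow> nat \<Rightarrow> 'a" where
  "shift i u n = (if i \<le> n then u (n - i) else 0)"

lemma shift_0 [simp]: "shift 0 u = u"
  by (simp add: shift_def fun_eq_iff)

lemma shift_shift: "shift i (shift j u) n = shift (i + j) u n"
  by (auto simp: shift_def add.commute)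

lemma bdiff_shift_sum: "bdiff k u n = (\<Sum>j\<le>k. (-1) ^ j * of_nat (k choose j) * shift j u n)"
  by (simp add: bdiff_def shift_def)

lemma pascal_sum:
  fixes F :: "nat \<Rightarrow> 'a::comm_ring_1"
  shows "(\<Sum>j\<le>Suc k. of_nat (Suc k choose j) * F j) =
    (\<Sum>j\<le>k. of_nat (k choose j) * F j) + (\<Sum>j\<le>k. of_nat (k choose j) * F (Suc j))"
proof -
  have "(\<Sum>j\<le>Suc k. of_nat (Suc k choose j) * F j) =
      F 0 + (\<Sum>j\<le>k. of_nat (k choose Suc j) * F (Suc j)) + (\<Sum>j\<le>k. of_nat (k choose j) * F (Suc j))"
    by (subst sum.atMost_Suc_shift) (simp add: distrib_right sum.distrib)
  moreover have "F 0 + (\<Sum>j\<le>k. of_nat (k choose Suc j) * F (Suc j)) = (\<Sum>j\<le>Suc k. of_nat (k choose j) * F j)"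
    by (subst sum.atMost_Suc_shift) simp
  ultimately show ?thesis by (simp add: binomial_eq_0)
qed

lemma bdiff_0 [simp]: "bdiff 0 u = u"
  by (simp add: bdiff_def fun_eq_iff)

lemma bdiff_add: "bdiff k (\<lambda>n. u n + v n) n = bdiff k u n + bdiff k v n"
  unfolding bdiff_def sum.distrib[symmetric] by (intro sum.cong) (auto simp: distrib_left)

lemma bdiff_diff: "bdiff k (\<lambda>n. u n - v n) n = bdiff k u n - bdiff k v n"
  unfolding bdiff_def sum_subtractf[symmetric] by (intro sum.cong) (auto simp: right_diff_distrib)

lemma bdiff_scale: "bdiff k (\<lambda>n. a * u n) n = a * bdiff k u n"
  unfolding bdiff_def sum_distrib_left by (intro sum.cong) (auto simp: mult_ac)

lemma bdiff_shift: "bdiff k (shift i u) n = shift i (bdiff k u) n"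
proof (cases "i \<le> n")
  case True
  then have "shift (j + i) u n = shift j u (n - i)" for j
    by (auto simp: shift_def le_diff_conv2 add.commute)
  then show ?thesis
    unfolding bdiff_shift_sum shift_shift using True by (simp add: shift_def[of i])
next
  case False
  then show ?thesis
    unfolding bdiff_shift_sum shift_shift by (simp add: shift_def)
qed

lemma bdiff_Suc: "bdiff (Suc k) u n = bdiff k u n - shift 1 (bdiff k u) n"
proof -
  have "bdiff (Suc k) u n = (\<Sum>j\<le>Suc k. of_nat (Suc k choose j) * ((-1) ^ j * shift j u n))"
    unfolding bdiff_shift_sum by (intro sum.cong) (auto simp: mult_ac)
  also have "\<dots> = bdiff k u n - (\<Sum>j\<le>k. (-1) ^ j * of_nat (k choose j) * shift j (shift 1 u) n)"
    unfolding pascal_sum bdiff_shift_sum[of k u] shift_shift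
    by (simp add: mult_ac flip: sum_negf)
  also have "(\<Sum>j\<le>k. (-1) ^ j * of_nat (k choose j) * shift j (shift 1 u) n) = shift 1 (bdiff k u) n"
    using bdiff_shift[of k 1 u n] by (simp only: bdiff_shift_sum[of k "shift 1 u"])
  finally show ?thesis .
qed

lemma bdiff_Suc': "bdiff (Suc k) u n = bdiff k (\<lambda>n. u n - shift 1 u n) n"
  by (simp add: bdiff_Suc bdiff_diff bdiff_shift)

lemma shift_diff: "shift i (\<lambda>n. u n - v n) n = shift i u n - (shift i v n :: 'a::comm_ring_1)"
  by (simp add: shift_def)

lemma shift_sum: "shift i (\<lambda>n. \<Sum>j\<in>A. F j n) n = (\<Sum>j\<in>A. shift i (F j) n :: 'a::comm_ring_1)"
  by (simp add: shift_def)

text \<open>Induction through a n b n - a (n-1) b (n-1) = a n (b n - b (n-1)) + (a n - a (n-1)) b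
  (n-1), followed by Pascal's rule. Only the factor from \<open>h\<close> is shifted, so the decay
  of the differences of \<open>g\<close> is available at the index \<open>n\<close> itself.\<close>

lemma leibniz:
  "bdiff k (\<lambda>n. g n * h n) n = (\<Sum>j\<le>k. of_nat (k choose j) * (bdiff j g n * shift j (bdiff (k - j) h) n))"
proof (induction k arbitrary: n)
  case 0
  then show ?case by simp
next
  case (Suc k)
  let ?F = "\<lambda>j. bdiff j g n * shift j (bdiff (Suc k - j) h) n"
  have L: "bdiff k (\<lambda>n. g n * h n) = (\<lambda>n. \<Sum>j\<le>k. of_nat (k choose j) * (bdiff j g n * shift j (bdiff (k - j) h) n))"
    using Suc by (simp add: fun_eq_iff)
  have "bdiff (Suc k) (\<lambda>n. g n * h n) n = (\<Sum>j\<le>k. of_nat (k choose j) *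
      (bdiff j g n * shift j (bdiff (k - j) h) n -
       shift 1 (bdiff j g) n * shift 1 (shift j (bdiff (k - j) h)) n))"
    unfolding bdiff_Suc[of k "\<lambda>n. g n * h n"] L shift_sum sum_subtractf[symmetric]
    by (intro sum.cong refl) (auto simp: shift_def right_diff_distrib)
  also have "\<dots> = (\<Sum>j\<le>k. of_nat (k choose j) * (?F j + ?F (Suc j)))"
  proof (intro sum.cong refl arg_cong2[where f = "(*)"])
    fix j assume "j \<in> {..k}"
    then have S: "Suc k - j = Suc (k - j)" by auto
    have "shift j (bdiff (Suc k - j) h) n = shift j (bdiff (k - j) h) n - shift (Suc j) (bdiff (k - j) h) n"
      unfolding S bdiff_Suc shift_diff using shift_shift[of j 1 "bdiff (k - j) h" n]
      by (auto simp: shift_def)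
    moreover have "bdiff (Suc j) g n = bdiff j g n - shift 1 (bdiff j g) n" by (rule bdiff_Suc)
    moreover have "shift 1 (shift j (bdiff (k - j) h)) n = shift (Suc j) (bdiff (k - j) h) n"
      by (simp add: shift_shift)
    ultimately show "bdiff j g n * shift j (bdiff (k - j) h) n -
       shift 1 (bdiff j g) n * shift 1 (shift j (bdiff (k - j) h)) n = ?F j + ?F (Suc j)"
      by (simp only: left_diff_distrib right_diff_distrib diff_Suc_Suc) simp
  qed
  also have "\<dots> = (\<Sum>j\<le>Suc k. of_nat (Suc k choose j) * ?F j)"
    unfolding pascal_sum by (simp add: distrib_left sum.distrib)
  finally show ?case .
qed

lemma bdiff_of_real: "bdiff k (\<lambda>n. complex_of_real (u n)) n = complex_of_real (bdiff k u n)"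
  unfolding bdiff_def of_real_sum by (intro sum.cong) auto

lemma bdiff_bounded:
  fixes u :: "nat \<Rightarrow> complex"
  assumes "\<And>n. cmod (u n) \<le> 1"
  shows "cmod (bdiff k u n) \<le> 2 ^ k"
proof -
  have "cmod (bdiff k u n) \<le> (\<Sum>j\<le>k. cmod ((-1) ^ j * of_nat (k choose j) * shift j u n))"
    unfolding bdiff_shift_sum by (rule norm_sum)
  also have "\<dots> \<le> (\<Sum>j\<le>k. real (k choose j))"
  proof (rule sum_mono)
    fix j
    have "cmod (shift j u n) \<le> 1" using assms by (simp add: shift_def)
    then show "cmod ((-1) ^ j * of_nat (k choose j) * shift j u n) \<le> real (k choose j)"
      by (simp add: norm_mult norm_power mult_left_le)
  qed
  also have "\<dots> = 2 ^ k"
    using choose_row_sum[of k] by (metis of_nat_numeral of_nat_power of_nat_sum)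
  finally show ?thesis .
qed

lemma bdiff_has_field_derivative:
  assumes "\<And>n. ((\<lambda>s. G s n) has_field_derivative G' n) (at s within S)"
  shows "((\<lambda>s. bdiff k (G s) n) has_field_derivative bdiff k G' n) (at s within S)"
  unfolding bdiff_def
proof (rule DERIV_sum)
  fix j
  show "((\<lambda>s. (-1) ^ j * of_nat (k choose j) * (if j \<le> n then G s (n - j) else 0)) has_field_derivative
      (-1) ^ j * of_nat (k choose j) * (if j \<le> n then G' (n - j) else 0)) (at s within S)"
    by (cases "j \<le> n") (auto intro!: DERIV_cmult assms)
qed

text \<open>A discrete Mikhlin condition. In contrast to \<open>S_class\<close> it includes j = 0,
  so \<open>g\<close> itself is bounded.\<close>

definition multiplier_bound :: "nat \<Rightarrow> real \<Rightarrow> (nat \<Rightarrow> complex) \<Rightarrow> bool" where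
  "multiplier_bound k C g \<longleftrightarrow> (\<forall>j\<le>k. \<forall>n. real (Suc n) ^ j * cmod (bdiff j g n) \<le> C)"

lemma multiplier_bound_nonneg: "multiplier_bound k C g \<Longrightarrow> 0 \<le> C"
  unfolding multiplier_bound_def
  by (metis mult_nonneg_nonneg norm_ge_zero of_nat_0_le_iff order_trans zero_le zero_le_power)

lemma multiplier_bound_diff:
  assumes "multiplier_bound k C g" "multiplier_bound k C' h"
  shows "multiplier_bound k (C + C') (\<lambda>n. g n - h n)"
  unfolding multiplier_bound_def
proof (intro allI impI)
  fix j n assume j: "j \<le> k"
  have "real (Suc n) ^ j * cmod (bdiff j (\<lambda>n. g n - h n) n)
      \<le> real (Suc n) ^ j * (cmod (bdiff j g n) + cmod (bdiff j h n))"
    unfolding bdiff_diff by (intro mult_left_mono norm_triangle_ineq4) auto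
  also have "\<dots> \<le> C + C'"
    using assms j by (auto simp: multiplier_bound_def distrib_left intro!: add_mono simp del: of_nat_Suc)
  finally show "real (Suc n) ^ j * cmod (bdiff j (\<lambda>n. g n - h n) n) \<le> C + C'" .
qed

text \<open>The extra weight \<open>r\<close> covers two uses: r = 0 for products of multipliers, r
  = 1 for a factor that decays one order faster, such as a first difference. The power of 2 is a sum
  of binomial coefficients.\<close>

lemma weighted_product_bound:
  assumes G: "multiplier_bound k A G"
    and w: "\<And>j n. j \<le> k \<Longrightarrow> real (Suc n) ^ (j + r) * cmod (bdiff j w n) \<le> B"
  shows "real (Suc n) ^ (k + r) * cmod (bdiff k (\<lambda>n. G n * w n) n) \<le> 2 ^ k * real (Suc k) ^ (k + r) * (A * B)"
proof -
  have A: "0 \<le> A" using G by (rule multiplier_bound_nonneg)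
  have B: "0 \<le> B" using w[of 0 0] by (meson le0 mult_nonneg_nonneg norm_ge_zero of_nat_0_le_iff order_trans zero_le_power)
  have term_le: "real (Suc n) ^ (k + r) * (cmod (bdiff j G n) * cmod (shift j (bdiff (k - j) w) n))
      \<le> real (Suc k) ^ (k + r) * (A * B)" if j: "j \<le> k" for j
  proof (cases "j \<le> n")
    case False
    then show ?thesis using A B by (simp add: shift_def)
  next
    case True
    define m where "m = n - j"
    \<comment> \<open>This compares the weights at \<open>n\<close> and at the shifted index n - j,
      and produces the powers of \<open>Suc k\<close>.\<close>
    have "n + 1 \<le> (k + 1) * (m + 1)"
    proof -
      have "n + 1 = m + 1 + j" using True by (simp add: m_def)
      also have "\<dots> \<le> (m + 1) + k * (m + 1)" using j by (simp add: trans_le_add2)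
      finally show ?thesis by simp
    qed
    then have le: "real (Suc n) \<le> real (Suc k) * real (Suc m)"
      by (metis Suc_eq_plus1 of_nat_le_iff of_nat_mult)
    have split: "real (Suc n) ^ (k + r) = real (Suc n) ^ j * real (Suc n) ^ (k - j + r)"
      using j by (simp flip: power_add)
    have "real (Suc n) ^ (k - j + r) * cmod (bdiff (k - j) w m)
        \<le> (real (Suc k) * real (Suc m)) ^ (k - j + r) * cmod (bdiff (k - j) w m)"
      by (intro mult_right_mono power_mono le) auto
    also have "\<dots> = real (Suc k) ^ (k - j + r) * (real (Suc m) ^ (k - j + r) * cmod (bdiff (k - j) w m))"
      by (simp only: power_mult_distrib mult.assoc)
    also have "\<dots> \<le> real (Suc k) ^ (k + r) * B"
      using w[of "k - j" m] by (intro mult_mono power_increasing) auto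
    finally have 1: "real (Suc n) ^ (k - j + r) * cmod (bdiff (k - j) w m) \<le> real (Suc k) ^ (k + r) * B" .
    have 2: "real (Suc n) ^ j * cmod (bdiff j G n) \<le> A"
      using G j by (auto simp: multiplier_bound_def)
    have "real (Suc n) ^ (k + r) * (cmod (bdiff j G n) * cmod (shift j (bdiff (k - j) w) n))
       = (real (Suc n) ^ j * cmod (bdiff j G n)) * (real (Suc n) ^ (k - j + r) * cmod (bdiff (k - j) w m))"
      using True by (simp add: split shift_def m_def mult_ac del: of_nat_Suc)
    also have "\<dots> \<le> A * (real (Suc k) ^ (k + r) * B)"
      by (intro mult_mono 1 2 A) auto
    finally show ?thesis by (simp add: mult_ac)
  qed
  have "cmod (bdiff k (\<lambda>n. G n * w n) n) \<le>
      (\<Sum>j\<le>k. real (k choose j) * (cmod (bdiff j G n) * cmod (shift j (bdiff (k - j) w) n)))"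
    unfolding leibniz by (rule order_trans[OF norm_sum]) (simp add: norm_mult)
  then have "real (Suc n) ^ (k + r) * cmod (bdiff k (\<lambda>n. G n * w n) n) \<le> real (Suc n) ^ (k + r) *
      (\<Sum>j\<le>k. real (k choose j) * (cmod (bdiff j G n) * cmod (shift j (bdiff (k - j) w) n)))"
    by (rule mult_left_mono) simp
  also have "\<dots> = (\<Sum>j\<le>k. real (k choose j) *
      (real (Suc n) ^ (k + r) * (cmod (bdiff j G n) * cmod (shift j (bdiff (k - j) w) n))))"
    unfolding sum_distrib_left by (intro sum.cong) (auto simp: mult_ac)
  also have "\<dots> \<le> (\<Sum>j\<le>k. real (k choose j) * (real (Suc k) ^ (k + r) * (A * B)))"
    by (intro sum_mono mult_left_mono term_le) auto
  also have "\<dots> = (\<Sum>j\<le>k. real (k choose j)) * (real (Suc k) ^ (k + r) * (A * B))"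
    by (simp only: sum_distrib_right)
  also have "(\<Sum>j\<le>k. real (k choose j)) = 2 ^ k"
    using choose_row_sum[of k] by (metis of_nat_numeral of_nat_power of_nat_sum)
  finally show ?thesis by (simp add: mult_ac)
qed

lemma multiplier_bound_mono: "multiplier_bound k C g \<Longrightarrow> j \<le> k \<Longrightarrow> C \<le> C' \<Longrightarrow> multiplier_bound j C' g"
  unfolding multiplier_bound_def by (meson order_trans)

lemma multiplier_bound_mult:
  assumes "multiplier_bound k A g" "multiplier_bound k B h"
  shows "multiplier_bound k (2 ^ k * real (Suc k) ^ k * (A * B)) (\<lambda>n. g n * h n)"
  unfolding multiplier_bound_def
proof (intro allI impI)
  fix j n assume j: "j \<le> k"
  have AB: "0 \<le> A * B" using assms multiplier_bound_nonneg by (intro mult_nonneg_nonneg) auto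
  have "real (Suc n) ^ j * cmod (bdiff j (\<lambda>n. g n * h n) n) \<le> 2 ^ j * real (Suc j) ^ j * (A * B)"
    using weighted_product_bound[of j A g 0 h B n] multiplier_bound_mono[OF assms(1) j order_refl] assms(2) j
    by (auto simp: multiplier_bound_def simp del: of_nat_Suc)
  also have "\<dots> \<le> 2 ^ k * real (Suc k) ^ k * (A * B)"
  proof (intro mult_right_mono mult_mono AB)
    have "real (Suc j) ^ j \<le> real (Suc k) ^ j" using j by (intro power_mono) auto
    also have "\<dots> \<le> real (Suc k) ^ k" using j by (intro power_increasing) auto
    finally show "real (Suc j) ^ j \<le> real (Suc k) ^ k" .
  qed (use j in auto)
  finally show "real (Suc n) ^ j * cmod (bdiff j (\<lambda>n. g n * h n) n) \<le> 2 ^ k * real (Suc k) ^ k * (A * B)" .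
qed

text \<open>With \<open>w = u - shift 1 u\<close>, the difference of \<open>exp (i u)\<close> is the increment over \<open>s\<close> in \<open>[0, 1]\<close> of
  \<open>exp (i u) * exp (- i s w)\<close>, up to a boundary term at the first index. Its derivative in \<open>s\<close> gains
  the factor \<open>w\<close>, which supplies the missing power of \<open>n\<close>.\<close>

lemma exp_multiplier_bound:
  "\<exists>C'. \<forall>u::nat \<Rightarrow> real. (\<forall>j n. 1 \<le> j \<longrightarrow> j \<le> k \<longrightarrow> real (Suc n) ^ j * \<bar>bdiff j u n\<bar> \<le> C) \<longrightarrow>
     multiplier_bound k C' (\<lambda>n. exp (\<i> * complex_of_real (u n)))"
proof (induction k)
  case 0
  show ?case by (intro exI[of _ 1]) (simp add: multiplier_bound_def)
next
  case (Suc k)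
  \<comment> \<open>One constant for all \<open>u\<close> is essential: the hypothesis is applied to
    \<open>u\<close> and to every - t * w with \<open>t\<close> in [0, 1].\<close>
  then obtain C1 where C1: "\<And>u::nat \<Rightarrow> real. (\<And>j n. 1 \<le> j \<Longrightarrow> j \<le> k \<Longrightarrow> real (Suc n) ^ j * \<bar>bdiff j u n\<bar> \<le> C) \<Longrightarrow>
     multiplier_bound k C1 (\<lambda>n. exp (\<i> * complex_of_real (u n)))" by blast
  \<comment> \<open>\<open>K\<close> bounds the product of the two exponentials, \<open>K2\<close>
    that product times \<open>w\<close> with one more weight, and \<open>K3\<close> the boundary
    term.\<close>
  define K where "K = 2 ^ k * real (Suc k) ^ k * (C1 * C1)"
  define K2 where "K2 = 2 ^ k * real (Suc k) ^ (k + 1) * (K * C)"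
  define K3 where "K3 = 2 ^ k * real (Suc k) ^ Suc k"
  have "multiplier_bound (Suc k) (max C1 (K2 + K3)) (\<lambda>n. exp (\<i> * complex_of_real (u n)))"
    if u: "\<And>j n. 1 \<le> j \<Longrightarrow> j \<le> Suc k \<Longrightarrow> real (Suc n) ^ j * \<bar>bdiff j u n\<bar> \<le> C" for u :: "nat \<Rightarrow> real"
  proof -
    define g where "g = (\<lambda>n. exp (\<i> * complex_of_real (u n)))"
    define w where "w = (\<lambda>n. u n - shift 1 u n)"
    have wd: "bdiff j w n = bdiff (Suc j) u n" for j n unfolding w_def by (rule bdiff_Suc'[symmetric])
    have gb: "multiplier_bound k C1 g" unfolding g_def using u by (intro C1) auto
    have wb: "real (Suc n) ^ (j + 1) * cmod (bdiff j (\<lambda>n. complex_of_real (w n)) n) \<le> C" if "j \<le> k" for j n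
      using u[of "Suc j" n] that by (simp add: bdiff_of_real wd del: of_nat_Suc)
    have vb: "multiplier_bound k C1 (\<lambda>n. exp (\<i> * complex_of_real (- t * w n)))" if t: "0 \<le> t" "t \<le> 1" for t
    proof (rule C1)
      fix j n assume j: "1 \<le> j" "j \<le> k"
      have "real (Suc n) ^ j * \<bar>bdiff j (\<lambda>n. - t * w n) n\<bar> = t * (real (Suc n) ^ j * \<bar>bdiff (Suc j) u n\<bar>)"
        using t by (simp only: bdiff_scale wd) (simp add: abs_mult del: of_nat_Suc)
      also have "\<dots> \<le> 1 * (real (Suc n) ^ Suc j * \<bar>bdiff (Suc j) u n\<bar>)"
        using t by (intro mult_mono mult_right_mono power_increasing) auto
      also have "\<dots> \<le> C" using u[of "Suc j" n] j by simp
      finally show "real (Suc n) ^ j * \<bar>bdiff j (\<lambda>n. - t * w n) n\<bar> \<le> C" .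
    qed
    have last: "real (Suc n) ^ Suc k * cmod (bdiff (Suc k) g n) \<le> K2 + K3" for n
    proof -
      define F where "F s = bdiff k (\<lambda>m. g m * exp (- (s * \<i> * complex_of_real (w m)))) n" for s
      define F' where "F' s = bdiff k (\<lambda>m. g m * (exp (- (s * \<i> * complex_of_real (w m))) * - (\<i> * complex_of_real (w m)))) n" for s
      have der: "(F has_field_derivative F' s) (at s within closed_segment 0 1)" for s
        unfolding F_def F'_def
        by (rule bdiff_has_field_derivative) (auto intro!: derivative_eq_intros)
      have F'b: "cmod (F' s) \<le> K2 / real (Suc n) ^ Suc k" if s: "s \<in> closed_segment 0 1" for s
      proof -
        obtain t where t: "0 \<le> t" "t \<le> 1" "s = complex_of_real t"
          using s by (auto simp: closed_segment_def scaleR_conv_of_real)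
        have eq: "F' s = (- \<i>) * bdiff k (\<lambda>m. (g m * exp (\<i> * complex_of_real (- t * w m))) * complex_of_real (w m)) n"
          unfolding F'_def bdiff_scale[symmetric] t(3)
          by (rule arg_cong[where f = "\<lambda>v. bdiff k v n"]) (auto simp: mult_ac)
        have "multiplier_bound k K (\<lambda>m. g m * exp (\<i> * complex_of_real (- t * w m)))"
          unfolding K_def by (rule multiplier_bound_mult[OF gb vb[OF t(1,2)]])
        from weighted_product_bound[OF this wb, of n]
        have "real (Suc n) ^ Suc k * cmod (F' s) \<le> K2"
          unfolding eq K2_def by (simp add: norm_mult del: of_nat_Suc power_Suc)
        then show ?thesis by (simp add: field_simps del: of_nat_Suc power_Suc)
      qed
      have diff: "cmod (F 0 - F 1) \<le> K2 / real (Suc n) ^ Suc k * cmod (0 - 1)"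
        by (rule field_differentiable_bound[OF convex_closed_segment[of 0 1] der F'b]) auto
      \<comment> \<open>At index 0 the shift of \<open>u\<close> vanishes, so w 0 = u 0 and the
        exponential at s = 1 equals 1, whereas \<open>shift 1 g\<close> is 0 there.\<close>
      define d where "d = (\<lambda>n::nat. if n = 0 then 1 else 0 :: complex)"
      have "g m * exp (- (1 * \<i> * complex_of_real (w m))) = shift 1 g m + d m" for m
        by (cases m) (auto simp: g_def w_def shift_def d_def algebra_simps simp flip: exp_add)
      then have "F 1 = shift 1 (bdiff k g) n + bdiff k d n"
        unfolding F_def by (simp add: bdiff_add bdiff_shift)
      moreover have "F 0 = bdiff k g n" by (simp add: F_def)
      ultimately have eq: "bdiff (Suc k) g n = (F 0 - F 1) + bdiff k d n"
        by (simp add: bdiff_Suc)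
      have dK: "real (Suc n) ^ Suc k * cmod (bdiff k d n) \<le> K3"
      proof (cases "n \<le> k")
        case True
        have "cmod (bdiff k d n) \<le> 2 ^ k" by (rule bdiff_bounded) (simp add: d_def)
        then have "real (Suc n) ^ Suc k * cmod (bdiff k d n) \<le> real (Suc k) ^ Suc k * 2 ^ k"
          using True by (intro mult_mono power_mono) auto
        then show ?thesis by (simp add: K3_def mult_ac)
      next
        case False
        then have "bdiff k d n = 0" unfolding bdiff_def by (intro sum.neutral) (auto simp: d_def)
        then show ?thesis by (simp add: K3_def)
      qed
      have "real (Suc n) ^ Suc k * cmod (bdiff (Suc k) g n)
         \<le> real (Suc n) ^ Suc k * (cmod (F 0 - F 1) + cmod (bdiff k d n))"
        unfolding eq by (intro mult_left_mono norm_triangle_ineq) auto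
      also have "\<dots> \<le> K2 + K3"
        using diff dK by (simp add: distrib_left field_simps del: of_nat_Suc power_Suc)
      finally show ?thesis .
    qed
    show ?thesis
      unfolding multiplier_bound_def g_def[symmetric]
    proof (intro allI impI)
      fix j n assume "j \<le> Suc k"
      then consider "j \<le> k" | "j = Suc k" by linarith
      then show "real (Suc n) ^ j * cmod (bdiff j g n) \<le> max C1 (K2 + K3)"
      proof cases
        case 1
        then show ?thesis using gb by (auto simp: multiplier_bound_def intro: max.coboundedI1)
      next
        case 2
        then show ?thesis using last by (auto intro: max.coboundedI2)
      qed
    qed
  qed
  then show ?case by blast
qed

text \<open>The differences of t f scale with \<open>t\<close>, and the constant of
  \<open>exp_multiplier_bound\<close> depends only on their size. Uniformity in \<open>t\<close> is
  what the domination arguments as \<open>t\<close> tends to 0 require.\<close>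

lemma S_class_multiplier_bound:
  assumes "f \<in> S_class k"
  obtains C where "\<And>t. \<bar>t\<bar> \<le> R \<Longrightarrow>
    multiplier_bound k C (\<lambda>n. exp (\<i> * complex_of_real t * complex_of_real (f n)))"
proof -
  have "\<exists>K. \<forall>n. real (Suc n) ^ j * \<bar>bdiff j f n\<bar> \<le> K" if "1 \<le> j" "j \<le> k" for j
  proof -
    have "Bseq (\<lambda>n. real (Suc n) ^ j * bdiff j f n)"
      using assms that by (auto simp: S_class_def)
    from BseqE[OF this] obtain K where "\<forall>n. norm (real (Suc n) ^ j * bdiff j f n) \<le> K" .
    then show ?thesis by (auto simp: abs_mult)
  qed
  then obtain K where K: "\<And>j n. 1 \<le> j \<Longrightarrow> j \<le> k \<Longrightarrow> real (Suc n) ^ j * \<bar>bdiff j f n\<bar> \<le> K j" by metis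
  define B where "B = \<bar>R\<bar> * (\<Sum>j\<le>k. \<bar>K j\<bar>)"
  obtain C where C: "\<And>u::nat \<Rightarrow> real. (\<And>j n. 1 \<le> j \<Longrightarrow> j \<le> k \<Longrightarrow> real (Suc n) ^ j * \<bar>bdiff j u n\<bar> \<le> B) \<Longrightarrow>
     multiplier_bound k C (\<lambda>n. exp (\<i> * complex_of_real (u n)))"
    using exp_multiplier_bound[of k B] by blast
  have "multiplier_bound k C (\<lambda>n. exp (\<i> * complex_of_real t * complex_of_real (f n)))" if t: "\<bar>t\<bar> \<le> R" for t
  proof -
    have "multiplier_bound k C (\<lambda>n. exp (\<i> * complex_of_real (t * f n)))"
    proof (rule C)
      fix j n assume j: "1 \<le> j" "j \<le> k"
      have "real (Suc n) ^ j * \<bar>bdiff j (\<lambda>n. t * f n) n\<bar> = \<bar>t\<bar> * (real (Suc n) ^ j * \<bar>bdiff j f n\<bar>)"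
        by (simp add: bdiff_scale abs_mult mult_ac)
      also have "\<dots> \<le> \<bar>R\<bar> * K j" using K[OF j, of n] t by (intro mult_mono) auto
      also have "\<dots> \<le> B" unfolding B_def
        using member_le_sum[of j "{..k}" "\<lambda>j. \<bar>K j\<bar>"] j by (intro mult_left_mono) auto
      finally show "real (Suc n) ^ j * \<bar>bdiff j (\<lambda>n. t * f n) n\<bar> \<le> B" .
    qed
    then show ?thesis by (simp add: mult.assoc)
  qed
  then show thesis by (rule that)
qed

subsection \<open>The group on the space of formal series\<close>

lemma bdiff_tendsto:
  fixes Y :: "'b \<Rightarrow> nat \<Rightarrow> complex"
  assumes "\<And>n. ((\<lambda>t. Y t n) \<longlongrightarrow> y n) F"
  shows "((\<lambda>t. bdiff k (Y t) n) \<longlongrightarrow> bdiff k y n) F"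
  unfolding bdiff_def
proof (rule tendsto_sum)
  fix j
  show "((\<lambda>t. (-1) ^ j * of_nat (k choose j) * (if j \<le> n then Y t (n - j) else 0)) \<longlongrightarrow>
     (-1) ^ j * of_nat (k choose j) * (if j \<le> n then y (n - j) else 0)) F"
    by (cases "j \<le> n") (auto intro!: tendsto_mult_left assms)
qed

text \<open>The difference operator is triangular: every coordinate is recovered from finitely many
  differences, so no norm bound on \<open>Y\<close> is involved.\<close>

lemma tendsto_zero_of_bdiff:
  fixes Y :: "'b \<Rightarrow> nat \<Rightarrow> complex"
  assumes "\<And>n. ((\<lambda>t. bdiff k (Y t) n) \<longlongrightarrow> 0) F"
  shows "((\<lambda>t. Y t n) \<longlongrightarrow> 0) F"
  using assms
proof (induction k arbitrary: n)
  case (Suc k)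
  have "((\<lambda>t. bdiff k (Y t) m) \<longlongrightarrow> 0) F" for m
  proof (induction m)
    case 0
    then show ?case using Suc.prems[of 0] by (simp add: bdiff_Suc shift_def)
  next
    case (Suc m)
    show ?case
      using tendsto_add[OF \<open>\<And>n. ((\<lambda>t. bdiff (Suc k) (Y t) n) \<longlongrightarrow> 0) F\<close>[of "Suc m"] Suc]
      by (simp add: bdiff_Suc shift_def)
  qed
  then show ?case by (rule Suc.IH)
qed simp

lemma bdiff_single_first:
  fixes u :: "nat \<Rightarrow> complex"
  assumes "\<And>i. i < m \<Longrightarrow> u i = 0"
  shows "bdiff k u m = u m"
proof -
  have "bdiff k u m = (\<Sum>j\<in>{0}. (-1) ^ j * of_nat (k choose j) * (if j \<le> m then u (m - j) else 0))"
    unfolding bdiff_def using assms by (intro sum.mono_neutral_right) auto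
  then show ?thesis by simp
qed

lemma bdiff_finite_support:
  fixes u :: "nat \<Rightarrow> complex"
  assumes "\<And>i. i \<ge> m \<Longrightarrow> u i = 0" "n \<ge> m + k"
  shows "bdiff k u n = 0"
  unfolding bdiff_def using assms by (intro sum.neutral) auto

text \<open>The Leibniz sum with the differences of the multiplier replaced by their decay rates. It
  depends on \<open>h\<close> alone; the values are made complex so that it can be a member of
  \<open>lp p\<close>.\<close>

definition dom_seq :: "nat \<Rightarrow> cseq \<Rightarrow> cseq" where
  "dom_seq k h n = (\<Sum>j\<le>k. complex_of_real
     (real (k choose j) * (cmod (shift j (bdiff (k - j) h) n) / real (Suc n) ^ j)))"

lemma multiplier_dominated:
  assumes "multiplier_bound k C g"
  shows "cmod (bdiff k (\<lambda>n. g n * h n) n) \<le> C * cmod (dom_seq k h n)"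
proof -
  have "cmod (bdiff k (\<lambda>n. g n * h n) n) \<le>
      (\<Sum>j\<le>k. real (k choose j) * (cmod (bdiff j g n) * cmod (shift j (bdiff (k - j) h) n)))"
    unfolding leibniz by (rule order_trans[OF norm_sum]) (simp add: norm_mult)
  also have "\<dots> \<le> (\<Sum>j\<le>k. real (k choose j) * (C / real (Suc n) ^ j * cmod (shift j (bdiff (k - j) h) n)))"
  proof (intro sum_mono mult_left_mono mult_right_mono)
    fix j assume "j \<in> {..k}"
    then have "real (Suc n) ^ j * cmod (bdiff j g n) \<le> C" using assms by (auto simp: multiplier_bound_def)
    then show "cmod (bdiff j g n) \<le> C / real (Suc n) ^ j" by (simp add: field_simps del: of_nat_Suc)
  qed auto
  also have "\<dots> = C * (\<Sum>j\<le>k. real (k choose j) * (cmod (shift j (bdiff (k - j) h) n) / real (Suc n) ^ j))"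
    unfolding sum_distrib_left by (intro sum.cong) auto
  also have "(\<Sum>j\<le>k. real (k choose j) * (cmod (shift j (bdiff (k - j) h) n) / real (Suc n) ^ j)) = cmod (dom_seq k h n)"
    unfolding dom_seq_def of_real_sum[symmetric] norm_of_real
    by (rule abs_of_nonneg[symmetric]) (auto intro!: sum_nonneg)
  finally show ?thesis .
qed

context lp_space begin

definition hardy_const :: real where
  "hardy_const = (2 powr p / (p - 1)) powr (1 / p)"

lemma hardy_nrm:
  assumes w: "w \<in> lp p" and le: "\<And>n. cmod (v n) * real (Suc n) \<le> (\<Sum>m\<le>n. cmod (w m))"
  shows "v \<in> lp p" "nrm v \<le> hardy_const * nrm w"
proof -
  have "(\<Sum>n<N. cmod (v n) powr p) \<le> (hardy_const * nrm w) powr p" for N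
  proof -
    have "(\<Sum>n<N. cmod (v n) powr p) \<le> (\<Sum>n<N. ((\<Sum>m\<le>n. cmod (w m)) / real (Suc n)) powr p)"
      using le p0 by (intro sum_mono powr_mono2) (auto simp: field_simps)
    also have "\<dots> \<le> 2 powr p / (p - 1) * (\<Sum>n<N. cmod (w n) powr p)" by (rule hardy) simp
    also have "\<dots> \<le> 2 powr p / (p - 1) * nrm w powr p"
      using sum_le_nrm[OF w] p1 by (intro mult_left_mono) auto
    also have "\<dots> = (hardy_const * nrm w) powr p"
      using p1 p0 nrm_nonneg by (simp add: hardy_const_def powr_mult powr_powr)
    finally show ?thesis .
  qed
  from nrm_leI[OF this] show "v \<in> lp p" "nrm v \<le> hardy_const * nrm w"
    using nrm_nonneg by (auto simp: hardy_const_def)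
qed

text \<open>Lowering the order of the difference by one means taking partial sums, and Hardy's
  inequality pays for this with one factor 1/(n+1). The weights already present decrease, so they
  can be moved inside the sum.\<close>

lemma weighted_bdiff_lp:
  assumes h: "bdiff k h \<in> lp p"
  shows "j \<le> k \<Longrightarrow> (\<lambda>n. bdiff (k - j) h n / of_nat (Suc n) ^ j) \<in> lp p \<and>
    nrm (\<lambda>n. bdiff (k - j) h n / of_nat (Suc n) ^ j) \<le> hardy_const ^ j * nrm (bdiff k h)"
proof (induction j)
  case 0
  then show ?case using h by simp
next
  case (Suc j)
  define w where "w = (\<lambda>n. bdiff (k - j) h n / of_nat (Suc n) ^ j)"
  define v where "v = (\<lambda>n. bdiff (k - Suc j) h n / of_nat (Suc n) ^ Suc j)"
  have w: "w \<in> lp p" "nrm w \<le> hardy_const ^ j * nrm (bdiff k h)" using Suc by (auto simp: w_def)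
  have S: "k - j = Suc (k - Suc j)" using Suc by simp
  have cum: "bdiff (k - Suc j) h n = (\<Sum>m\<le>n. bdiff (k - j) h m)" for n
    by (induction n) (simp_all add: S bdiff_Suc shift_def)
  have "cmod (v n) * real (Suc n) \<le> (\<Sum>m\<le>n. cmod (w m))" for n
  proof -
    have "cmod (v n) * real (Suc n) = cmod (bdiff (k - Suc j) h n) / real (Suc n) ^ j"
      by (simp add: v_def norm_divide norm_power norm_mult del: of_nat_Suc)
    also have "\<dots> \<le> (\<Sum>m\<le>n. cmod (bdiff (k - j) h m)) / real (Suc n) ^ j"
      unfolding cum by (intro divide_right_mono norm_sum) auto
    also have "\<dots> \<le> (\<Sum>m\<le>n. cmod (w m))"
      unfolding sum_divide_distrib
    proof (rule sum_mono)
      fix m assume "m \<in> {..n}"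
      then show "cmod (bdiff (k - j) h m) / real (Suc n) ^ j \<le> cmod (w m)"
        by (simp add: w_def norm_divide norm_power del: of_nat_Suc)
           (intro divide_left_mono power_mono, auto)
    qed
    finally show ?thesis .
  qed
  from hardy_nrm[OF w(1) this] have "v \<in> lp p" "nrm v \<le> hardy_const * nrm w" by auto
  moreover have "hardy_const * nrm w \<le> hardy_const ^ Suc j * nrm (bdiff k h)"
    using mult_left_mono[OF w(2), of hardy_const] by (simp add: hardy_const_def mult_ac)
  ultimately show ?case unfolding v_def by simp
qed

lemma shift_lp:
  assumes "x \<in> lp p" shows "shift j x \<in> lp p" "nrm (shift j x) \<le> nrm x"
proof -
  have "(\<Sum>n<N. cmod (shift j x n) powr p) \<le> nrm x powr p" for N
  proof -
    have "(\<Sum>n<N. cmod (shift j x n) powr p) = (\<Sum>n\<in>{j..<N}. cmod (x (n - j)) powr p)"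
      using p0 by (intro sum.mono_neutral_cong_right) (auto simp: shift_def)
    also have "\<dots> = (\<Sum>n\<in>(\<lambda>n. n - j) ` {j..<N}. cmod (x n) powr p)"
      by (subst sum.reindex) (auto intro!: inj_onI)
    also have "\<dots> \<le> nrm x powr p" by (rule sum_le_nrm[OF assms]) simp
    finally show ?thesis .
  qed
  from nrm_leI[OF this nrm_nonneg] show "shift j x \<in> lp p" "nrm (shift j x) \<le> nrm x" by auto
qed

lemma dom_seq_lp:
  "\<exists>C>0. \<forall>h. bdiff k h \<in> lp p \<longrightarrow> dom_seq k h \<in> lp p \<and> nrm (dom_seq k h) \<le> C * nrm (bdiff k h)"
proof -
  define C where "C = (\<Sum>j\<le>k. real (k choose j) * hardy_const ^ j) + 1"
  have H0: "0 \<le> hardy_const" by (simp add: hardy_const_def)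
  have "dom_seq k h \<in> lp p \<and> nrm (dom_seq k h) \<le> C * nrm (bdiff k h)" if h: "bdiff k h \<in> lp p" for h
  proof -
    define X where "X j n = complex_of_real (real (k choose j) * (cmod (shift j (bdiff (k - j) h) n) / real (Suc n) ^ j))" for j n
    define W where "W j = (\<lambda>n. bdiff (k - j) h n / of_nat (Suc n) ^ j)" for j
    have X: "X j \<in> lp p \<and> nrm (X j) \<le> real (k choose j) * hardy_const ^ j * nrm (bdiff k h)" if j: "j \<le> k" for j
    proof -
      have W: "W j \<in> lp p" "nrm (W j) \<le> hardy_const ^ j * nrm (bdiff k h)"
        using weighted_bdiff_lp[OF h j] by (auto simp: W_def)
      \<comment> \<open>Replacing the weight at \<open>n\<close> by the larger one at n - j makes
        the term a shifted copy of \<open>W j\<close>.\<close>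
      have le: "cmod (X j n) \<le> cmod (of_nat (k choose j) * shift j (W j) n)" for n
      proof (cases "j \<le> n")
        case True
        have "cmod (bdiff (k - j) h (n - j)) / real (Suc n) ^ j \<le> cmod (bdiff (k - j) h (n - j)) / real (Suc (n - j)) ^ j"
          by (intro divide_left_mono power_mono) auto
        then have "real (k choose j) * (cmod (bdiff (k - j) h (n - j)) / real (Suc n) ^ j)
          \<le> real (k choose j) * (cmod (bdiff (k - j) h (n - j)) / real (Suc (n - j)) ^ j)"
          by (rule mult_left_mono) simp
        then show ?thesis using True
          by (simp add: X_def W_def shift_def norm_mult norm_divide norm_power del: of_nat_Suc)
      qed (simp add: X_def shift_def)
      note S = shift_lp[OF W(1), of j]
      have "X j \<in> lp p" "nrm (X j) \<le> nrm (\<lambda>n. of_nat (k choose j) * shift j (W j) n)"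
        using nrm_mono[OF nrm_scale(1)[OF S(1), of "of_nat (k choose j)"] le] by auto
      moreover have "nrm (\<lambda>n. of_nat (k choose j) * shift j (W j) n) = real (k choose j) * nrm (shift j (W j))"
        using nrm_scale(2)[OF S(1), of "of_nat (k choose j)"] by simp
      moreover have "real (k choose j) * nrm (shift j (W j)) \<le> real (k choose j) * (hardy_const ^ j * nrm (bdiff k h))"
        using S(2) W(2) by (intro mult_left_mono) auto
      ultimately show ?thesis by (simp add: mult.assoc)
    qed
    have eq: "dom_seq k h = (\<lambda>n. \<Sum>j\<le>k. X j n)" by (simp add: dom_seq_def X_def fun_eq_iff)
    have "nrm (dom_seq k h) \<le> (\<Sum>j\<le>k. nrm (X j))"
      unfolding eq using nrm_sum[of "{..k}" X] X by auto
    also have "\<dots> \<le> (\<Sum>j\<le>k. real (k choose j) * hardy_const ^ j * nrm (bdiff k h))"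
      using X by (intro sum_mono) auto
    also have "\<dots> \<le> C * nrm (bdiff k h)"
      using nrm_nonneg by (simp add: C_def distrib_right sum_distrib_right)
    finally show ?thesis unfolding eq using sum_lp[of "{..k}" X] X by auto
  qed
  moreover have "C > 0" using H0 by (simp add: C_def add_nonneg_pos sum_nonneg)
  ultimately show ?thesis by blast
qed

lemma lp_diff_scale: "x \<in> lp_diff p k \<Longrightarrow> (\<lambda>i. a * x i) \<in> lp_diff p k"
  using nrm_scale(1)[of "bdiff k x" a] by (simp add: lp_diff_def bdiff_scale[abs_def])

lemma lp_diff_diff: "x \<in> lp_diff p k \<Longrightarrow> y \<in> lp_diff p k \<Longrightarrow> (\<lambda>i. x i - y i) \<in> lp_diff p k"
  using nrm_diff(1)[of "bdiff k x" "bdiff k y"] by (simp add: lp_diff_def bdiff_diff[abs_def])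

end

section \<open>Convergence in the space of formal series, failure of the basis property, and the
  group\<close>

context lp_symmetric_basis begin

lemma lp_diff_norm_equiv:
  "\<exists>m>0. \<exists>M>0. \<forall>x\<in>lp_diff p k. m * nrm (bdiff k x) \<le> lp_diff_norm p k e x \<and>
     lp_diff_norm p k e x \<le> M * nrm (bdiff k x)"
  using equivalent_to_canonical unfolding lp_diff_norm_def lp_diff_def by blast

text \<open>Here the basis leaves the argument: all later limits are computed with the plain
  \<open>lp p\<close> norm of differences.\<close>

lemma tendsto_in_lp_diff:
  "tendsto_in (lp_diff p k) (lp_diff_norm p k e) X x F \<longleftrightarrow>
     x \<in> lp_diff p k \<and> (\<forall>\<^sub>F t in F. X t \<in> lp_diff p k) \<and> ((\<lambda>t. nrm (bdiff k (\<lambda>i. X t i - x i))) \<longlongrightarrow> 0) F"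
proof (cases "x \<in> lp_diff p k \<and> (\<forall>\<^sub>F t in F. X t \<in> lp_diff p k)")
  case True
  obtain m M where mM: "m > 0" "M > 0"
    "\<And>x. x \<in> lp_diff p k \<Longrightarrow> m * nrm (bdiff k x) \<le> lp_diff_norm p k e x"
    "\<And>x. x \<in> lp_diff p k \<Longrightarrow> lp_diff_norm p k e x \<le> M * nrm (bdiff k x)"
    using lp_diff_norm_equiv[of k] by blast
  have ev: "\<forall>\<^sub>F t in F. (\<lambda>i. X t i - x i) \<in> lp_diff p k"
    using True by (auto elim!: eventually_mono intro: lp_diff_diff)
  have "((\<lambda>t. lp_diff_norm p k e (\<lambda>i. X t i - x i)) \<longlongrightarrow> 0) F \<longleftrightarrow>
      ((\<lambda>t. nrm (bdiff k (\<lambda>i. X t i - x i))) \<longlongrightarrow> 0) F" (is "?L \<longleftrightarrow> ?R")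
  proof
    assume L: ?L
    have "\<forall>\<^sub>F t in F. norm (nrm (bdiff k (\<lambda>i. X t i - x i))) \<le> (1 / m) * lp_diff_norm p k e (\<lambda>i. X t i - x i)"
      using ev by eventually_elim (use mM nrm_nonneg in \<open>simp add: field_simps\<close>)
    then show ?R by (rule Lim_null_comparison) (intro tendsto_mult_right_zero L)
  next
    assume R: ?R
    have "\<forall>\<^sub>F t in F. norm (lp_diff_norm p k e (\<lambda>i. X t i - x i)) \<le> M * nrm (bdiff k (\<lambda>i. X t i - x i))"
      using ev by eventually_elim (use mM nrm_nonneg in \<open>simp add: lp_diff_norm_def\<close>)
    then show ?L by (rule Lim_null_comparison) (intro tendsto_mult_right_zero R)
  qed
  then show ?thesis using True by (simp add: tendsto_in_def)
qed (auto simp: tendsto_in_def)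

lemma tendsto_in_lp_diff_coord:
  assumes "tendsto_in (lp_diff p k) (lp_diff_norm p k e) X x F"
  shows "((\<lambda>t. X t i) \<longlongrightarrow> x i) F"
proof -
  have *: "x \<in> lp_diff p k" "\<forall>\<^sub>F t in F. X t \<in> lp_diff p k" "((\<lambda>t. nrm (bdiff k (\<lambda>i. X t i - x i))) \<longlongrightarrow> 0) F"
    using assms by (auto simp: tendsto_in_lp_diff)
  have "((\<lambda>t. bdiff k (\<lambda>i. X t i - x i) n) \<longlongrightarrow> 0) F" for n
  proof (rule Lim_null_comparison[OF _ *(3)])
    show "\<forall>\<^sub>F t in F. norm (bdiff k (\<lambda>i. X t i - x i) n) \<le> nrm (bdiff k (\<lambda>i. X t i - x i))"
      using *(2)
    proof eventually_elim
      case (elim t)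
      then have "bdiff k (\<lambda>i. X t i - x i) \<in> lp p" using lp_diff_diff[OF elim *(1)] by (simp add: lp_diff_def)
      then show ?case by (rule coord_le_nrm)
    qed
  qed
  from tendsto_zero_of_bdiff[of k "\<lambda>t i. X t i - x i", OF this] show ?thesis
    by (rule LIM_zero_cancel)
qed

lemma not_basis:
  assumes k: "k \<ge> 1"
  shows "\<not> schauder_basis (lp_diff p k) (lp_diff_norm p k e) single_term"
proof
  assume b: "schauder_basis (lp_diff p k) (lp_diff_norm p k e) single_term"
  obtain l where l: "k = Suc l" using k by (cases k) auto
  define x :: cseq where "x = (\<lambda>_. 1)"
  \<comment> \<open>With zeros before the first index, the first difference of the constant 1 is the
    unit vector at 0; the remaining \<open>l\<close> differences keep its support finite.\<close>
  have "bdiff k x n = 0" if "n \<ge> 1 + l" for n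
    unfolding l bdiff_Suc' by (rule bdiff_finite_support[OF _ that]) (simp add: x_def shift_def)
  then have "bdiff k x \<in> lp p"
    by (intro finite_support_lp[of "{..<1 + l}"]) simp_all
  then have xl: "x \<in> lp_diff p k" by (simp add: lp_diff_def)
  then obtain c where c: "sums_in (lp_diff p k) (lp_diff_norm p k e) c single_term x"
    using b unfolding schauder_basis_def by blast
  define P where "P m i = (\<Sum>n<m. c n * single_term n i)" for m i
  have P: "P m i = (if i < m then c i else 0)" for m i
    by (simp add: P_def single_term_def if_distrib[of "(*) _"] cong: if_cong)
  have t: "tendsto_in (lp_diff p k) (lp_diff_norm p k e) P x sequentially"
    using c by (simp add: sums_in_def P_def[abs_def])
  have "c i = 1" for i
  proof -
    have "(\<lambda>m. P m i) \<longlonglongrightarrow> c i"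
      by (rule tendsto_eventually, rule eventually_sequentiallyI[of "Suc i"]) (simp add: P)
    then show ?thesis
      using LIMSEQ_unique[OF _ tendsto_in_lp_diff_coord[OF t, of i]] by (simp add: x_def)
  qed
  then have Y: "(\<lambda>i. P m i - x i) = (\<lambda>i. if i < m then 0 else - 1)" for m
    by (auto simp: P x_def)
  have "\<forall>\<^sub>F m in sequentially. P m \<in> lp_diff p k" "(\<lambda>m. nrm (bdiff k (\<lambda>i. P m i - x i))) \<longlonglongrightarrow> 0"
    using t by (auto simp: tendsto_in_lp_diff)
  from eventually_happens[OF eventually_conj[OF this(1) order_tendstoD(2)[OF this(2), of 1]]]
  obtain m where m: "P m \<in> lp_diff p k" "nrm (bdiff k (\<lambda>i. P m i - x i)) < 1" by auto
  have "bdiff k (\<lambda>i. P m i - x i) \<in> lp p"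
    using lp_diff_diff[OF m(1) xl] by (simp add: lp_diff_def)
  from coord_le_nrm[OF this, of m] have "cmod (bdiff k (\<lambda>i. P m i - x i) m) < 1" using m(2) by simp
  moreover have "bdiff k (\<lambda>i. P m i - x i) m = - 1"
    unfolding Y by (subst bdiff_single_first) auto
  ultimately show False by simp
qed

definition exp_group :: "(nat \<Rightarrow> real) \<Rightarrow> real \<Rightarrow> cseq \<Rightarrow> cseq" where
  "exp_group f t c = (\<lambda>n. exp (\<i> * complex_of_real t * complex_of_real (f n)) * c n)"

lemma exp_group_bounded:
  assumes f: "f \<in> S_class k"
  shows "bounded_operator_on (lp_diff p k) (lp_diff_norm p k e) (exp_group f t)"
proof -
  obtain C where C: "multiplier_bound k C (\<lambda>n. exp (\<i> * complex_of_real t * complex_of_real (f n)))"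
    using S_class_multiplier_bound[OF f, of "\<bar>t\<bar>"] by (metis order_refl)
  have C0: "0 \<le> C" by (rule multiplier_bound_nonneg[OF C])
  obtain D where D: "D > 0" "\<And>h. bdiff k h \<in> lp p \<Longrightarrow> dom_seq k h \<in> lp p \<and> nrm (dom_seq k h) \<le> D * nrm (bdiff k h)"
    using dom_seq_lp[of k] by blast
  obtain m M where mM: "m > 0" "M > 0"
    "\<And>x. x \<in> lp_diff p k \<Longrightarrow> m * nrm (bdiff k x) \<le> lp_diff_norm p k e x"
    "\<And>x. x \<in> lp_diff p k \<Longrightarrow> lp_diff_norm p k e x \<le> M * nrm (bdiff k x)"
    using lp_diff_norm_equiv[of k] by blast
  have b: "exp_group f t x \<in> lp_diff p k \<and> nrm (bdiff k (exp_group f t x)) \<le> C * D * nrm (bdiff k x)"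
    if x: "x \<in> lp_diff p k" for x
  proof -
    have dl: "dom_seq k x \<in> lp p" "nrm (dom_seq k x) \<le> D * nrm (bdiff k x)"
      using D(2) x by (auto simp: lp_diff_def)
    have le: "cmod (bdiff k (exp_group f t x) n) \<le> cmod (complex_of_real C * dom_seq k x n)" for n
      unfolding exp_group_def using multiplier_dominated[OF C, of x n] C0 by (simp add: norm_mult)
    note n = nrm_mono[OF nrm_scale(1)[OF dl(1), of "complex_of_real C"] le]
    have "nrm (bdiff k (exp_group f t x)) \<le> C * nrm (dom_seq k x)"
      using n(2) nrm_scale(2)[OF dl(1), of "complex_of_real C"] C0 by simp
    also have "\<dots> \<le> C * (D * nrm (bdiff k x))" by (intro mult_left_mono dl C0)
    finally show ?thesis using n(1) by (simp add: lp_diff_def mult.assoc)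
  qed
  have "lp_diff_norm p k e (exp_group f t x) \<le> (M * (C * D) / m) * lp_diff_norm p k e x"
    if x: "x \<in> lp_diff p k" for x
  proof -
    have "lp_diff_norm p k e (exp_group f t x) \<le> M * (C * D * nrm (bdiff k x))"
      using b[OF x] mM(4)[of "exp_group f t x"] mM(2) by (meson less_imp_le mult_left_mono order_trans)
    also have "\<dots> = (M * (C * D) / m) * (m * nrm (bdiff k x))" using mM(1) by simp
    also have "\<dots> \<le> (M * (C * D) / m) * lp_diff_norm p k e x"
      using mM C0 D(1) x by (intro mult_left_mono) auto
    finally show ?thesis .
  qed
  moreover have "exp_group f t (\<lambda>i. a * x i + b * y i) = (\<lambda>i. a * exp_group f t x i + b * exp_group f t y i)" for a b x y
    by (simp add: exp_group_def fun_eq_iff algebra_simps)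
  ultimately show ?thesis unfolding bounded_operator_on_def using b by blast
qed

lemma exp_group_lp_diff: "f \<in> S_class k \<Longrightarrow> x \<in> lp_diff p k \<Longrightarrow> exp_group f t x \<in> lp_diff p k"
  using exp_group_bounded[of f k t] by (simp add: bounded_operator_on_def)

text \<open>The constant 1 is the exponential at t = 0, so this is a difference of two members of
  one uniformly bounded family.\<close>

lemma exp_minus_one_bound:
  assumes "f \<in> S_class k"
  obtains C where "0 \<le> C" "\<And>t. \<bar>t\<bar> \<le> 1 \<Longrightarrow>
    multiplier_bound k C (\<lambda>n. exp (\<i> * complex_of_real t * complex_of_real (f n)) - 1)"
proof -
  obtain C where C: "\<And>t. \<bar>t\<bar> \<le> 1 \<Longrightarrow> multiplier_bound k C (\<lambda>n. exp (\<i> * complex_of_real t * complex_of_real (f n)))"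
    using S_class_multiplier_bound[OF assms, of 1] by blast
  have "multiplier_bound k (C + C) (\<lambda>n. exp (\<i> * complex_of_real t * complex_of_real (f n)) - 1)" if "\<bar>t\<bar> \<le> 1" for t
    using multiplier_bound_diff[OF C[OF that] C[of 0]] by simp
  moreover have "0 \<le> C + C" using multiplier_bound_nonneg[OF C[of 0]] by simp
  ultimately show thesis using that by blast
qed

lemma eventually_small: "\<forall>\<^sub>F t::real in at 0. t \<noteq> 0 \<and> \<bar>t\<bar> \<le> 1"
  unfolding eventually_at by (intro exI[of _ 1]) auto

lemma exp_group_continuous:
  assumes f: "f \<in> S_class k" and x: "x \<in> lp_diff p k"
  shows "tendsto_in (lp_diff p k) (lp_diff_norm p k e) (\<lambda>t. exp_group f t x) x (at 0)"
proof -
  obtain C where C: "0 \<le> C" "\<And>t. \<bar>t\<bar> \<le> 1 \<Longrightarrow>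
    multiplier_bound k C (\<lambda>n. exp (\<i> * complex_of_real t * complex_of_real (f n)) - 1)"
    using exp_minus_one_bound[OF f] by blast
  have dl: "dom_seq k x \<in> lp p"
    using dom_seq_lp[of k] x by (auto simp: lp_diff_def)
  have eq: "(\<lambda>i. exp_group f t x i - x i) = (\<lambda>n. (exp (\<i> * complex_of_real t * complex_of_real (f n)) - 1) * x n)" for t
    by (simp add: exp_group_def left_diff_distrib)
  have "((\<lambda>t. nrm (bdiff k (\<lambda>i. exp_group f t x i - x i))) \<longlongrightarrow> 0) (at 0)"
  proof (rule dominated_nrm_tendsto[OF nrm_scale(1)[OF dl, of "complex_of_real C"]])
    show "\<forall>\<^sub>F t in at 0. \<forall>n. cmod (bdiff k (\<lambda>i. exp_group f t x i - x i) n) \<le> cmod (complex_of_real C * dom_seq k x n)"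
      using eventually_small
    proof eventually_elim
      case (elim t)
      then show ?case
        unfolding eq using multiplier_dominated[OF C(2)[of t], of x] C(1) by (simp add: norm_mult)
    qed
    fix n
    have "((\<lambda>t. bdiff k (\<lambda>i. exp_group f t x i - x i) n) \<longlongrightarrow> bdiff k (\<lambda>i. exp_group f 0 x i - x i) n) (at 0)"
      unfolding exp_group_def by (intro bdiff_tendsto tendsto_intros)
    moreover have "bdiff k (\<lambda>i. exp_group f 0 x i - x i) n = 0"
      by (simp add: exp_group_def bdiff_def)
    ultimately show "((\<lambda>t. bdiff k (\<lambda>i. exp_group f t x i - x i) n) \<longlongrightarrow> 0) (at 0)" by simp
  qed
  then show ?thesis
    unfolding tendsto_in_lp_diff using x exp_group_lp_diff[OF f x] by simp
qed

lemma exp_quotient_tendsto: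
  "((\<lambda>t. (exp (\<i> * complex_of_real t * a) * c - c) / complex_of_real t) \<longlongrightarrow> \<i> * a * c) (at 0)"
proof -
  have "((\<lambda>z. exp (\<i> * z * a) * c) has_field_derivative \<i> * a * c) (at 0)"
    by (auto intro!: derivative_eq_intros)
  then have lim: "((\<lambda>z. (exp (\<i> * z * a) * c - c) / z) \<longlongrightarrow> \<i> * a * c) (at 0)"
    by (simp add: has_field_derivative_iff)
  have "filterlim complex_of_real (at 0) (at 0)"
    unfolding filterlim_at
    using tendsto_of_real[OF tendsto_ident_at[of "0::real" UNIV]] eventually_small
    by (auto elim!: eventually_mono)
  from filterlim_compose[OF lim this] show ?thesis .
qed

text \<open>Mean value inequality for \<open>s \<mapsto> \<Delta>\<^sup>k (exp (i s f) x - s y) n\<close> with \<open>y = i f x\<close>: its derivative is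
  \<open>\<Delta>\<^sup>k ((exp (i s f) - 1) y) n\<close>, which is dominated uniformly in \<open>s\<close>.\<close>

lemma exp_group_derivative:
  assumes f: "f \<in> S_class k" and x: "x \<in> lp_diff p k" and y: "A_op f x \<in> lp_diff p k"
  shows "orbit_deriv_in (lp_diff p k) (lp_diff_norm p k e) (exp_group f) x (A_op f x)"
proof -
  define y where "y = A_op f x"
  define Q where "Q t = (\<lambda>i. (exp_group f t x i - x i) / complex_of_real t)" for t
  obtain C where C: "0 \<le> C" "\<And>t. \<bar>t\<bar> \<le> 1 \<Longrightarrow>
    multiplier_bound k C (\<lambda>n. exp (\<i> * complex_of_real t * complex_of_real (f n)) - 1)"
    using exp_minus_one_bound[OF f] by blast
  have dl: "dom_seq k y \<in> lp p"
    using dom_seq_lp[of k] assms(3) by (auto simp: lp_diff_def y_def)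
  have bound: "cmod (bdiff k (\<lambda>i. Q t i - y i) n) \<le> C * cmod (dom_seq k y n)" if t: "t \<noteq> 0" "\<bar>t\<bar> \<le> 1" for t n
  proof -
    let ?S = "closed_segment 0 (complex_of_real t)"
    define F where "F s = bdiff k (\<lambda>m. exp (\<i> * s * complex_of_real (f m)) * x m - s * y m) n" for s
    define F' where "F' s = bdiff k (\<lambda>m. (exp (\<i> * s * complex_of_real (f m)) - 1) * y m) n" for s
    have der: "(F has_field_derivative F' s) (at s within ?S)" for s
      unfolding F_def F'_def
      by (rule bdiff_has_field_derivative)
         (auto intro!: derivative_eq_intros simp: y_def A_op_def algebra_simps)
    have F'b: "cmod (F' s) \<le> C * cmod (dom_seq k y n)" if s: "s \<in> ?S" for s
    proof -
      obtain u where u: "0 \<le> u" "u \<le> 1" "s = complex_of_real (u * t)"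
        using s by (auto simp: closed_segment_def scaleR_conv_of_real)
      have "\<bar>u * t\<bar> \<le> 1" using u t by (simp add: abs_mult mult_le_one)
      from multiplier_dominated[OF C(2)[OF this], of y n] show ?thesis
        unfolding F'_def u(3) .
    qed
    have "cmod (F (complex_of_real t) - F 0) \<le> C * cmod (dom_seq k y n) * cmod (complex_of_real t - 0)"
      by (rule field_differentiable_bound[OF convex_closed_segment der F'b]) auto
    \<comment> \<open>The factor \<open>t\<close> cancels the length of the segment in the mean
      value inequality and leaves a bound independent of \<open>t\<close>.\<close>
    moreover have "F (complex_of_real t) - F 0 = complex_of_real t * bdiff k (\<lambda>i. Q t i - y i) n"
      unfolding F_def bdiff_diff[symmetric] bdiff_scale[symmetric]
      by (rule arg_cong[where f = "\<lambda>v. bdiff k v n"])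
         (use t in \<open>simp add: Q_def exp_group_def fun_eq_iff field_simps\<close>)
    ultimately show ?thesis using t by (simp add: norm_mult field_simps)
  qed
  have "((\<lambda>t. nrm (bdiff k (\<lambda>i. Q t i - y i))) \<longlongrightarrow> 0) (at 0)"
  proof (rule dominated_nrm_tendsto[OF nrm_scale(1)[OF dl, of "complex_of_real C"]])
    show "\<forall>\<^sub>F t in at 0. \<forall>n. cmod (bdiff k (\<lambda>i. Q t i - y i) n) \<le> cmod (complex_of_real C * dom_seq k y n)"
      using eventually_small by eventually_elim (use bound C(1) in \<open>simp add: norm_mult\<close>)
    fix n
    have "((\<lambda>t. Q t i - y i) \<longlongrightarrow> 0) (at 0)" for i
      unfolding Q_def exp_group_def y_def A_op_def by (intro LIM_zero exp_quotient_tendsto)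
    then have "((\<lambda>t. bdiff k (\<lambda>i. Q t i - y i) n) \<longlongrightarrow> bdiff k (\<lambda>i. 0) n) (at 0)"
      by (rule bdiff_tendsto)
    then show "((\<lambda>t. bdiff k (\<lambda>i. Q t i - y i) n) \<longlongrightarrow> 0) (at 0)" by (simp add: bdiff_def)
  qed
  moreover have "Q t \<in> lp_diff p k" for t
    using lp_diff_scale[OF lp_diff_diff[OF exp_group_lp_diff[OF f x] x], of "inverse (complex_of_real t)" t]
    by (simp add: Q_def field_simps)
  ultimately show ?thesis
    unfolding orbit_deriv_in_def tendsto_in_lp_diff using y by (simp add: Q_def y_def)
qed

text \<open>That the generator is no larger than \<open>A_op f\<close> on \<open>A_dom p k f\<close>
  rests on coordinatewise limits: a derivative \<open>y\<close> of the orbit must equal i f x at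
  every index, so f x = - i y lies in the space.\<close>

lemma exp_group_generated:
  assumes f: "f \<in> S_class k"
  shows "generates_C0_group (lp_diff p k) (lp_diff_norm p k e) (A_dom p k f) (A_op f) (exp_group f)"
proof -
  have "C0_group (lp_diff p k) (lp_diff_norm p k e) (exp_group f)"
    unfolding C0_group_def using exp_group_bounded[OF f] exp_group_continuous[OF f]
    by (auto simp: exp_group_def fun_eq_iff distrib_left distrib_right mult_exp_exp mult.assoc simp flip: exp_add)
  moreover have der: "orbit_deriv_in (lp_diff p k) (lp_diff_norm p k e) (exp_group f) x (A_op f x)"
    if x: "x \<in> A_dom p k f" for x
  proof (rule exp_group_derivative[OF f])
    show "x \<in> lp_diff p k" using x by (simp add: A_dom_def)
    show "A_op f x \<in> lp_diff p k"
      using lp_diff_scale[of "\<lambda>n. complex_of_real (f n) * x n" k \<i>] x by (simp add: A_dom_def A_op_def mult.assoc)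
  qed
  moreover have "x \<in> A_dom p k f"
    if x: "x \<in> lp_diff p k" and y: "orbit_deriv_in (lp_diff p k) (lp_diff_norm p k e) (exp_group f) x y" for x y
  proof -
    have t: "tendsto_in (lp_diff p k) (lp_diff_norm p k e) (\<lambda>t i. (exp_group f t x i - x i) / complex_of_real t) y (at 0)"
      using y by (simp add: orbit_deriv_in_def)
    have "((\<lambda>t. (exp_group f t x i - x i) / complex_of_real t) \<longlongrightarrow> \<i> * complex_of_real (f i) * x i) (at 0)" for i
      unfolding exp_group_def by (rule exp_quotient_tendsto)
    from tendsto_unique[OF _ tendsto_in_lp_diff_coord[OF t] this]
    have "y i = \<i> * complex_of_real (f i) * x i" for i by simp
    then have "(\<lambda>n. complex_of_real (f n) * x n) = (\<lambda>n. - \<i> * y n)"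
      by (simp add: fun_eq_iff mult.assoc)
    moreover have "y \<in> lp_diff p k" using t by (simp add: tendsto_in_def)
    ultimately show ?thesis using x lp_diff_scale[of y k "- \<i>"] by (simp add: A_dom_def)
  qed
  ultimately show ?thesis
    unfolding generates_C0_group_def by (auto simp: A_dom_def)
qed

end

theorem theorem15:
  fixes p :: real and k :: nat and e :: "nat \<Rightarrow> cseq" and f :: "nat \<Rightarrow> real"
  assumes "p > 1"
    and "symmetric_basis (lp p) (lp_norm p) e"
    and "k \<ge> 1"
    and "f \<in> S_class k"
  shows "\<not> schauder_basis (lp_diff p k) (lp_diff_norm p k e) single_term \<and>
    (\<exists>T. generates_C0_group (lp_diff p k) (lp_diff_norm p k e) (A_dom p k f) (A_op f) T \<and>
      (\<forall>t. \<forall>c\<in>lp_diff p k.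
        T t c = (\<lambda>n. exp (\<i> * complex_of_real t * complex_of_real (f n)) * c n)))"
proof -
  interpret lp_symmetric_basis p e
    by unfold_locales (use assms in auto)
  show ?thesis
    using not_basis[OF assms(3)] exp_group_generated[OF assms(4)]
    by (auto simp: exp_group_def)
qed

end
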